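(* In the adjacency-list model augmented with $\texttt{JUMP}$, the single-target problem can be solved in $\tilde O(\min\{m,n/\delta\})$ expected time for every target $t$, and in $\tilde O\big(\min\{m,(m/\delta)^{1/2},d/\delta\}\big)$ expected time averaged over all targets $t\in V$, where $d=m/n$.
   Context: Let $G=(V,E)$ be a directed graph with $n=|V|$ nodes and $m=|E|$ edges, $d=m/n$. Fix a constant $\alpha\in(0,1)$. An $\alpha$-discounted random walk from $s$: at each step, with probability $\alpha$ it terminates at the current node, otherwise it moves to a uniformly random out-neighbor of the current node. $\pi(s,t)$ is the probability that such a walk from $s$ terminates at $t$. Adjacency-list model: an algorithm accesses $G$ only through constant-time queries $\texttt{DEG-IN}(u)$, $\texttt{DEG-OUT}(u)$ (in-/out-degree of $u$), $\texttt{IN}(u,i)$, $\texttt{OUT}(u,i)$ ($i$-th in-/out-neighbor of $u$); $\texttt{JUMP}()$ returns a uniformly random node of $V$. Single-target problem: given $G$ (via queries), a target $t\in V$ and $\delta\in(0,1]$, output estimates $\hat\pi(s,t)$ for all $s\in V$ such that for each $s$, $\Pr\{|\hat\pi(s,t)-\pi(s,t)|\ge\varepsilon\max\{\pi(s,t),\delta\}\}\le p_f$, where $\varepsilon,p_f$ are fixed small constants. The average-case time is the maximum over graphs with $n$ nodes and $m$ edges of $\frac1n\sum_{t\in V}$ (expected running time with target $t$). $\tilde O$ suppresses polylogarithmic factors in $n$ and $1/\delta$. *)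

theory Defs
  imports "HOL-Probability.Probability" "Graph_Theory.Pair_Digraph"
begin

section \<open>Graphs given by adjacency lists\<close>

text \<open>Nodes are natural numbers, but the node set is an arbitrary finite set of them, so that
  labels carry no information (in particular, nodes cannot be enumerated without queries).\<close>

record adj_graph =
  dgraph :: "nat pair_pre_digraph"
  in_nbrs :: "nat \<Rightarrow> nat list"
  out_nbrs :: "nat \<Rightarrow> nat list"

text \<open>The order of the neighbours in the lists is arbitrary.  Every node has an out-neighbour, as
  otherwise the move to a random out-neighbour is undefined.\<close>

definition valid_graph :: "adj_graph \<Rightarrow> bool" where
  "valid_graph g \<longleftrightarrow>
     pair_fin_digraph (dgraph g) \<and> pverts (dgraph g) \<noteq> {} \<and>
     (\<forall>u\<in>pverts (dgraph g). \<exists>v. (u, v) \<in> parcs (dgraph g)) \<and>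
     (\<forall>u\<in>pverts (dgraph g).
        distinct (in_nbrs g u) \<and> set (in_nbrs g u) = {v. (v, u) \<in> parcs (dgraph g)} \<and>
        distinct (out_nbrs g u) \<and> set (out_nbrs g u) = {v. (u, v) \<in> parcs (dgraph g)})"

definition graphs :: "nat \<Rightarrow> nat \<Rightarrow> adj_graph set" where
  "graphs n m =
     {g. valid_graph g \<and> card (pverts (dgraph g)) = n \<and> card (parcs (dgraph g)) = m}"


section \<open>Discounted random walks\<close>

datatype walk_state = Walking nat | Terminated nat

fun walk_step :: "real \<Rightarrow> nat pair_pre_digraph \<Rightarrow> walk_state \<Rightarrow> walk_state pmf" where
  "walk_step \<alpha> G (Walking u) =
     bind_pmf (bernoulli_pmf \<alpha>) (\<lambda>stop.
       if stop then return_pmf (Terminated u)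
       else map_pmf Walking (pmf_of_set {v. (u, v) \<in> parcs G}))"
| "walk_step \<alpha> G (Terminated u) = return_pmf (Terminated u)"

fun walk :: "real \<Rightarrow> nat pair_pre_digraph \<Rightarrow> nat \<Rightarrow> nat \<Rightarrow> walk_state pmf" where
  "walk \<alpha> G s 0 = return_pmf (Walking s)"
| "walk \<alpha> G s (Suc k) = bind_pmf (walk \<alpha> G s k) (walk_step \<alpha> G)"

text \<open>The events ``terminated at \<open>t\<close> within \<open>k\<close> steps'' increase with \<open>k\<close>; the
  supremum is the probability of their union.\<close>

definition ppr :: "real \<Rightarrow> nat pair_pre_digraph \<Rightarrow> nat \<Rightarrow> nat \<Rightarrow> real" where
  "ppr \<alpha> G s t = (SUP k. pmf (walk \<alpha> G s k) (Terminated t))"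


section \<open>Randomised RAM programs with graph queries\<close>

text \<open>A program is a fixed piece of syntax working on finitely many named arrays of natural numbers
  and of reals (a scalar is a cell of an array), all cells being initially \<open>0\<close>.  Since the
  expressions are part of the program, evaluating one takes constant time.  Natural numbers only have
  addition and truncated subtraction, reals only field operations and comparison (no
  rounding), and there are no real literals: the only reals available are the inputs and what is
  computed from them.\<close>

type_synonym arr = string

datatype nexp =
    NLit nat
  | NGet arr nexp
  | NAdd nexp nexp
  | NSub nexp nexp

datatype rexp =
    RNat nexp
  | RGet arr nexp
  | RAdd rexp rexp
  | RSub rexp rexp
  | RMul rexp rexp
  | RDiv rexp rexp

datatype bexp =
    BNLess nexp nexp
  | BRLess rexp rexp
  | BNot bexp
  | BAnd bexp bexp

text \<open>In the commands that store a value, the first two arguments are the array and the index of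
  the target cell.\<close>

datatype com =
    SetN arr nexp nexp
  | SetR arr nexp rexp
  | Uniform arr nexp nexp
  | Flip arr nexp rexp
  | DegIn arr nexp nexp
  | DegOut arr nexp nexp
  | InNbr arr nexp nexp nexp
  | OutNbr arr nexp nexp nexp
  | Jump arr nexp
  | Skip
  | Seq com com
  | Cond bexp com com
  | While bexp com

record mem =
  nats :: "arr \<Rightarrow> nat \<Rightarrow> nat"
  reals :: "arr \<Rightarrow> nat \<Rightarrow> real"

fun nval :: "nexp \<Rightarrow> mem \<Rightarrow> nat" where
  "nval (NLit k) \<sigma> = k"
| "nval (NGet a i) \<sigma> = nats \<sigma> a (nval i \<sigma>)"
| "nval (NAdd e f) \<sigma> = nval e \<sigma> + nval f \<sigma>"
| "nval (NSub e f) \<sigma> = nval e \<sigma> - nval f \<sigma>"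

fun rval :: "rexp \<Rightarrow> mem \<Rightarrow> real" where
  "rval (RNat e) \<sigma> = real (nval e \<sigma>)"
| "rval (RGet a i) \<sigma> = reals \<sigma> a (nval i \<sigma>)"
| "rval (RAdd e f) \<sigma> = rval e \<sigma> + rval f \<sigma>"
| "rval (RSub e f) \<sigma> = rval e \<sigma> - rval f \<sigma>"
| "rval (RMul e f) \<sigma> = rval e \<sigma> * rval f \<sigma>"
| "rval (RDiv e f) \<sigma> = rval e \<sigma> / rval f \<sigma>"

fun bval :: "bexp \<Rightarrow> mem \<Rightarrow> bool" where
  "bval (BNLess e f) \<sigma> \<longleftrightarrow> nval e \<sigma> < nval f \<sigma>"
| "bval (BRLess e f) \<sigma> \<longleftrightarrow> rval e \<sigma> < rval f \<sigma>"
| "bval (BNot b) \<sigma> \<longleftrightarrow> \<not> bval b \<sigma>"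
| "bval (BAnd b c) \<sigma> \<longleftrightarrow> bval b \<sigma> \<and> bval c \<sigma>"

definition store_nat :: "arr \<Rightarrow> nexp \<Rightarrow> nat \<Rightarrow> mem \<Rightarrow> mem" where
  "store_nat a i x \<sigma> = \<sigma>\<lparr>nats := (nats \<sigma>)(a := (nats \<sigma> a)(nval i \<sigma> := x))\<rparr>"

definition store_real :: "arr \<Rightarrow> nexp \<Rightarrow> real \<Rightarrow> mem \<Rightarrow> mem" where
  "store_real a i x \<sigma> = \<sigma>\<lparr>reals := (reals \<sigma>)(a := (reals \<sigma> a)(nval i \<sigma> := x))\<rparr>"

definition list_get :: "nat list \<Rightarrow> nat \<Rightarrow> nat" where
  "list_get xs i = (if i < length xs then xs ! i else 0)"

text \<open>A configuration consists of the stack of commands still to be executed (empty once the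
  program has halted), the memory, and the number of steps made so far.\<close>

record config =
  todo :: "com list"
  memory :: mem
  clock :: nat

text \<open>The effect of one step on the stack and the memory.  \<open>Uniform a i e\<close> draws from
  \<open>{0, \<dots>, e - 1}\<close> (from \<open>{0}\<close> if \<open>e = 0\<close>); \<open>Flip a i p\<close> stores
  \<open>1\<close> with probability \<open>p\<close> (clipped to \<open>[0, 1]\<close>) and \<open>0\<close> otherwise; indices into
  neighbour lists start at \<open>0\<close>.\<close>

fun exec1 :: "adj_graph \<Rightarrow> com \<Rightarrow> com list \<Rightarrow> mem \<Rightarrow> (com list \<times> mem) pmf" where
  "exec1 g (SetN a i e) cs \<sigma> = return_pmf (cs, store_nat a i (nval e \<sigma>) \<sigma>)"
| "exec1 g (SetR a i e) cs \<sigma> = return_pmf (cs, store_real a i (rval e \<sigma>) \<sigma>)"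
| "exec1 g (Uniform a i e) cs \<sigma> =
     map_pmf (\<lambda>x. (cs, store_nat a i x \<sigma>)) (pmf_of_set {0..<max 1 (nval e \<sigma>)})"
| "exec1 g (Flip a i p) cs \<sigma> =
     map_pmf (\<lambda>b. (cs, store_nat a i (if b then 1 else 0) \<sigma>))
       (bernoulli_pmf (max 0 (min 1 (rval p \<sigma>))))"
| "exec1 g (DegIn a i u) cs \<sigma> =
     return_pmf (cs, store_nat a i (length (in_nbrs g (nval u \<sigma>))) \<sigma>)"
| "exec1 g (DegOut a i u) cs \<sigma> =
     return_pmf (cs, store_nat a i (length (out_nbrs g (nval u \<sigma>))) \<sigma>)"
| "exec1 g (InNbr a i u j) cs \<sigma> =
     return_pmf (cs, store_nat a i (list_get (in_nbrs g (nval u \<sigma>)) (nval j \<sigma>)) \<sigma>)"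
| "exec1 g (OutNbr a i u j) cs \<sigma> =
     return_pmf (cs, store_nat a i (list_get (out_nbrs g (nval u \<sigma>)) (nval j \<sigma>)) \<sigma>)"
| "exec1 g (Jump a i) cs \<sigma> =
     map_pmf (\<lambda>x. (cs, store_nat a i x \<sigma>)) (pmf_of_set (pverts (dgraph g)))"
| "exec1 g Skip cs \<sigma> = return_pmf (cs, \<sigma>)"
| "exec1 g (Seq c d) cs \<sigma> = return_pmf (c # d # cs, \<sigma>)"
| "exec1 g (Cond b c d) cs \<sigma> = return_pmf ((if bval b \<sigma> then c else d) # cs, \<sigma>)"
| "exec1 g (While b c) cs \<sigma> =
     return_pmf (if bval b \<sigma> then c # While b c # cs else cs, \<sigma>)"

definition step :: "adj_graph \<Rightarrow> config \<Rightarrow> config pmf" where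
  "step g x = (case todo x of
      [] \<Rightarrow> return_pmf x
    | c # cs \<Rightarrow>
        map_pmf (\<lambda>(cs', \<sigma>'). \<lparr>todo = cs', memory = \<sigma>', clock = Suc (clock x)\<rparr>)
          (exec1 g c cs (memory x)))"

fun steps :: "adj_graph \<Rightarrow> nat \<Rightarrow> config \<Rightarrow> config pmf" where
  "steps g 0 x = return_pmf x"
| "steps g (Suc k) x = bind_pmf (steps g k x) (step g)"

definition halted :: "config \<Rightarrow> bool" where
  "halted x \<longleftrightarrow> todo x = []"

definition halt_prob :: "adj_graph \<Rightarrow> com \<Rightarrow> mem \<Rightarrow> (mem \<Rightarrow> bool) \<Rightarrow> real" where
  "halt_prob g prog \<sigma> P =
     (SUP k. measure_pmf.prob (steps g k \<lparr>todo = [prog], memory = \<sigma>, clock = 0\<rparr>)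
        {x. halted x \<and> P (memory x)})"

text \<open>By monotone convergence the supremum of the expected number of steps among the first \<open>k\<close>
  is the expected total number of steps (possibly \<open>\<infinity>\<close>).\<close>

definition expected_time :: "adj_graph \<Rightarrow> com \<Rightarrow> mem \<Rightarrow> ennreal" where
  "expected_time g prog \<sigma> =
     (SUP k. \<integral>\<^sup>+ x. of_nat (clock x)
        \<partial>measure_pmf (steps g k \<lparr>todo = [prog], memory = \<sigma>, clock = 0\<rparr>))"


section \<open>The single-target problem\<close>

text \<open>The program learns the target and the real parameters, but neither the number of nodes nor
  the number of edges.\<close>

definition input_mem :: "real \<Rightarrow> real \<Rightarrow> real \<Rightarrow> real \<Rightarrow> nat \<Rightarrow> mem" where
  "input_mem \<alpha> \<epsilon> p\<^sub>f \<delta> t =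
     \<lparr>nats = (\<lambda>_ _. 0)(''target'' := (\<lambda>_. 0)(0 := t)),
      reals = (\<lambda>_ _. 0)(
        ''alpha'' := (\<lambda>_. 0)(0 := \<alpha>),
        ''epsilon'' := (\<lambda>_. 0)(0 := \<epsilon>),
        ''pf'' := (\<lambda>_. 0)(0 := p\<^sub>f),
        ''delta'' := (\<lambda>_. 0)(0 := \<delta>))\<rparr>"

text \<open>The output is an array indexed by nodes.  Cells that were never written hold the estimate
  \<open>0\<close>, so that the output can be sparse; this is needed as the average-case bound may be
  smaller than the number of nodes.\<close>

definition estimate :: "mem \<Rightarrow> nat \<Rightarrow> real" where
  "estimate \<sigma> s = reals \<sigma> ''estimate'' s"

definition solves_single_target :: "real \<Rightarrow> real \<Rightarrow> real \<Rightarrow> com \<Rightarrow> bool" where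
  "solves_single_target \<alpha> \<epsilon> p\<^sub>f prog \<longleftrightarrow>
     (\<forall>g t \<delta>. valid_graph g \<and> t \<in> pverts (dgraph g) \<and> 0 < \<delta> \<and> \<delta> \<le> 1 \<longrightarrow>
        halt_prob g prog (input_mem \<alpha> \<epsilon> p\<^sub>f \<delta> t) (\<lambda>_. True) = 1 \<and>
        (\<forall>s\<in>pverts (dgraph g).
           halt_prob g prog (input_mem \<alpha> \<epsilon> p\<^sub>f \<delta> t)
             (\<lambda>\<sigma>. \<bar>estimate \<sigma> s - ppr \<alpha> (dgraph g) s t\<bar>
                    \<ge> \<epsilon> * max (ppr \<alpha> (dgraph g) s t) \<delta>) \<le> p\<^sub>f))"

definition target_time :: "real \<Rightarrow> real \<Rightarrow> real \<Rightarrow> com \<Rightarrow> real \<Rightarrow> adj_graph \<Rightarrow> nat \<Rightarrow> ennreal" where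
  "target_time \<alpha> \<epsilon> p\<^sub>f prog \<delta> g t = expected_time g prog (input_mem \<alpha> \<epsilon> p\<^sub>f \<delta> t)"

definition average_case_time ::
  "real \<Rightarrow> real \<Rightarrow> real \<Rightarrow> com \<Rightarrow> real \<Rightarrow> nat \<Rightarrow> nat \<Rightarrow> ennreal" where
  "average_case_time \<alpha> \<epsilon> p\<^sub>f prog \<delta> n m =
     (SUP g\<in>graphs n m.
        (\<Sum>t\<in>pverts (dgraph g). target_time \<alpha> \<epsilon> p\<^sub>f prog \<delta> g t) / of_nat n)"

definition polylog :: "nat \<Rightarrow> nat \<Rightarrow> real \<Rightarrow> real" where
  "polylog k n \<delta> = (1 + ln (real n) + ln (1 / \<delta>)) ^ k"

end

theory Submission
  imports Defs
begin

text \<open>The program combines backward pushes from the target with forward random walks.  Backward pushing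
  maintains reserves \<open>p\<close> and residues \<open>r\<close> such that the error \<open>e = \<pi>(\<cdot>, t) - p\<close> satisfies
  \<open>e(v) = \<alpha> r(v) + (1 - \<alpha>) \<cdot> mean of e over the out-neighbours of v\<close>; that is, \<open>e(v)\<close> is the expected
  residue at the end of a walk from \<open>v\<close>.  A phase with residues at most \<open>M\<close> pushes all nodes of residue
  more than \<open>\<alpha> M / 2\<close>, which lowers the bound to \<open>(1 - \<alpha> / 2) M\<close>; these nodes satisfy
  \<open>\<pi>(u, t) > \<alpha>\<^sup>2 M / 2\<close>, so their total in-degree is at most \<open>m\<close>, and at most \<open>O(d / M)\<close> on average
  over the targets.  Alternatively, \<open>O(1 + M / \<delta>)\<close> walks from each node reduce the error to \<open>\<epsilon> \<delta>\<close>
  by Chebyshev's inequality.  Before each phase the cost of pushing is compared with the cost of the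
  walks, by sampling nodes until either that many steps are spent or the target has been hit \<open>K\<close> times;
  in the latter case a given node is missing with probability at most \<open>2\<^sup>-\<^sup>K\<close>, and the walks are started
  from the sampled nodes.  Each phase thus costs about \<open>min {m, d / M, n (1 + M / \<delta>)}\<close> on average, and
  the geometric mean of the last two terms is \<open>O(\<surd>(m / \<delta>))\<close> while \<open>M \<ge> \<epsilon> \<delta>\<close>.\<close>

section \<open>A calculus for expected running times and probabilities\<close>

text \<open>Two obstacles shape the program. It does not know the number n of nodes, so the cost of
  a push phase can be computed beforehand but that of the walks cannot; and the walks must start
  everywhere although nodes cannot be enumerated. Sampling answers both: the target is a node whose
  hits are recognised for free, its K-th hit comes after K n samples on average, and since failure
  is allowed per node, a constant K is enough. Samples and hits survive from one phase to the next.
  In the analysis each phase is charged either with the push bound or with the walks, by a choice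
  that may depend on n: whatever the program does at random, both charges cover it up to constants.
  So the expected time is bounded by a sum of minima of two deterministic quantities. The failure
  probability is split in halves, one for a node that was never sampled, one for the walks, which
  are run in at most one phase.\<close>

text \<open>The expectation of \<open>f\<close> at the final memory plus \<open>\<tau>\<close> times the number of steps:
  \<open>\<tau> = 1, f = 0\<close> gives the expected time, and \<open>\<tau> = 0\<close> with an indicator gives a probability.
  As loops are least fixed points, all upper bounds come from inductive invariants.\<close>

primrec ert :: "real \<Rightarrow> adj_graph \<Rightarrow> com \<Rightarrow> (mem \<Rightarrow> ennreal) \<Rightarrow> mem \<Rightarrow> ennreal" where
  "ert \<tau> g (SetN a i e) = (\<lambda>f st. ennreal \<tau> + f (store_nat a i (nval e st) st))"
| "ert \<tau> g (SetR a i e) = (\<lambda>f st. ennreal \<tau> + f (store_real a i (rval e st) st))"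
| "ert \<tau> g (Uniform a i e) = (\<lambda>f st. ennreal \<tau> +
     (\<integral>\<^sup>+ x. f (store_nat a i x st) \<partial>measure_pmf (pmf_of_set {0..<max 1 (nval e st)})))"
| "ert \<tau> g (Flip a i p) = (\<lambda>f st. ennreal \<tau> +
     (\<integral>\<^sup>+ b. f (store_nat a i (if b then 1 else 0) st)
        \<partial>measure_pmf (bernoulli_pmf (max 0 (min 1 (rval p st))))))"
| "ert \<tau> g (DegIn a i u) =
     (\<lambda>f st. ennreal \<tau> + f (store_nat a i (length (in_nbrs g (nval u st))) st))"
| "ert \<tau> g (DegOut a i u) =
     (\<lambda>f st. ennreal \<tau> + f (store_nat a i (length (out_nbrs g (nval u st))) st))"
| "ert \<tau> g (InNbr a i u j) =
     (\<lambda>f st. ennreal \<tau> + f (store_nat a i (list_get (in_nbrs g (nval u st)) (nval j st)) st))"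
| "ert \<tau> g (OutNbr a i u j) =
     (\<lambda>f st. ennreal \<tau> + f (store_nat a i (list_get (out_nbrs g (nval u st)) (nval j st)) st))"
| "ert \<tau> g (Jump a i) = (\<lambda>f st. ennreal \<tau> +
     (\<integral>\<^sup>+ x. f (store_nat a i x st) \<partial>measure_pmf (pmf_of_set (pverts (dgraph g)))))"
| "ert \<tau> g Skip = (\<lambda>f st. ennreal \<tau> + f st)"
| "ert \<tau> g (Seq c d) = (\<lambda>f st. ennreal \<tau> + ert \<tau> g c (ert \<tau> g d f) st)"
| "ert \<tau> g (Cond b c d) =
     (\<lambda>f st. ennreal \<tau> + (if bval b st then ert \<tau> g c f st else ert \<tau> g d f st))"
| "ert \<tau> g (While b c) =
     (\<lambda>f. lfp (\<lambda>X st. ennreal \<tau> + (if bval b st then ert \<tau> g c X st else f st)))"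

lemma ert_mono: "f \<le> f' \<Longrightarrow> ert \<tau> g c f \<le> ert \<tau> g c f'"
proof (induction c arbitrary: f f')
  case (While b c)
  then show ?case
    unfolding ert.simps by (intro lfp_mono) (simp add: le_fun_def)
next
  case (Seq c d)
  have "ert \<tau> g c (ert \<tau> g d f) \<le> ert \<tau> g c (ert \<tau> g d f')"
    using Seq.IH Seq.prems by blast
  then show ?case by (auto simp: le_fun_def)
qed (auto simp: le_fun_def simp del: nn_integral_bernoulli_pmf
       intro!: add_left_mono nn_integral_mono)

lemma ert_While_unfold:
  "ert \<tau> g (While b c) f st =
     ennreal \<tau> + (if bval b st then ert \<tau> g c (ert \<tau> g (While b c) f) st else f st)"
proof -
  have "mono (\<lambda>X st. ennreal \<tau> + (if bval b st then ert \<tau> g c X st else f st))"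
    using ert_mono by (auto simp: mono_def le_fun_def)
  from lfp_unfold[OF this] show ?thesis
    by (simp add: fun_eq_iff)
qed

text \<open>Park induction: a pre-fixed point lies above the least one. No termination argument is
  needed; halting is derived later from a finite expected time.\<close>

lemma ert_While_le:
  assumes "\<And>st. ennreal \<tau> + (if bval b st then ert \<tau> g c I st else f st) \<le> I st"
  shows "ert \<tau> g (While b c) f st \<le> I st"
  using lfp_lowerbound[of "\<lambda>X st. ennreal \<tau> + (if bval b st then ert \<tau> g c X st else f st)" I] assms
  by (simp add: le_fun_def)


subsection \<open>Soundness\<close>

text \<open>The pending commands are read as nested continuations, which links the small-step
  machine to the structural recursion of \<open>ert\<close>.\<close>

definition ert_stack :: "real \<Rightarrow> adj_graph \<Rightarrow> com list \<Rightarrow> (mem \<Rightarrow> ennreal) \<Rightarrow> mem \<Rightarrow> ennreal" where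
  "ert_stack \<tau> g cs f = foldr (ert \<tau> g) cs f"

lemma ert_stack_simps [simp]:
  "ert_stack \<tau> g [] f = f"
  "ert_stack \<tau> g (c # cs) f = ert \<tau> g c (ert_stack \<tau> g cs f)"
  by (simp_all add: ert_stack_def)

text \<open>The \<open>\<tau>\<close> under the integral is the clock tick of this step; the loop
  case is one unfolding of the fixed point.\<close>

lemma ert_exec1:
  "(\<integral>\<^sup>+ y. ennreal \<tau> + ert_stack \<tau> g (fst y) f (snd y) \<partial>measure_pmf (exec1 g c cs st)) =
     ert \<tau> g c (ert_stack \<tau> g cs f) st"
proof (cases c)
  case (While b d)
  then show ?thesis
    using ert_While_unfold[of \<tau> g b d "ert_stack \<tau> g cs f" st] by (auto simp del: ert.simps(13))
qed (simp_all add: nn_integral_add measure_pmf.emeasure_space_1)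

definition config_value :: "real \<Rightarrow> adj_graph \<Rightarrow> (mem \<Rightarrow> ennreal) \<Rightarrow> config \<Rightarrow> ennreal" where
  "config_value \<tau> g f x = ennreal \<tau> * of_nat (clock x) + ert_stack \<tau> g (todo x) f (memory x)"

text \<open>Time spent plus expected future value is a martingale: a step moves
  \<open>\<tau>\<close> from the future to the clock, and a halted configuration stays put.\<close>

lemma config_value_step:
  "(\<integral>\<^sup>+ y. config_value \<tau> g f y \<partial>measure_pmf (step g x)) = config_value \<tau> g f x"
proof (cases "todo x")
  case (Cons c cs)
  have "(\<integral>\<^sup>+ y. config_value \<tau> g f y \<partial>measure_pmf (step g x)) =
    (\<integral>\<^sup>+ y. ennreal \<tau> * of_nat (clock x) + (ennreal \<tau> + ert_stack \<tau> g (fst y) f (snd y))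
       \<partial>measure_pmf (exec1 g c cs (memory x)))"
    using Cons by (simp add: step_def config_value_def case_prod_beta algebra_simps)
  also have "\<dots> = ennreal \<tau> * of_nat (clock x) +
    (\<integral>\<^sup>+ y. ennreal \<tau> + ert_stack \<tau> g (fst y) f (snd y) \<partial>measure_pmf (exec1 g c cs (memory x)))"
    by (subst nn_integral_add) (simp_all add: measure_pmf.emeasure_space_1)
  also have "\<dots> = config_value \<tau> g f x"
    by (simp add: ert_exec1 config_value_def Cons)
  finally show ?thesis .
qed (simp add: step_def)

lemma config_value_steps:
  "(\<integral>\<^sup>+ y. config_value \<tau> g f y \<partial>measure_pmf (steps g k x)) = config_value \<tau> g f x"
  by (induction k) (simp_all add: config_value_step)

text \<open>For \<open>\<tau> = 1\<close> the clock is one summand of the martingale, whose mean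
  keeps its initial value; the other summand is nonnegative.\<close>

theorem expected_time_le_ert: "expected_time g c st \<le> ert 1 g c (\<lambda>_. 0) st"
  unfolding expected_time_def
proof (rule SUP_least)
  fix k
  let ?x = "\<lparr>todo = [c], memory = st, clock = 0\<rparr>"
  have "(\<integral>\<^sup>+ x. of_nat (clock x) \<partial>measure_pmf (steps g k ?x)) \<le>
        (\<integral>\<^sup>+ y. config_value 1 g (\<lambda>_. 0) y \<partial>measure_pmf (steps g k ?x))"
    by (intro nn_integral_mono) (simp add: config_value_def)
  then show "(\<integral>\<^sup>+ x. of_nat (clock x) \<partial>measure_pmf (steps g k ?x)) \<le> ert 1 g c (\<lambda>_. 0) st"
    by (simp add: config_value_steps) (simp add: config_value_def)
qed

text \<open>For \<open>\<tau> = 0\<close> a halted configuration is worth exactly its indicator and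
  any other at least 0, so the initial value dominates the probability after any number of
  steps.\<close>

theorem halt_prob_le_ert:
  assumes "ert 0 g c (\<lambda>st'. if P st' then 1 else 0) st \<le> ennreal q" "0 \<le> q"
  shows "halt_prob g c st P \<le> q"
  unfolding halt_prob_def
proof (rule cSUP_least)
  fix k
  let ?x = "\<lparr>todo = [c], memory = st, clock = 0\<rparr>"
  let ?f = "\<lambda>st'. if P st' then 1 else (0::ennreal)"
  have "emeasure (measure_pmf (steps g k ?x)) {x. halted x \<and> P (memory x)} =
      (\<integral>\<^sup>+ y. indicator {x. halted x \<and> P (memory x)} y \<partial>measure_pmf (steps g k ?x))"
    by simp
  also have "\<dots> \<le> (\<integral>\<^sup>+ y. config_value 0 g ?f y \<partial>measure_pmf (steps g k ?x))"
    by (intro nn_integral_mono) (auto simp: config_value_def halted_def indicator_def)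
  also have "\<dots> = ert 0 g c ?f st"
    by (simp add: config_value_steps) (simp add: config_value_def)
  finally show "measure_pmf.prob (steps g k ?x) {x. halted x \<and> P (memory x)} \<le> q"
    using assms by (metis (no_types, lifting) ennreal_le_iff measure_pmf.emeasure_eq_measure order_trans)
qed simp

lemma clock_of_unhalted:
  "y \<in> set_pmf (steps g k x) \<Longrightarrow> \<not> halted y \<Longrightarrow> clock y = clock x + k"
proof (induction k arbitrary: y)
  case (Suc k)
  then obtain z where z: "z \<in> set_pmf (steps g k x)" "y \<in> set_pmf (step g z)" by auto
  then have "\<not> halted z" using Suc.prems by (auto simp: step_def halted_def)
  with z Suc.IH show ?case
    by (cases "todo z") (auto simp: step_def halted_def)
qed simp

text \<open>Markov's inequality: a run that is unhalted after \<open>k\<close> steps shows clock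
  \<open>k\<close>, so this has probability at most \<open>T / k\<close>.\<close>

theorem halt_prob_True_eq_1:
  assumes "expected_time g c st < \<infinity>"
  shows "halt_prob g c st (\<lambda>_. True) = 1"
proof -
  let ?x = "\<lparr>todo = [c], memory = st, clock = 0\<rparr>"
  let ?p = "\<lambda>k. measure_pmf.prob (steps g k ?x) {x. halted x}"
  obtain T where T: "expected_time g c st = ennreal T" "0 \<le> T"
    using assms by (cases "expected_time g c st") auto
  have bound: "real k * (1 - ?p k) \<le> T" for k
  proof -
    have "of_nat k * emeasure (measure_pmf (steps g k ?x)) {x. \<not> halted x} =
      (\<integral>\<^sup>+ y. of_nat k * indicator {x. \<not> halted x} y \<partial>measure_pmf (steps g k ?x))"
      by (simp add: nn_integral_cmult)
    also have "\<dots> \<le> (\<integral>\<^sup>+ y. of_nat (clock y) \<partial>measure_pmf (steps g k ?x))"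
      by (intro nn_integral_mono_AE, subst AE_measure_pmf_iff)
         (auto simp: indicator_def dest!: clock_of_unhalted)
    also have "\<dots> \<le> expected_time g c st"
      unfolding expected_time_def by (rule SUP_upper) simp
    finally have "of_nat k * emeasure (measure_pmf (steps g k ?x)) {x. \<not> halted x} \<le> ennreal T"
      using T by simp
    moreover have "measure_pmf.prob (steps g k ?x) {x. \<not> halted x} = 1 - ?p k"
      using measure_pmf.prob_compl[of "{x. halted x}" "steps g k ?x"]
      by (simp add: Compl_eq_Diff_UNIV[symmetric] Collect_neg_eq)
    ultimately have "ennreal (real k * (1 - ?p k)) \<le> ennreal T"
      by (simp add: measure_pmf.emeasure_eq_measure ennreal_mult'' ennreal_of_nat_eq_real_of_nat)
    then show ?thesis using T by (simp add: ennreal_le_iff)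
  qed
  have bdd: "bdd_above (range ?p)" by (rule bdd_aboveI[of _ 1]) auto
  have "(SUP k. ?p k) \<le> 1" by (rule cSUP_least) auto
  moreover have "1 - e \<le> (SUP k. ?p k)" if "0 < e" for e :: real
  proof -
    obtain k :: nat where k: "T / e < real k" using reals_Archimedean2 by blast
    then have "0 < real k" using T that by (meson divide_nonneg_pos le_less_trans)
    have "real k * (1 - ?p k) \<le> real k * e"
      using bound[of k] k that by (simp add: field_simps)
    then have "1 - e \<le> ?p k" using \<open>0 < real k\<close> by simp
    also have "\<dots> \<le> (SUP k. ?p k)" by (rule cSUP_upper[OF _ bdd]) simp
    finally show ?thesis .
  qed
  ultimately show ?thesis
    unfolding halt_prob_def
    by (simp, metis add.commute diff_le_eq field_le_epsilon antisym)
qed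


subsection \<open>Frames\<close>

primrec writes_nat :: "com \<Rightarrow> arr set" where
  "writes_nat (SetN a i e) = {a}"
| "writes_nat (SetR a i e) = {}"
| "writes_nat (Uniform a i e) = {a}"
| "writes_nat (Flip a i p) = {a}"
| "writes_nat (DegIn a i u) = {a}"
| "writes_nat (DegOut a i u) = {a}"
| "writes_nat (InNbr a i u j) = {a}"
| "writes_nat (OutNbr a i u j) = {a}"
| "writes_nat (Jump a i) = {a}"
| "writes_nat Skip = {}"
| "writes_nat (Seq c d) = writes_nat c \<union> writes_nat d"
| "writes_nat (Cond b c d) = writes_nat c \<union> writes_nat d"
| "writes_nat (While b c) = writes_nat c"

primrec writes_real :: "com \<Rightarrow> arr set" where
  "writes_real (SetN a i e) = {}"
| "writes_real (SetR a i e) = {a}"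
| "writes_real (Uniform a i e) = {}"
| "writes_real (Flip a i p) = {}"
| "writes_real (DegIn a i u) = {}"
| "writes_real (DegOut a i u) = {}"
| "writes_real (InNbr a i u j) = {}"
| "writes_real (OutNbr a i u j) = {}"
| "writes_real (Jump a i) = {}"
| "writes_real Skip = {}"
| "writes_real (Seq c d) = writes_real c \<union> writes_real d"
| "writes_real (Cond b c d) = writes_real c \<union> writes_real d"
| "writes_real (While b c) = writes_real c"

text \<open>Whole arrays are tracked, not cells. Each array has one role in the program, so this
  syntactic footprint settles most side conditions on unchanged data.\<close>

definition frame :: "com \<Rightarrow> mem \<Rightarrow> mem \<Rightarrow> bool" where
  "frame c st st' \<longleftrightarrow> (\<forall>a. a \<notin> writes_nat c \<longrightarrow> nats st' a = nats st a) \<and>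
                    (\<forall>a. a \<notin> writes_real c \<longrightarrow> reals st' a = reals st a)"

lemma frame_refl [simp]: "frame c st st"
  by (simp add: frame_def)

lemma frame_trans: "frame c st st' \<Longrightarrow> frame c st' st'' \<Longrightarrow> frame c st st''"
  by (simp add: frame_def)

lemma store_simps [simp]:
  "nats (store_nat a i x st) = (nats st)(a := (nats st a)(nval i st := x))"
  "reals (store_nat a i x st) = reals st"
  "nats (store_real a i y st) = nats st"
  "reals (store_real a i y st) = (reals st)(a := (reals st a)(nval i st := y))"
  by (simp_all add: store_nat_def store_real_def)

text \<open>In the loop case the candidate bound is infinite off the frame, so that
  \<open>ert_While_le\<close> has to be checked only where the frame condition holds.\<close>

lemma ert_frame_mono:
  "(\<And>st'. frame c st st' \<Longrightarrow> f st' \<le> f' st') \<Longrightarrow> ert \<tau> g c f st \<le> ert \<tau> g c f' st"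
proof (induction c arbitrary: f f' st)
  case (Seq c d)
  have "ert \<tau> g c (ert \<tau> g d f) st \<le> ert \<tau> g c (ert \<tau> g d f') st"
    by (rule Seq.IH(1), rule Seq.IH(2), rule Seq.prems) (auto simp: frame_def)
  then show ?case by (simp add: add_left_mono)
next
  case (Cond b c d)
  have "ert \<tau> g c f st \<le> ert \<tau> g c f' st" "ert \<tau> g d f st \<le> ert \<tau> g d f' st"
    by (rule Cond.IH, rule Cond.prems, simp add: frame_def)+
  then show ?case by (simp add: add_left_mono)
next
  case (While b c)
  let ?I = "\<lambda>st'. if frame c st st' then ert \<tau> g (While b c) f' st' else \<infinity>"
  have "ert \<tau> g (While b c) f st \<le> ?I st"
  proof (rule ert_While_le[where I = ?I])
    fix st'
    show "ennreal \<tau> + (if bval b st' then ert \<tau> g c ?I st' else f st') \<le> ?I st'"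
    proof (cases "frame c st st'")
      case True
      have "ert \<tau> g c ?I st' \<le> ert \<tau> g c (ert \<tau> g (While b c) f') st'"
        by (rule While.IH) (auto dest: frame_trans[OF True])
      moreover have "f st' \<le> f' st'"
        using While.prems True by (simp add: frame_def)
      ultimately show ?thesis
        using True by (subst (2) ert_While_unfold) (auto simp del: ert.simps intro: add_left_mono)
    qed simp
  qed
  then show ?case by (simp del: ert.simps)
qed (auto simp: frame_def simp del: nn_integral_bernoulli_pmf
       intro!: add_left_mono nn_integral_mono)


subsection \<open>Triples for parts whose running time and outcome are bounded surely\<close>

text \<open>Stated through continuations, one triple serves both for time and for probabilities. As
  \<open>f\<close> may be infinite off \<open>Q\<close>, it forces \<open>Q\<close> almost surely at
  the end. The bound \<open>B\<close> is a single constant, so whatever later code has to know must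
  be part of \<open>Q\<close>.\<close>

definition triple :: "adj_graph \<Rightarrow> mem \<Rightarrow> com \<Rightarrow> real \<Rightarrow> (mem \<Rightarrow> bool) \<Rightarrow> bool" where
  "triple g st c T Q \<longleftrightarrow> 0 \<le> T \<and>
     (\<forall>\<tau> f B. 0 \<le> \<tau> \<longrightarrow> 0 \<le> B \<longrightarrow> (\<forall>st'. Q st' \<longrightarrow> f st' \<le> ennreal B) \<longrightarrow>
        ert \<tau> g c f st \<le> ennreal (\<tau> * T + B))"

lemma tripleD:
  assumes "triple g st c T Q" "0 \<le> \<tau>" "0 \<le> B" "\<And>st'. Q st' \<Longrightarrow> f st' \<le> ennreal B" "\<tau> * T + B \<le> B'"
  shows "ert \<tau> g c f st \<le> ennreal B'"
  using assms unfolding triple_def by (meson ennreal_leI order_trans)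

lemma triple_weaken:
  assumes "triple g st c T Q" "T \<le> T'" "\<And>st'. frame c st st' \<Longrightarrow> Q st' \<Longrightarrow> Q' st'"
  shows "triple g st c T' Q'"
  unfolding triple_def
proof (intro conjI allI impI)
  show "0 \<le> T'" using assms by (simp add: triple_def)
  fix \<tau> B :: real and f
  assume *: "0 \<le> \<tau>" "0 \<le> B" "\<forall>st'. Q' st' \<longrightarrow> f st' \<le> ennreal B"
  have "ert \<tau> g c f st \<le> ert \<tau> g c (\<lambda>st'. if frame c st st' then f st' else 0) st"
    by (rule ert_frame_mono) simp
  also have "\<dots> \<le> ennreal (\<tau> * T' + B)"
    by (rule tripleD[OF assms(1) *(1,2)]) (use * assms(2,3) in \<open>auto simp: mult_left_mono\<close>)
  finally show "ert \<tau> g c f st \<le> ennreal (\<tau> * T' + B)" .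
qed

lemma ennreal_add_le:
  "0 \<le> a \<Longrightarrow> 0 \<le> b \<Longrightarrow> x \<le> ennreal b \<Longrightarrow> ennreal a + x \<le> ennreal (a + b)"
  by (simp add: ennreal_plus add_left_mono)

lemma triple_atomic:
  assumes "\<And>\<tau> f. ert \<tau> g c f st = ennreal \<tau> + f st'" "Q st'"
  shows "triple g st c 1 Q"
  using assms by (auto simp: triple_def ennreal_add_le)

lemma triple_Seq:
  assumes "triple g st c T (\<lambda>st'. triple g st' d T' Q)" "0 \<le> T'"
  shows "triple g st (Seq c d) (1 + T + T') Q"
  unfolding triple_def
proof (intro conjI allI impI)
  show "0 \<le> 1 + T + T'" using assms by (simp add: triple_def)
  fix \<tau> B :: real and f
  assume *: "0 \<le> \<tau>" "0 \<le> B" "\<forall>st'. Q st' \<longrightarrow> f st' \<le> ennreal B"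
  have "ert \<tau> g c (ert \<tau> g d f) st \<le> ennreal (\<tau> * T + (\<tau> * T' + B))"
  proof (rule tripleD[OF assms(1) *(1)])
    show "ert \<tau> g d f st' \<le> ennreal (\<tau> * T' + B)" if "triple g st' d T' Q" for st'
      using tripleD[OF that] * by blast
  qed (use * assms in auto)
  moreover have "0 \<le> \<tau> * T + (\<tau> * T' + B)"
    using * assms by (simp add: triple_def)
  ultimately have "ert \<tau> g (Seq c d) f st \<le> ennreal (\<tau> + (\<tau> * T + (\<tau> * T' + B)))"
    using *(1) by (simp add: ennreal_add_le)
  then show "ert \<tau> g (Seq c d) f st \<le> ennreal (\<tau> * (1 + T + T') + B)"
    by (simp add: algebra_simps)
qed

text \<open>A known total \<open>T\<close> is spent from the left instead of being summed up from
  the parts. With the rules below, \<open>intro\<close> then runs through straight-line code and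
  leaves only numerals and memory updates.\<close>

lemma triple_ticks:
  assumes "\<And>\<tau> f. ert \<tau> g c f st = of_nat k * ennreal \<tau> + ert \<tau> g d f st'"
    "triple g st' d (T - real k) Q"
  shows "triple g st c T Q"
  unfolding triple_def
proof (intro conjI allI impI)
  have T: "real k \<le> T" using assms(2) by (simp add: triple_def)
  then show "0 \<le> T" by simp
  fix \<tau> B :: real and f
  assume *: "0 \<le> \<tau>" "0 \<le> B" "\<forall>st'. Q st' \<longrightarrow> f st' \<le> ennreal B"
  have "ennreal (real k * \<tau>) + ert \<tau> g d f st' \<le> ennreal (real k * \<tau> + (\<tau> * (T - real k) + B))"
    using * T by (intro ennreal_add_le tripleD[OF assms(2) *(1,2)]) auto
  then show "ert \<tau> g c f st \<le> ennreal (\<tau> * T + B)"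
    using *(1) by (simp add: assms(1) algebra_simps ennreal_mult' ennreal_of_nat_eq_real_of_nat)
qed

definition moves :: "adj_graph \<Rightarrow> com \<Rightarrow> mem \<Rightarrow> mem \<Rightarrow> bool" where
  "moves g c st st' \<longleftrightarrow> (\<forall>\<tau> f. ert \<tau> g c f st = ennreal \<tau> + f st')"

lemma triple_moves: "moves g c st st' \<Longrightarrow> Q st' \<Longrightarrow> 1 \<le> T \<Longrightarrow> triple g st c T Q"
  by (rule triple_weaken[OF triple_atomic]) (auto simp: moves_def)

lemma triple_moves_Seq:
  "moves g c st st' \<Longrightarrow> triple g st' d (T - 2) Q \<Longrightarrow> triple g st (Seq c d) T Q"
  by (rule triple_ticks[where k = 2]) (auto simp: moves_def mult_2)

text \<open>\<open>triple_Cond_Seq\<close> copies the continuation behind each branch, which creates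
  left-nested sequences; this rule consumes them.\<close>

lemma triple_moves_Seq_Seq:
  "moves g c st st' \<Longrightarrow> triple g st' (Seq c' d) (T - 2) Q \<Longrightarrow> triple g st (Seq (Seq c c') d) T Q"
  by (rule triple_ticks[where k = 2]) (simp_all add: moves_def mult_2 add.assoc)

lemma triple_Cond_Seq:
  assumes "bval b st \<Longrightarrow> triple g st (Seq c e) (T - 1) Q" "\<not> bval b st \<Longrightarrow> triple g st (Seq d e) (T - 1) Q"
  shows "triple g st (Seq (Cond b c d) e) T Q"
  by (rule triple_ticks[where k = 1 and d = "if bval b st then Seq c e else Seq d e"])
     (use assms in auto)

lemma triple_Cond_end:
  assumes "bval b st \<Longrightarrow> triple g st c (T - 1) Q" "\<not> bval b st \<Longrightarrow> triple g st d (T - 1) Q"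
  shows "triple g st (Cond b c d) T Q"
  by (rule triple_ticks[where k = 1 and d = "if bval b st then c else d"])
     (use assms in auto)

lemma moves_intros:
  "moves g (SetN a i e) st (store_nat a i (nval e st) st)"
  "moves g (SetR a i x) st (store_real a i (rval x st) st)"
  "moves g (DegIn a i u) st (store_nat a i (length (in_nbrs g (nval u st))) st)"
  "moves g (DegOut a i u) st (store_nat a i (length (out_nbrs g (nval u st))) st)"
  "moves g (InNbr a i u j) st (store_nat a i (list_get (in_nbrs g (nval u st)) (nval j st)) st)"
  "moves g (OutNbr a i u j) st (store_nat a i (list_get (out_nbrs g (nval u st)) (nval j st)) st)"
  "moves g Skip st st"
  by (simp_all add: moves_def)

lemmas straight_intros =
  moves_intros[THEN triple_moves_Seq] moves_intros[THEN triple_moves_Seq_Seq]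
  moves_intros[THEN triple_moves] triple_Cond_Seq

text \<open>\<open>V\<close> is variant and remaining time in one: an iteration of cost
  \<open>T st'\<close> must lower it by that cost plus one for the test. This allows amortised
  bounds such as sums of in-degrees.\<close>

lemma triple_While:
  assumes "I st" "\<And>st'. frame c st st' \<Longrightarrow> I st' \<Longrightarrow> 0 \<le> V st'"
    and body: "\<And>st'. frame c st st' \<Longrightarrow> I st' \<Longrightarrow> bval b st' \<Longrightarrow>
       triple g st' c (T st') (\<lambda>st''. frame c st st'' \<longrightarrow> I st'' \<and> V st'' + T st' + 1 \<le> V st')"
    and cost: "\<And>st'. frame c st st' \<Longrightarrow> I st' \<Longrightarrow> bval b st' \<Longrightarrow> T st' + 1 \<le> V st'"
    and post: "\<And>st'. frame c st st' \<Longrightarrow> I st' \<Longrightarrow> \<not> bval b st' \<Longrightarrow> Q st'"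
  shows "triple g st (While b c) (1 + V st) Q"
  unfolding triple_def
proof (intro conjI allI impI)
  show "0 \<le> 1 + V st" using assms(1) assms(2)[of st] by simp
  fix \<tau> B :: real and f
  assume *: "0 \<le> \<tau>" "0 \<le> B" "\<forall>st'. Q st' \<longrightarrow> f st' \<le> ennreal B"
  let ?J = "\<lambda>st'. frame c st st' \<and> I st'"
  let ?P = "\<lambda>st'. if ?J st' then ennreal (\<tau> * (1 + V st') + B) else \<infinity>"
  have "ert \<tau> g (While b c) f st \<le> ?P st"
  proof (rule ert_While_le[where I = ?P])
    fix st'
    show "ennreal \<tau> + (if bval b st' then ert \<tau> g c ?P st' else f st') \<le> ?P st'"
    proof (cases "?J st'")
      case J: True
      then have V: "0 \<le> V st'" using assms(2) by simp
      show ?thesis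
      proof (cases "bval b st'")
        case True
        have T: "triple g st' c (T st') (\<lambda>st''. ?J st'' \<and> V st'' + T st' + 1 \<le> V st')"
          using J True by (intro triple_weaken[OF body]) (auto intro: frame_trans)
        have TV: "T st' + 1 \<le> V st'" using J True cost by blast
        have "ert \<tau> g c ?P st' \<le> ennreal (\<tau> * V st' + B)"
        proof (rule tripleD[OF T *(1)])
          show "0 \<le> \<tau> * (V st' - T st') + B" using * TV by simp
          fix st'' assume a: "?J st'' \<and> V st'' + T st' + 1 \<le> V st'"
          then have "\<tau> * (1 + V st'') \<le> \<tau> * (V st' - T st')"
            using *(1) by (intro mult_left_mono) auto
          then show "?P st'' \<le> ennreal (\<tau> * (V st' - T st') + B)"
            using a by (auto intro!: ennreal_leI)
        qed (simp add: algebra_simps)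
        then have "ennreal \<tau> + ert \<tau> g c ?P st' \<le> ennreal (\<tau> + (\<tau> * V st' + B))"
          using * V by (intro ennreal_add_le) auto
        then show ?thesis using J True by (simp add: algebra_simps)
      next
        case False
        then have "f st' \<le> ennreal (\<tau> * V st' + B)"
          using J post[of st'] * V by (auto intro: order_trans ennreal_leI)
        then have "ennreal \<tau> + f st' \<le> ennreal (\<tau> + (\<tau> * V st' + B))"
          using * V by (intro ennreal_add_le) auto
        then show ?thesis using J False by (simp add: algebra_simps)
      qed
    qed auto
  qed
  then show "ert \<tau> g (While b c) f st \<le> ennreal (\<tau> * (1 + V st) + B)" using assms(1) by simp
qed


section \<open>Graphs and discounted walks\<close>

definition out_mean :: "adj_graph \<Rightarrow> (nat \<Rightarrow> real) \<Rightarrow> nat \<Rightarrow> real" where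
  "out_mean g h v = (\<Sum>w\<in>set (out_nbrs g v). h w) / real (length (out_nbrs g v))"

locale walk_graph =
  fixes g :: adj_graph and \<alpha> :: real
  assumes valid: "valid_graph g" and alpha: "0 < \<alpha>" "\<alpha> < 1"
begin

abbreviation "V \<equiv> pverts (dgraph g)"

lemma wf_fin: "pair_fin_digraph (dgraph g)"
  using valid by (simp add: valid_graph_def)

lemma finite_V [simp]: "finite V"
  using wf_fin by (simp add: pair_fin_digraph_def pair_fin_digraph_axioms_def)

lemma V_nonempty [simp]: "V \<noteq> {}"
  using valid by (simp add: valid_graph_def)

lemma card_V_pos: "0 < card V"
  by (simp add: card_gt_0_iff)

lemma arcs_in_V: "(u, v) \<in> parcs (dgraph g) \<Longrightarrow> u \<in> V \<and> v \<in> V"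
  using wf_fin pair_wf_digraph.arc_fst_in_verts pair_wf_digraph.arc_snd_in_verts
  by (fastforce simp: pair_fin_digraph_def)

lemma set_out_nbrs: "u \<in> V \<Longrightarrow> set (out_nbrs g u) = {v. (u, v) \<in> parcs (dgraph g)}"
  and set_in_nbrs: "u \<in> V \<Longrightarrow> set (in_nbrs g u) = {v. (v, u) \<in> parcs (dgraph g)}"
  and distinct_out_nbrs: "u \<in> V \<Longrightarrow> distinct (out_nbrs g u)"
  and distinct_in_nbrs: "u \<in> V \<Longrightarrow> distinct (in_nbrs g u)"
  using valid by (simp_all add: valid_graph_def)

lemma out_nbrs_nonempty: "u \<in> V \<Longrightarrow> out_nbrs g u \<noteq> []"
  using valid set_out_nbrs[of u] by (force simp: valid_graph_def)

lemma out_nbrs_in_V: "u \<in> V \<Longrightarrow> v \<in> set (out_nbrs g u) \<Longrightarrow> v \<in> V"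
  and in_nbrs_in_V: "u \<in> V \<Longrightarrow> v \<in> set (in_nbrs g u) \<Longrightarrow> v \<in> V"
  by (auto simp: set_out_nbrs set_in_nbrs dest: arcs_in_V)

lemma in_nbrs_iff: "u \<in> V \<Longrightarrow> v \<in> V \<Longrightarrow> v \<in> set (in_nbrs g u) \<longleftrightarrow> u \<in> set (out_nbrs g v)"
  by (simp add: set_out_nbrs set_in_nbrs)

lemma sum_length_in_nbrs: "(\<Sum>u\<in>V. length (in_nbrs g u)) = card (parcs (dgraph g))"
proof -
  have fin: "finite (set (in_nbrs g u))" for u by simp
  have "(\<Sum>u\<in>V. length (in_nbrs g u)) = (\<Sum>u\<in>V. card (set (in_nbrs g u)))"
    by (intro sum.cong) (simp_all add: distinct_in_nbrs distinct_card)
  also have "\<dots> = card (SIGMA u:V. set (in_nbrs g u))"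
    by simp
  also have "\<dots> = card (parcs (dgraph g))"
    by (rule bij_betw_same_card[of prod.swap])
       (auto simp: bij_betw_def set_in_nbrs image_iff dest: arcs_in_V)
  finally show ?thesis .
qed

lemma card_V_le_arcs: "card V \<le> card (parcs (dgraph g))"
proof -
  have "card V \<le> card (fst ` parcs (dgraph g))"
    using valid wf_fin
    by (intro card_mono) (force simp: valid_graph_def pair_fin_digraph_def pair_fin_digraph_axioms_def)+
  also have "\<dots> \<le> card (parcs (dgraph g))"
    using wf_fin by (intro card_image_le) (simp add: pair_fin_digraph_def pair_fin_digraph_axioms_def)
  finally show ?thesis .
qed

section \<open>Averaging over out-neighbours and the maximum principle\<close>

lemma out_mean_cong: "v \<in> V \<Longrightarrow> (\<And>w. w \<in> V \<Longrightarrow> h w = h' w) \<Longrightarrow> out_mean g h v = out_mean g h' v"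
  unfolding out_mean_def by (intro arg_cong2[of _ _ _ _ "(/)"] sum.cong) (auto dest: out_nbrs_in_V)

lemma out_mean_mono: "v \<in> V \<Longrightarrow> (\<And>w. w \<in> V \<Longrightarrow> h w \<le> h' w) \<Longrightarrow> out_mean g h v \<le> out_mean g h' v"
  unfolding out_mean_def by (intro divide_right_mono sum_mono) (auto dest: out_nbrs_in_V)

lemma out_mean_const [simp]: "v \<in> V \<Longrightarrow> out_mean g (\<lambda>_. c) v = c"
  using out_nbrs_nonempty[of v] distinct_out_nbrs[of v] by (simp add: out_mean_def distinct_card)

lemma out_mean_add: "out_mean g (\<lambda>w. h w + h' w) v = out_mean g h v + out_mean g h' v"
  by (simp add: out_mean_def sum.distrib add_divide_distrib)

lemma out_mean_diff: "out_mean g (\<lambda>w. h w - h' w) v = out_mean g h v - out_mean g h' v"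
  by (simp add: out_mean_def sum_subtractf diff_divide_distrib)

lemma out_mean_cmult: "out_mean g (\<lambda>w. c * h w) v = c * out_mean g h v"
  by (simp add: out_mean_def sum_distrib_left)

text \<open>Minimum principle: where \<open>e\<close> is minimal, its mean over the out-neighbours
  is no smaller, and what remains of the equation compares \<open>\<alpha> * z\<close> with
  \<open>\<alpha> * r\<close>. Errors are thus controlled by their linear equation alone, without
  representing them by walks.\<close>

lemma walk_value_lower:
  assumes e: "\<And>v. v \<in> V \<Longrightarrow> e v = \<alpha> * r v + (1 - \<alpha>) * out_mean g e v"
    and r: "\<And>v. v \<in> V \<Longrightarrow> b \<le> r v" and v: "v \<in> V"
  shows "b \<le> e v"
proof -
  define z where "z = Min (e ` V)"
  have "z \<in> e ` V" unfolding z_def by (rule Min_in) auto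
  then obtain x where x: "x \<in> V" "z = e x" by auto
  have zl: "z \<le> e w" if "w \<in> V" for w using that by (simp add: z_def)
  have "z = out_mean g (\<lambda>_. z) x" using x by simp
  also have "\<dots> \<le> out_mean g e x" by (rule out_mean_mono) (use x zl in auto)
  finally have "(1 - \<alpha>) * z \<le> (1 - \<alpha>) * out_mean g e x"
    using alpha by (intro mult_left_mono) auto
  then have "\<alpha> * r x + (1 - \<alpha>) * z \<le> z" using e[OF x(1)] x(2) by linarith
  then have "\<alpha> * r x \<le> \<alpha> * z" by (simp add: algebra_simps)
  then have "b \<le> z" using r[OF x(1)] alpha by simp
  then show ?thesis using zl[OF v] by simp
qed

lemma walk_value_upper:
  assumes e: "\<And>v. v \<in> V \<Longrightarrow> e v = \<alpha> * r v + (1 - \<alpha>) * out_mean g e v"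
    and r: "\<And>v. v \<in> V \<Longrightarrow> r v \<le> b" and v: "v \<in> V"
  shows "e v \<le> b"
proof -
  have "- b \<le> - e v"
    by (rule walk_value_lower[where r = "\<lambda>v. - r v" and e = "\<lambda>v. - e v"])
       (use e r v in \<open>auto simp: out_mean_def sum_negf\<close>)
  then show ?thesis by simp
qed

lemma walk_value_ge_alpha_mult:
  assumes e: "\<And>v. v \<in> V \<Longrightarrow> e v = \<alpha> * r v + (1 - \<alpha>) * out_mean g e v"
    and r: "\<And>v. v \<in> V \<Longrightarrow> 0 \<le> r v" and v: "v \<in> V"
  shows "\<alpha> * r v \<le> e v"
proof -
  have "0 \<le> out_mean g e v"
    unfolding out_mean_def
    by (intro divide_nonneg_nonneg sum_nonneg walk_value_lower[OF e r])
       (use v in \<open>auto dest: out_nbrs_in_V\<close>)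
  then show ?thesis using e[OF v] alpha by simp
qed


subsection \<open>First-step analysis of personalised PageRank\<close>

abbreviation "term_prob s k t \<equiv> pmf (walk \<alpha> (dgraph g) s k) (Terminated t)"

text \<open>\<open>walk\<close> adds steps at the end, first-step analysis at the beginning; for the
  iterates of a single kernel both orders agree.\<close>

lemma walk_from_first_step:
  "bind_pmf (walk_step \<alpha> G x) (\<lambda>y. ((\<lambda>p. bind_pmf p (walk_step \<alpha> G)) ^^ k) (return_pmf y)) =
     ((\<lambda>p. bind_pmf p (walk_step \<alpha> G)) ^^ Suc k) (return_pmf x)"
  by (induction k) (simp_all add: bind_return_pmf bind_return_pmf' flip: bind_assoc_pmf)

lemma walk_eq_funpow:
  "walk \<alpha> G s k = ((\<lambda>p. bind_pmf p (walk_step \<alpha> G)) ^^ k) (return_pmf (Walking s))"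
  by (induction k) simp_all

lemma terminated_funpow:
  "((\<lambda>p. bind_pmf p (walk_step \<alpha> G)) ^^ k) (return_pmf (Terminated u)) = return_pmf (Terminated u)"
  by (induction k) (simp_all add: bind_return_pmf)

lemma term_prob_Suc:
  assumes "s \<in> V"
  shows "term_prob s (Suc k) t = \<alpha> * of_bool (s = t) + (1 - \<alpha>) * out_mean g (\<lambda>v. term_prob v k t) s"
proof -
  let ?it = "\<lambda>y. ((\<lambda>p. bind_pmf p (walk_step \<alpha> (dgraph g))) ^^ k) (return_pmf y)"
  have fin: "finite {v. (s, v) \<in> parcs (dgraph g)}" "{v. (s, v) \<in> parcs (dgraph g)} \<noteq> {}"
    using set_out_nbrs[OF assms] out_nbrs_nonempty[OF assms] by (metis finite_set, metis set_empty)
  have card: "card {v. (s, v) \<in> parcs (dgraph g)} = length (out_nbrs g s)"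
    using set_out_nbrs[OF assms] distinct_out_nbrs[OF assms] by (metis distinct_card)
  have "walk \<alpha> (dgraph g) s (Suc k) = bind_pmf (walk_step \<alpha> (dgraph g) (Walking s)) ?it"
    by (simp only: walk_from_first_step walk_eq_funpow)
  also have "\<dots> = bind_pmf (bernoulli_pmf \<alpha>) (\<lambda>stop. if stop then return_pmf (Terminated s)
       else bind_pmf (pmf_of_set {v. (s, v) \<in> parcs (dgraph g)}) (\<lambda>v. walk \<alpha> (dgraph g) v k))"
    by (auto simp: bind_assoc_pmf bind_map_pmf bind_return_pmf terminated_funpow walk_eq_funpow
        intro!: bind_pmf_cong)
  finally show ?thesis
    using alpha fin
    by (simp add: pmf_bind[of "bernoulli_pmf \<alpha>"] pmf_bind_pmf_of_set out_mean_def card set_out_nbrs[OF assms]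
        split: split_indicator)
qed

lemma term_prob_mono:
  assumes "s \<in> V"
  shows "term_prob s k t \<le> term_prob s (Suc k) t"
  using assms
proof (induction k arbitrary: s)
  case 0
  then show ?case by (simp add: pmf_return)
next
  case (Suc k)
  have "out_mean g (\<lambda>v. term_prob v k t) s \<le> out_mean g (\<lambda>v. term_prob v (Suc k) t) s"
    by (rule out_mean_mono) (use Suc in auto)
  then show ?case
    using alpha unfolding term_prob_Suc[OF Suc.prems] by (simp add: mult_left_mono)
qed

lemma term_prob_tendsto:
  assumes "s \<in> V"
  shows "(\<lambda>k. term_prob s k t) \<longlonglongrightarrow> ppr \<alpha> (dgraph g) s t"
  unfolding ppr_def
  by (rule LIMSEQ_incseq_SUP)
     (auto intro!: incseq_SucI term_prob_mono[OF assms] bdd_aboveI[of _ 1] simp: pmf_le_1)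

text \<open>Both sides of \<open>term_prob_Suc\<close> converge. The result is the residue equation
  of the initial state, with no reserves and residue 1 at \<open>t\<close>.\<close>

lemma ppr_first_step:
  assumes "s \<in> V"
  shows "ppr \<alpha> (dgraph g) s t =
    \<alpha> * of_bool (s = t) + (1 - \<alpha>) * out_mean g (\<lambda>v. ppr \<alpha> (dgraph g) v t) s"
proof -
  have "(\<lambda>k. \<alpha> * of_bool (s = t) + (1 - \<alpha>) * out_mean g (\<lambda>v. term_prob v k t) s) \<longlonglongrightarrow>
    \<alpha> * of_bool (s = t) + (1 - \<alpha>) * out_mean g (\<lambda>v. ppr \<alpha> (dgraph g) v t) s"
    unfolding out_mean_def
    by (intro tendsto_intros term_prob_tendsto)
       (use assms out_nbrs_nonempty in \<open>auto dest: out_nbrs_in_V\<close>)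
  moreover have "(\<lambda>k. \<alpha> * of_bool (s = t) + (1 - \<alpha>) * out_mean g (\<lambda>v. term_prob v k t) s) \<longlonglongrightarrow>
    ppr \<alpha> (dgraph g) s t"
    using LIMSEQ_Suc[OF term_prob_tendsto[OF assms]] by (simp only: term_prob_Suc[OF assms])
  ultimately show ?thesis by (rule LIMSEQ_unique[symmetric])
qed

lemma ppr_nonneg: "s \<in> V \<Longrightarrow> 0 \<le> ppr \<alpha> (dgraph g) s t"
  by (rule LIMSEQ_le_const[OF term_prob_tendsto]) auto

text \<open>Terminations at different nodes are disjoint events. This is what makes pushing cheap on
  average over the targets.\<close>

lemma sum_ppr_le_1:
  assumes "s \<in> V"
  shows "(\<Sum>t\<in>V. ppr \<alpha> (dgraph g) s t) \<le> 1"
proof (rule LIMSEQ_le_const2)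
  show "(\<lambda>k. \<Sum>t\<in>V. term_prob s k t) \<longlonglongrightarrow> (\<Sum>t\<in>V. ppr \<alpha> (dgraph g) s t)"
    by (intro tendsto_sum term_prob_tendsto[OF assms])
  have "(\<Sum>t\<in>V. term_prob s k t) \<le> 1" for k
  proof -
    have "(\<Sum>t\<in>V. term_prob s k t) = (\<Sum>x\<in>Terminated ` V. pmf (walk \<alpha> (dgraph g) s k) x)"
      by (subst sum.reindex) (auto simp: inj_on_def)
    also have "\<dots> = measure_pmf.prob (walk \<alpha> (dgraph g) s k) (Terminated ` V)"
      by (simp add: measure_measure_pmf_finite)
    finally show ?thesis by simp
  qed
  then show "\<exists>N. \<forall>k\<ge>N. (\<Sum>t\<in>V. term_prob s k t) \<le> 1" by blast
qed

end


section \<open>The program\<close>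

abbreviation nvar :: "arr \<Rightarrow> nexp" where "nvar a \<equiv> NGet a (NLit 0)"
abbreviation rvar :: "arr \<Rightarrow> rexp" where "rvar a \<equiv> RGet a (NLit 0)"
abbreviation rlit :: "nat \<Rightarrow> rexp" where "rlit k \<equiv> RNat (NLit k)"
abbreviation setn :: "arr \<Rightarrow> nexp \<Rightarrow> com" where "setn a e \<equiv> SetN a (NLit 0) e"
abbreviation incr :: "arr \<Rightarrow> com" where "incr a \<equiv> SetN a (NLit 0) (NAdd (nvar a) (NLit 1))"
abbreviation block :: "com \<Rightarrow> com \<Rightarrow> com" (infixr ";;" 60) where "c ;; d \<equiv> Seq c d"

text \<open>\<open>amt\<close> freezes the residues to be pushed. A push phase thus acts as one
  linear update of the residue vector, and its cost \<open>c\<close> is known before any push is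
  made.\<close>

definition scan_body :: com where
  "scan_body =
     setn ''u'' (NGet ''list'' (nvar ''i'')) ;;
     Cond (BRLess (RDiv (RMul (rvar ''alpha'') (rvar ''M'')) (rlit 2)) (RGet ''r'' (nvar ''u'')))
       (SetR ''amt'' (nvar ''u'') (RGet ''r'' (nvar ''u'')) ;;
        DegIn ''d'' (NLit 0) (nvar ''u'') ;;
        setn ''c'' (NAdd (nvar ''c'') (nvar ''d'')))
       (SetR ''amt'' (nvar ''u'') (rlit 0)) ;;
     incr ''i''"

definition scan :: com where
  "scan =
     setn ''c'' (NLit 0) ;; setn ''i'' (NLit 0) ;;
     While (BNLess (nvar ''i'') (nvar ''len'')) scan_body"

definition sample_body :: com where
  "sample_body =
     Jump ''x'' (NLit 0) ;;
     SetN ''sample'' (nvar ''N'') (nvar ''x'') ;;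
     incr ''N'' ;;
     Cond (BAnd (BNot (BNLess (nvar ''x'') (nvar ''target'')))
                (BNot (BNLess (nvar ''target'') (nvar ''x''))))
       (incr ''hits'') Skip"

text \<open>With \<open>N + 1\<close>, a sample is taken only if the walks from all samples,
  including the new one, are still covered by \<open>c\<close>.\<close>

definition sample_guard :: "nat \<Rightarrow> bexp" where
  "sample_guard K =
     BAnd (BNLess (nvar ''hits'') (NLit K))
       (BNot (BRLess (RNat (nvar ''c''))
          (RMul (RNat (NAdd (nvar ''N'') (NLit 1)))
             (RAdd (rlit 1) (RDiv (rvar ''M'') (rvar ''delta''))))))"

definition sampling :: "nat \<Rightarrow> com" where
  "sampling K = While (sample_guard K) sample_body"

definition spread_body :: com where
  "spread_body =
     InNbr ''v'' (NLit 0) (nvar ''u'') (nvar ''j'') ;;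
     DegOut ''o'' (NLit 0) (nvar ''v'') ;;
     SetR ''r'' (nvar ''v'') (RAdd (RGet ''r'' (nvar ''v''))
        (RDiv (RMul (RSub (rlit 1) (rvar ''alpha'')) (RGet ''amt'' (nvar ''u''))) (RNat (nvar ''o'')))) ;;
     Cond (BNLess (NGet ''mark'' (nvar ''v'')) (NLit 1))
       (SetN ''mark'' (nvar ''v'') (NLit 1) ;;
        SetN ''list'' (nvar ''len'') (nvar ''v'') ;;
        incr ''len'') Skip ;;
     incr ''j''"

definition push_body :: com where
  "push_body =
     setn ''u'' (NGet ''list'' (nvar ''i'')) ;;
     Cond (BRLess (rlit 0) (RGet ''amt'' (nvar ''u'')))
       (SetR ''p'' (nvar ''u'') (RAdd (RGet ''p'' (nvar ''u''))
          (RMul (rvar ''alpha'') (RGet ''amt'' (nvar ''u'')))) ;;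
        SetR ''estimate'' (nvar ''u'') (RGet ''p'' (nvar ''u'')) ;;
        SetR ''r'' (nvar ''u'') (RSub (RGet ''r'' (nvar ''u'')) (RGet ''amt'' (nvar ''u''))) ;;
        DegIn ''d'' (NLit 0) (nvar ''u'') ;;
        setn ''j'' (NLit 0) ;;
        While (BNLess (nvar ''j'') (nvar ''d'')) spread_body) Skip ;;
     incr ''i''"

text \<open>\<open>L\<close> freezes the length of the list: nodes appended by the pushes of this
  phase wait for the next one.\<close>

definition push :: com where
  "push =
     setn ''L'' (nvar ''len'') ;; setn ''i'' (NLit 0) ;;
     While (BNLess (nvar ''i'') (nvar ''L'')) push_body ;;
     SetR ''M'' (NLit 0) (RMul (rvar ''M'') (RSub (rlit 1) (RDiv (rvar ''alpha'') (rlit 2))))"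

definition walk_body :: com where
  "walk_body =
     DegOut ''o'' (NLit 0) (nvar ''x'') ;;
     Uniform ''j'' (NLit 0) (nvar ''o'') ;;
     OutNbr ''x'' (NLit 0) (nvar ''x'') (nvar ''j'') ;;
     Flip ''b'' (NLit 0) (rvar ''alpha'')"

definition walk_once :: com where
  "walk_once =
     setn ''x'' (NGet ''sample'' (nvar ''i'')) ;;
     Flip ''b'' (NLit 0) (rvar ''alpha'') ;;
     While (BNLess (nvar ''b'') (NLit 1)) walk_body ;;
     SetR ''S'' (NLit 0) (RAdd (rvar ''S'') (RGet ''r'' (nvar ''x''))) ;;
     incr ''w''"

text \<open>Reals offer no rounding; comparing products makes the loop run exactly
  \<open>num_walks M\<close> times.\<close>

definition walk_guard :: bexp where
  "walk_guard = BRLess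
     (RMul (RNat (nvar ''w''))
        (RMul (RMul (rvar ''epsilon'') (rvar ''epsilon'')) (RMul (rvar ''delta'') (rvar ''pf''))))
     (RMul (rlit 2) (rvar ''M''))"

definition mc_body :: com where
  "mc_body =
     setn ''w'' (NLit 0) ;; SetR ''S'' (NLit 0) (rlit 0) ;;
     While walk_guard walk_once ;;
     SetR ''estimate'' (NGet ''sample'' (nvar ''i''))
        (RAdd (RGet ''p'' (NGet ''sample'' (nvar ''i''))) (RDiv (rvar ''S'') (RNat (nvar ''w'')))) ;;
     incr ''i''"

text \<open>\<open>M\<close> doubles as exit flag: 0 is below \<open>\<epsilon> * \<delta>\<close>,
  so \<open>main_loop\<close> ends afterwards.\<close>

definition monte_carlo :: com where
  "monte_carlo =
     setn ''i'' (NLit 0) ;;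
     While (BNLess (nvar ''i'') (nvar ''N'')) mc_body ;;
     SetR ''M'' (NLit 0) (rlit 0)"

text \<open>\<open>N\<close>, \<open>hits\<close> and the sampled nodes are not reset: a phase
  continues the sampling of its predecessors.\<close>

definition phase :: "nat \<Rightarrow> com" where
  "phase K =
     scan ;; sampling K ;; Cond (BNLess (nvar ''hits'') (NLit K)) push monte_carlo"

definition main_loop :: "nat \<Rightarrow> com" where
  "main_loop K = While (BNot (BRLess (rvar ''M'') (RMul (rvar ''epsilon'') (rvar ''delta'')))) (phase K)"

definition main :: "nat \<Rightarrow> com" where
  "main K =
     SetR ''r'' (nvar ''target'') (rlit 1) ;;
     SetN ''list'' (NLit 0) (nvar ''target'') ;;
     setn ''len'' (NLit 1) ;;
     SetN ''mark'' (nvar ''target'') (NLit 1) ;;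
     SetR ''M'' (NLit 0) (rlit 1) ;;
     main_loop K"

subsection \<open>Scanning\<close>

abbreviation nv :: "mem \<Rightarrow> arr \<Rightarrow> nat" where "nv st a \<equiv> nats st a 0"
abbreviation rv :: "mem \<Rightarrow> arr \<Rightarrow> real" where "rv st a \<equiv> reals st a 0"

definition scan_amt :: "mem \<Rightarrow> nat \<Rightarrow> real" where
  "scan_amt st v = (if rv st ''alpha'' * rv st ''M'' / 2 < reals st ''r'' v then reals st ''r'' v else 0)"

definition scan_cost :: "adj_graph \<Rightarrow> mem \<Rightarrow> nat \<Rightarrow> nat" where
  "scan_cost g st v =
     (if rv st ''alpha'' * rv st ''M'' / 2 < reals st ''r'' v then length (in_nbrs g v) else 0)"

lemma triple_scan:
  "triple g st scan (6 + 20 * real (nv st ''len''))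
     (\<lambda>st'. nv st' ''c'' = (\<Sum>j<nv st ''len''. scan_cost g st (nats st ''list'' j)) \<and>
       (\<forall>j<nv st ''len''. reals st' ''amt'' (nats st ''list'' j) = scan_amt st (nats st ''list'' j)))"
  (is "triple _ _ _ _ ?Q")
proof -
  let ?b = "BNLess (nvar ''i'') (nvar ''len'')"
  have loop: "triple g st1 (While ?b scan_body)
        (1 + 20 * real (nv st ''len'')) ?Q"
    if "nv st1 ''i'' = 0" "nv st1 ''c'' = 0" "nats st1 ''list'' = nats st ''list''"
      "nats st1 ''len'' = nats st ''len''" "reals st1 = reals st" for st1
  proof -
    let ?I = "\<lambda>st'. nv st' ''i'' \<le> nv st ''len'' \<and>
       nv st' ''c'' = (\<Sum>j<nv st' ''i''. scan_cost g st (nats st ''list'' j)) \<and>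
       (\<forall>j<nv st' ''i''. reals st' ''amt'' (nats st ''list'' j) = scan_amt st (nats st ''list'' j))"
    \<comment> \<open>20 is the 19 of the body plus the test; 19 itself is rounded up
      generously.\<close>
    let ?V = "\<lambda>st'. 20 * (real (nv st ''len'') - real (nv st' ''i''))"
    have body: "triple g st' scan_body 19 (\<lambda>st''. ?I st'' \<and> ?V st'' + 19 + 1 \<le> ?V st')"
      if I: "?I st'" and fr: "frame scan_body st1 st'" and b: "nv st' ''i'' < nv st' ''len''" for st'
    proof -
      have fr': "nats st' ''list'' = nats st ''list''" "nats st' ''len'' = nats st ''len''"
        "reals st' ''alpha'' = reals st ''alpha''" "reals st' ''M'' = reals st ''M''"
        "reals st' ''r'' = reals st ''r''"
        using fr that \<open>nats st1 ''list'' = nats st ''list''\<close> \<open>nats st1 ''len'' = nats st ''len''\<close> \<open>reals st1 = reals st\<close>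
        by (simp_all add: frame_def scan_body_def)
      show ?thesis
        unfolding scan_body_def
        by (intro straight_intros)
           (use I b fr' in \<open>auto simp: scan_amt_def scan_cost_def less_Suc_eq\<close>)
    qed
    have "triple g st1 (While ?b scan_body) (1 + ?V st1) ?Q"
    proof (rule triple_While[where I = ?I and T = "\<lambda>_. 19"])
      show "?I st1" using that by simp
      show "triple g st' scan_body 19 (\<lambda>st''. frame scan_body st1 st'' \<longrightarrow> ?I st'' \<and> ?V st'' + 19 + 1 \<le> ?V st')"
        if "frame scan_body st1 st'" "?I st'" "bval ?b st'" for st'
        using that by (intro triple_weaken[OF body]) auto
      have fr': "nats st' ''len'' = nats st ''len''" if "frame scan_body st1 st'" for st'
        using that \<open>nats st1 ''len'' = nats st ''len''\<close> by (simp add: frame_def scan_body_def)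
      show "19 + 1 \<le> ?V st'" 
        if "frame scan_body st1 st'" "?I st'" "bval ?b st'" for st'
        using that fr'[OF that(1)] by simp
      show "?Q st'" 
        if "frame scan_body st1 st'" "?I st'" "\<not> bval ?b st'" for st'
        using that fr'[OF that(1)] by simp
    qed auto
    then show ?thesis using that by simp
  qed
  show ?thesis
    unfolding scan_def
    by (intro straight_intros triple_weaken[OF loop]) auto
qed


subsection \<open>Pushing\<close>

definition touched :: "mem \<Rightarrow> nat list" where
  "touched st = map (nats st ''list'') [0..<nv st ''len'']"

lemma length_touched [simp]: "length (touched st) = nv st ''len''"
  by (simp add: touched_def)

lemma touched_nth: "j < nv st ''len'' \<Longrightarrow> touched st ! j = nats st ''list'' j"
  by (simp add: touched_def)

section \<open>The list of touched nodes and the push from a single node\<close>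

context walk_graph
begin

definition touched_ok :: "mem \<Rightarrow> bool" where
  "touched_ok st \<longleftrightarrow> distinct (touched st) \<and> set (touched st) \<subseteq> V \<and>
     (\<forall>v. nats st ''mark'' v = of_bool (v \<in> set (touched st)))"

lemma touched_ok_cong:
  assumes "nats st' ''list'' = nats st ''list''" "nats st' ''len'' = nats st ''len''"
    "nats st' ''mark'' = nats st ''mark''"
  shows "touched st' = touched st" "touched_ok st' = touched_ok st"
  using assms by (simp_all add: touched_ok_def touched_def)

text \<open>In-neighbour lists are distinct, so each in-neighbour receives its share once. The
  in-degree also bounds the growth of the touched list, which limits what the new entries cost in
  later phases.\<close>

lemma triple_spread:
  assumes ok: "touched_ok st" and u: "nv st ''u'' = u" "u \<in> V" and d: "nv st ''d'' = length (in_nbrs g u)"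
    and j: "nv st ''j'' = 0" and al: "rv st ''alpha'' = \<alpha>"
  shows "triple g st (While (BNLess (nvar ''j'') (nvar ''d'')) spread_body)
    (1 + 25 * real (length (in_nbrs g u)))
    (\<lambda>st'. touched_ok st' \<and> set (in_nbrs g u) \<subseteq> set (touched st') \<and>
       (\<exists>xs. touched st' = touched st @ xs \<and> length xs \<le> length (in_nbrs g u)) \<and>
       (\<forall>v. reals st' ''r'' v = reals st ''r'' v + (if v \<in> set (in_nbrs g u)
          then (1 - \<alpha>) * reals st ''amt'' u / real (length (out_nbrs g v)) else 0)))"
  (is "triple _ _ _ _ ?Q")
proof -
  let ?I = "\<lambda>st'. nv st' ''j'' \<le> length (in_nbrs g u) \<and>
     touched_ok st' \<and> set (take (nv st' ''j'') (in_nbrs g u)) \<subseteq> set (touched st') \<and>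
       (\<exists>xs. touched st' = touched st @ xs \<and> length xs \<le> nv st' ''j'') \<and>
       (\<forall>v. reals st' ''r'' v = reals st ''r'' v + (if v \<in> set (take (nv st' ''j'') (in_nbrs g u))
          then (1 - \<alpha>) * reals st ''amt'' u / real (length (out_nbrs g v)) else 0))"
  let ?W = "\<lambda>st'. 25 * (real (length (in_nbrs g u)) - real (nv st' ''j''))"
  have fr: "nats st' ''u'' = nats st ''u''" "nats st' ''d'' = nats st ''d''"
    "reals st' ''alpha'' = reals st ''alpha''" "reals st' ''amt'' = reals st ''amt''"
    if "frame spread_body st st'" for st'
    using that by (simp_all add: frame_def spread_body_def)
  have body: "triple g st' spread_body 24 (\<lambda>st''. ?I st'' \<and> ?W st'' + 24 + 1 \<le> ?W st')"
    if "frame spread_body st st'" and I: "?I st'" and b: "nv st' ''j'' < length (in_nbrs g u)" for st'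
  proof -
    note fr' = fr[OF that(1)]
    define v where "v = in_nbrs g u ! nv st' ''j''"
    have v: "v \<in> V" using in_nbrs_in_V[OF u(2)] b by (simp add: v_def)
    \<comment> \<open>\<open>v\<close> is new among the neighbours served so far, so the case
      distinction in the invariant changes at \<open>v\<close> only.\<close>
    have vn: "v \<notin> set (take (nv st' ''j'') (in_nbrs g u))"
      using distinct_in_nbrs[OF u(2)] b
      by (metis distinct_take id_take_nth_drop not_distinct_conv_prefix take_Suc_conv_app_nth v_def)
    have get: "list_get (in_nbrs g u) (nv st' ''j'') = v" using b by (simp add: list_get_def v_def)
    have tk: "take (Suc (nv st' ''j'')) (in_nbrs g u) = take (nv st' ''j'') (in_nbrs g u) @ [v]"
      using b by (simp add: take_Suc_conv_app_nth v_def)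
    obtain xs where xs: "touched st' = touched st @ xs" "length xs \<le> nv st' ''j''" using I by blast
    have mark: "nats st' ''mark'' v = of_bool (v \<in> set (touched st'))"
      using I by (simp add: touched_ok_def)
    have "triple g st' spread_body 24 (\<lambda>st''. nv st'' ''j'' = Suc (nv st' ''j'') \<and>
      reals st'' ''r'' = (reals st' ''r'')(v := reals st' ''r'' v +
         (1 - \<alpha>) * reals st ''amt'' u / real (length (out_nbrs g v))) \<and>
      (if v \<in> set (touched st')
       then nats st'' ''list'' = nats st' ''list'' \<and> nats st'' ''len'' = nats st' ''len'' \<and>
         nats st'' ''mark'' = nats st' ''mark''
       else nats st'' ''list'' = (nats st' ''list'')(nv st' ''len'' := v) \<and>
         nv st'' ''len'' = Suc (nv st' ''len'') \<and> nats st'' ''mark'' = (nats st' ''mark'')(v := 1)))"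
      unfolding spread_body_def
      by (intro straight_intros) (auto simp: fr' u al get mark)
    then show ?thesis
    proof (rule triple_weaken, goal_cases)
      case (2 st'')
      have t: "touched st'' = touched st' @ (if v \<in> set (touched st') then [] else [v])"
        using 2(2) by (auto simp: touched_def split: if_splits)
      have "touched_ok st''"
        using 2(2) I v unfolding touched_ok_def t by (auto split: if_splits)
      moreover have "?I st''" if "touched_ok st''"
        using that 2(2) I b xs vn unfolding t by (auto simp: tk)
      ultimately show ?case using 2(2) by simp
    qed simp
  qed
  have "triple g st (While (BNLess (nvar ''j'') (nvar ''d'')) spread_body) (1 + ?W st) ?Q"
  proof (rule triple_While[where I = ?I and T = "\<lambda>_. 24"], goal_cases)
    case (3 st')
    show ?case by (rule triple_weaken[OF body]) (use 3 fr[of st'] d u in auto)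
  next
    case (4 st')
    then show ?case using fr(2)[of st'] d u by auto
  next
    case (5 st')
    then show ?case using fr(2)[of st'] d u by auto
  qed (use ok j in auto)
  then show ?thesis using j by simp
qed

end

section \<open>A push phase as a simultaneous update\<close>

context walk_graph
begin

definition pushed :: "mem \<Rightarrow> nat \<Rightarrow> nat \<Rightarrow> real" where
  "pushed st k v = (if v \<in> set (take k (touched st)) then reals st ''amt'' v else 0)"

text \<open>Pushing runs along in-arcs, the residue equation along out-arcs. A push from
  \<open>u\<close> is seen here as the mean of a point mass, so that a phase adds up to one
  application of \<open>out_mean\<close>.\<close>

lemma out_mean_single:
  assumes "u \<in> V" "v \<in> V"
  shows "out_mean g (\<lambda>w. if w = u then x else 0) v =
    (if v \<in> set (in_nbrs g u) then x / real (length (out_nbrs g v)) else 0)"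
  using assms by (simp add: out_mean_def in_nbrs_iff)

lemma pushed_Suc:
  assumes "distinct (touched st)" "k < nv st ''len''"
  shows "pushed st (Suc k) =
    (\<lambda>v. pushed st k v + (if v = touched st ! k then reals st ''amt'' v else 0))"
proof -
  have "take (Suc k) (touched st) = take k (touched st) @ [touched st ! k]"
    using assms by (simp add: take_Suc_conv_app_nth)
  moreover from this have "touched st ! k \<notin> set (take k (touched st))"
    using assms(1) by (metis distinct_take not_distinct_conv_prefix)
  ultimately show ?thesis by (auto simp: pushed_def fun_eq_iff)
qed

definition push_cost :: "mem \<Rightarrow> nat \<Rightarrow> nat" where
  "push_cost st v = (if 0 < reals st ''amt'' v then length (in_nbrs g v) else 0)"

definition push_result :: "mem \<Rightarrow> nat \<Rightarrow> mem \<Rightarrow> bool" where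
  "push_result st k st' \<longleftrightarrow>
     touched_ok st' \<and> (\<forall>v. reals st' ''r'' v \<noteq> 0 \<longrightarrow> v \<in> set (touched st')) \<and>
     (\<exists>xs. touched st' = touched st @ xs \<and> length xs \<le> (\<Sum>j<k. push_cost st (touched st ! j))) \<and>
     (\<forall>v. reals st' ''p'' v = reals st ''p'' v + \<alpha> * pushed st k v) \<and>
     (\<forall>v. reals st' ''estimate'' v = reals st' ''p'' v) \<and>
     (\<forall>v\<in>V. reals st' ''r'' v = reals st ''r'' v - pushed st k v + (1 - \<alpha>) * out_mean g (pushed st k) v)"

lemma triple_push_body:
  assumes ok: "touched_ok st" and amt: "\<And>j. j < nv st ''len'' \<Longrightarrow> 0 \<le> reals st ''amt'' (touched st ! j)"
    and fr: "reals st' ''alpha'' = (\<lambda>_. 0)(0 := \<alpha>)" "reals st' ''amt'' = reals st ''amt''"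
    and k: "nv st' ''i'' = k" "k < nv st ''len''" and res: "push_result st k st'"
  shows "triple g st' push_body (29 + 25 * real (push_cost st (touched st ! k)))
    (\<lambda>st''. nv st'' ''i'' = Suc k \<and> push_result st (Suc k) st'')"
proof -
  define u where "u = touched st ! k"
  have uin: "u \<in> set (touched st)" unfolding u_def using k by (intro nth_mem) simp
  then have u: "u \<in> V" using ok by (auto simp: touched_ok_def)
  obtain xs where xs: "touched st' = touched st @ xs"
    "length xs \<le> (\<Sum>j<k. push_cost st (touched st ! j))"
    using res by (auto simp: push_result_def)
  then have "length (touched st') = nv st ''len'' + length xs" by (metis length_append length_touched)
  \<comment> \<open>The list has only been appended to, so entry \<open>k\<close> is still the
    scanned one.\<close>
  then have len: "nv st ''len'' \<le> nv st' ''len''" by simp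
  have lu: "nats st' ''list'' k = u"
    using touched_nth[of k st'] k len xs(1) by (simp add: nth_append u_def)
  have Suc: "pushed st (Suc k) = (\<lambda>v. pushed st k v + (if v = u then reals st ''amt'' v else 0))"
    using pushed_Suc[of st k] ok k by (simp add: touched_ok_def u_def)
  show ?thesis
  proof (cases "0 < reals st ''amt'' u")
    case False
    \<comment> \<open>Scanned amounts are nonnegative, so a skipped entry contributes
      nothing.\<close>
    then have 0: "reals st ''amt'' u = 0" using amt[of k] k by (simp add: u_def)
    then have P: "pushed st (Suc k) = pushed st k" unfolding Suc by auto
    have "triple g st' push_body (29 + 25 * real (push_cost st (touched st ! k)))
      (\<lambda>st''. nv st'' ''i'' = Suc k \<and> reals st'' = reals st' \<and> nats st'' ''list'' = nats st' ''list'' \<and>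
         nats st'' ''len'' = nats st' ''len'' \<and> nats st'' ''mark'' = nats st' ''mark'')"
      unfolding push_body_def by (intro straight_intros) (use False k lu fr in auto)
    then show ?thesis
    proof (rule triple_weaken, goal_cases)
      case (2 st'')
      then have "touched st'' = touched st'" "touched_ok st'' = touched_ok st'"
        using touched_ok_cong[of st'' st'] by auto
      then show ?case using 2(2) res by (auto simp: push_result_def P)
    qed simp
  next
    case True
    define x where "x = reals st ''amt'' u"
    let ?loop = "While (BNLess (nvar ''j'') (nvar ''d'')) spread_body"
    have rest: "triple g st1 (?loop ;; incr ''i'') (10 + 25 * real (length (in_nbrs g u)))
        (\<lambda>st''. nv st'' ''i'' = Suc k \<and> push_result st (Suc k) st'')"
      if s: "nats st1 ''list'' = nats st' ''list''" "nats st1 ''len'' = nats st' ''len''"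
        "nats st1 ''mark'' = nats st' ''mark''" "nv st1 ''u'' = u" "nv st1 ''j'' = 0"
        "nv st1 ''d'' = length (in_nbrs g u)" "nv st1 ''i'' = k" 
        "reals st1 ''alpha'' = reals st' ''alpha''" "reals st1 ''amt'' = reals st ''amt''"
        "reals st1 ''p'' = (reals st' ''p'')(u := reals st' ''p'' u + \<alpha> * x)"
        "reals st1 ''estimate'' = (reals st' ''estimate'')(u := reals st' ''p'' u + \<alpha> * x)"
        "reals st1 ''r'' = (reals st' ''r'')(u := reals st' ''r'' u - x)" for st1
    proof -
      have t: "touched st1 = touched st'" "touched_ok st1"
        using touched_ok_cong[of st1 st'] s res by (auto simp: push_result_def)
      have al: "rv st1 ''alpha'' = \<alpha>" using s fr by simp
      have "triple g st1 ?loop (1 + 25 * real (length (in_nbrs g u)))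
        (\<lambda>st2. triple g st2 (incr ''i'') 1 (\<lambda>st''. nv st'' ''i'' = Suc k \<and> push_result st (Suc k) st''))"
      proof (rule triple_weaken[OF triple_spread[OF t(2) s(4) u s(6,5) al]], goal_cases)
        case (2 st2)
        then obtain ys where ys: "touched st2 = touched st' @ ys" "length ys \<le> length (in_nbrs g u)"
          using t by auto
        have fr2: "reals st2 ''p'' = reals st1 ''p''" "reals st2 ''estimate'' = reals st1 ''estimate''"
          "nats st2 ''i'' = nats st1 ''i''"
          using 2(1) by (simp_all add: frame_def spread_body_def)
        have r2: "reals st2 ''r'' v = reals st' ''r'' v - (if v = u then x else 0) +
            (if v \<in> set (in_nbrs g u) then (1 - \<alpha>) * x / real (length (out_nbrs g v)) else 0)" for v
          using 2(2) s by (auto simp: x_def)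
        have "push_result st (Suc k) st2"
          unfolding push_result_def
        proof (intro conjI)
          show "touched_ok st2" using 2 by blast
          show "\<forall>v. reals st2 ''r'' v \<noteq> 0 \<longrightarrow> v \<in> set (touched st2)"
          proof (intro allI impI)
            fix v assume a: "reals st2 ''r'' v \<noteq> 0"
            show "v \<in> set (touched st2)"
            proof (cases "v = u \<or> v \<in> set (in_nbrs g u)")
              case True
              then show ?thesis using 2(2) uin ys(1) xs(1) by auto
            next
              case False
              then have "reals st' ''r'' v \<noteq> 0" using a by (simp add: r2)
              then show ?thesis using res ys(1) by (simp add: push_result_def)
            qed
          qed
          show "\<exists>xs. touched st2 = touched st @ xs \<and>
              length xs \<le> (\<Sum>j<Suc k. push_cost st (touched st ! j))"
            using xs ys True by (intro exI[of _ "xs @ ys"]) (simp add: push_cost_def u_def)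
          show "\<forall>v. reals st2 ''p'' v = reals st ''p'' v + \<alpha> * pushed st (Suc k) v"
            using res by (simp add: push_result_def fr2 s Suc x_def distrib_left)
          show "\<forall>v. reals st2 ''estimate'' v = reals st2 ''p'' v"
            using res by (simp add: push_result_def fr2 s)
          show "\<forall>v\<in>V. reals st2 ''r'' v =
              reals st ''r'' v - pushed st (Suc k) v + (1 - \<alpha>) * out_mean g (pushed st (Suc k)) v"
          proof
            fix v assume v: "v \<in> V"
            have "(\<lambda>w. if w = u then reals st ''amt'' w else 0) = (\<lambda>w. if w = u then x else 0)"
              by (auto simp: x_def)
            then have "out_mean g (pushed st (Suc k)) v = out_mean g (pushed st k) v +
                (if v \<in> set (in_nbrs g u) then x / real (length (out_nbrs g v)) else 0)"
              unfolding Suc out_mean_add using out_mean_single[OF u v, of x] by simp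
            then show "reals st2 ''r'' v =
              reals st ''r'' v - pushed st (Suc k) v + (1 - \<alpha>) * out_mean g (pushed st (Suc k)) v"
              using res v by (simp add: r2 push_result_def Suc x_def distrib_left)
          qed
        qed
        \<comment> \<open>The final \<open>incr\<close> touches none of the data that
          \<open>push_result\<close> mentions.\<close>
        then have "push_result st (Suc k) st3"
          if "reals st3 = reals st2" "nats st3 ''list'' = nats st2 ''list''"
            "nats st3 ''len'' = nats st2 ''len''" "nats st3 ''mark'' = nats st2 ''mark''" for st3
          using touched_ok_cong[OF that(2-4)] that(1) by (simp add: push_result_def)
        then show ?case
          by (intro straight_intros) (simp_all add: fr2 s)
      qed simp
      from triple_Seq[OF this] show ?thesis by (rule triple_weaken) auto
    qed
    show ?thesis
      unfolding push_body_def
      by (intro straight_intros triple_weaken[OF rest])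
         (use True k lu fr in \<open>auto simp: x_def push_cost_def u_def[symmetric]\<close>)
  qed
qed

lemma triple_push:
  assumes ok: "touched_ok st" and amt: "\<And>j. j < nv st ''len'' \<Longrightarrow> 0 \<le> reals st ''amt'' (touched st ! j)"
    and al: "reals st ''alpha'' = (\<lambda>_. 0)(0 := \<alpha>)"
    and sup: "\<And>v. reals st ''r'' v \<noteq> 0 \<Longrightarrow> v \<in> set (touched st)"
    and est: "reals st ''estimate'' = reals st ''p''"
  shows "triple g st push (10 + 30 * real (nv st ''len'') +
      25 * real (\<Sum>j<nv st ''len''. push_cost st (touched st ! j)))
    (\<lambda>st'. push_result st (nv st ''len'') st' \<and> rv st' ''M'' = rv st ''M'' * (1 - \<alpha> / 2))"
    (is "triple _ _ _ _ ?Q")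
proof -
  let ?n = "nv st ''len''"
  let ?loop = "While (BNLess (nvar ''i'') (nvar ''L'')) push_body"
  let ?c = "\<lambda>j. push_cost st (touched st ! j)"
  have loop: "triple g st1 ?loop (1 + (30 * real ?n + 25 * real (\<Sum>j<?n. ?c j)))
     (\<lambda>st'. push_result st ?n st' \<and> rv st' ''M'' = rv st ''M'' \<and> rv st' ''alpha'' = \<alpha>)"
    if s: "reals st1 = reals st" "nats st1 ''list'' = nats st ''list''" "nats st1 ''len'' = nats st ''len''"
      "nats st1 ''mark'' = nats st ''mark''" "nv st1 ''L'' = ?n" "nv st1 ''i'' = 0" for st1
  proof -
    let ?I = "\<lambda>st'. nv st' ''i'' \<le> ?n \<and> push_result st (nv st' ''i'') st'"
    let ?W = "\<lambda>st'. \<Sum>j=nv st' ''i''..<?n. 30 + 25 * real (?c j)"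
    let ?T = "\<lambda>st'. 29 + 25 * real (?c (nv st' ''i''))"
    have fr: "nats st' ''L'' = nats st1 ''L''" "reals st' ''alpha'' = reals st ''alpha''"
      "reals st' ''amt'' = reals st ''amt''" "reals st' ''M'' = reals st ''M''"
      if "frame push_body st1 st'" for st'
      using that s(1) by (simp_all add: frame_def push_body_def spread_body_def)
    have dec: "?W st' = ?T st' + 1 + (\<Sum>j=Suc (nv st' ''i'')..<?n. 30 + 25 * real (?c j))"
      if "nv st' ''i'' < ?n" for st'
      using that by (simp add: sum.atLeast_Suc_lessThan)
    have "triple g st1 ?loop (1 + ?W st1)
      (\<lambda>st'. push_result st ?n st' \<and> rv st' ''M'' = rv st ''M'' \<and> rv st' ''alpha'' = \<alpha>)"
    proof (rule triple_While[where I = ?I and T = ?T], goal_cases)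
      case 1
      have "touched st1 = touched st" "touched_ok st1" using touched_ok_cong[OF s(2-4)] ok by auto
      then show ?case using s sup est by (simp add: push_result_def pushed_def out_mean_def)
    next
      case (3 st')
      then have lt: "nv st' ''i'' < ?n" using fr(1)[of st'] s by simp
      show ?case
        by (rule triple_weaken[OF triple_push_body[OF ok amt, where k = "nv st' ''i''"]])
           (use 3 fr[of st'] lt al dec in auto)
    next
      case (4 st')
      then have lt: "nv st' ''i'' < ?n" using fr(1)[of st'] s by simp
      show ?case unfolding dec[OF lt] by (simp add: sum_nonneg)
    next
      case (5 st')
      then have "nv st' ''i'' = ?n" using fr(1)[of st'] s by simp
      then show ?case using 5 fr[of st'] al by simp
    qed (simp add: sum_nonneg)
    moreover have "?W st1 = 30 * real ?n + 25 * real (\<Sum>j<?n. ?c j)"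
      using s by (simp add: sum.distrib sum_distrib_left lessThan_atLeast0)
    ultimately show ?thesis by simp
  qed
  let ?fin = "SetR ''M'' (NLit 0) (RMul (rvar ''M'') (RSub (rlit 1) (RDiv (rvar ''alpha'') (rlit 2))))"
  have fin: "triple g st2 ?fin 1 ?Q" if "push_result st ?n st2" "rv st2 ''M'' = rv st ''M''" "rv st2 ''alpha'' = \<alpha>" for st2
  proof -
    have "push_result st ?n st3"
      if "nats st3 = nats st2" "reals st3 ''r'' = reals st2 ''r''" "reals st3 ''p'' = reals st2 ''p''"
        "reals st3 ''estimate'' = reals st2 ''estimate''" for st3
      using touched_ok_cong[of st3 st2] that \<open>push_result st ?n st2\<close> by (simp add: push_result_def)
    then show ?thesis by (intro straight_intros) (use that in auto)
  qed
  have all: "triple g st1 (?loop ;; ?fin) (3 + (30 * real ?n + 25 * real (\<Sum>j<?n. ?c j))) ?Q"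
    if s: "reals st1 = reals st" "nats st1 ''list'' = nats st ''list''" "nats st1 ''len'' = nats st ''len''"
      "nats st1 ''mark'' = nats st ''mark''" "nv st1 ''L'' = ?n" "nv st1 ''i'' = 0" for st1
  proof -
    have "triple g st1 ?loop (1 + (30 * real ?n + 25 * real (\<Sum>j<?n. ?c j))) (\<lambda>st'. triple g st' ?fin 1 ?Q)"
      by (rule triple_weaken[OF loop[OF s]]) (simp, rule fin, blast+)
    from triple_Seq[OF this] show ?thesis by (rule triple_weaken) auto
  qed
  show ?thesis
    unfolding push_def by (intro straight_intros triple_weaken[OF all]) auto
qed

end


section \<open>Random sampling\<close>

subsection \<open>Bounds for the random commands\<close>

declare ert.simps [simp del]

lemma ert_Seq_le:
  assumes "ert \<tau> g c (ert \<tau> g d f) st \<le> ennreal B" "0 \<le> \<tau>" "0 \<le> B"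
  shows "ert \<tau> g (Seq c d) f st \<le> ennreal (\<tau> + B)"
  using assms by (simp add: ert.simps ennreal_add_le)

lemma ert_moves_le:
  assumes "moves g c st st'" "f st' \<le> ennreal B" "0 \<le> \<tau>" "0 \<le> B"
  shows "ert \<tau> g c f st \<le> ennreal (\<tau> + B)"
  using assms by (simp add: moves_def ennreal_add_le)

lemma ert_Flip_le:
  assumes "f (store_nat a i 1 st) \<le> ennreal x" "f (store_nat a i 0 st) \<le> ennreal y"
    and "0 \<le> x" "0 \<le> y" "rval p st = q" "0 \<le> q" "q \<le> 1" "0 \<le> \<tau>"
  shows "ert \<tau> g (Flip a i p) f st \<le> ennreal (\<tau> + (q * x + (1 - q) * y))"
proof -
  have "f (store_nat a i 1 st) * ennreal q + f (store_nat a i 0 st) * ennreal (1 - q) \<le>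
      ennreal x * ennreal q + ennreal y * ennreal (1 - q)"
    by (intro add_mono mult_right_mono assms) auto
  also have "\<dots> = ennreal (q * x + (1 - q) * y)"
    using assms by (simp add: ennreal_mult'[symmetric] ennreal_plus[symmetric] mult.commute del: ennreal_plus)
  finally show ?thesis
    using assms by (simp add: ert.simps ennreal_add_le del: ennreal_plus)
qed

lemma nn_integral_pmf_of_set_le:
  assumes "finite A" "A \<noteq> {}" "\<And>x. x \<in> A \<Longrightarrow> f x \<le> ennreal (h x)" "\<And>x. x \<in> A \<Longrightarrow> 0 \<le> h x"
  shows "(\<integral>\<^sup>+ x. f x \<partial>measure_pmf (pmf_of_set A)) \<le> ennreal ((\<Sum>x\<in>A. h x) / real (card A))"
proof -
  have "(\<integral>\<^sup>+ x. f x \<partial>measure_pmf (pmf_of_set A)) = (\<Sum>x\<in>A. f x) / of_nat (card A)"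
    using assms by (simp add: nn_integral_pmf_of_set)
  also have "\<dots> \<le> (\<Sum>x\<in>A. ennreal (h x)) / of_nat (card A)"
    by (intro divide_right_mono_ennreal sum_mono assms)
  also have "\<dots> = ennreal ((\<Sum>x\<in>A. h x) / real (card A))"
    using assms
    by (simp add: sum_ennreal divide_ennreal[symmetric] sum_nonneg card_gt_0_iff ennreal_of_nat_eq_real_of_nat)
  finally show ?thesis .
qed

lemma ert_Uniform_le:
  assumes "nval e st = n" "0 < n" "\<And>x. x < n \<Longrightarrow> f (store_nat a i x st) \<le> ennreal (h x)"
    "\<And>x. x < n \<Longrightarrow> 0 \<le> h x" "0 \<le> \<tau>"
  shows "ert \<tau> g (Uniform a i e) f st \<le> ennreal (\<tau> + (\<Sum>x<n. h x) / real n)"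
proof -
  have "max 1 n = n" using assms by simp
  moreover have "(\<integral>\<^sup>+ x. f (store_nat a i x st) \<partial>measure_pmf (pmf_of_set {0..<n})) \<le>
      ennreal ((\<Sum>x\<in>{0..<n}. h x) / real (card {0..<n}))"
    by (rule nn_integral_pmf_of_set_le) (use assms in auto)
  moreover have "0 \<le> (\<Sum>x<n. h x) / real n"
    using assms by (intro divide_nonneg_nonneg sum_nonneg) auto
  ultimately show ?thesis
    using assms by (simp add: ert.simps ennreal_add_le lessThan_atLeast0 del: ennreal_plus)
qed

text \<open>The counterpart of \<open>triple_While\<close> for random loops: the potential
  \<open>P\<close> may grow on some outcomes if its mean covers the iteration. It is measured just
  after the test of the guard, hence the extra \<open>\<tau>\<close> at every visit.\<close>

lemma ert_While_inv_le:
  assumes I: "I st" and \<tau>: "0 \<le> \<tau>"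
    and P: "\<And>st'. frame c st st' \<Longrightarrow> I st' \<Longrightarrow> 0 \<le> P st'"
    and body: "\<And>st' F. \<lbrakk>frame c st st'; I st'; bval b st';
        \<And>st''. frame c st st'' \<Longrightarrow> I st'' \<Longrightarrow> F st'' \<le> ennreal (\<tau> + P st'')\<rbrakk> \<Longrightarrow> ert \<tau> g c F st' \<le> ennreal (P st')"
    and post: "\<And>st'. frame c st st' \<Longrightarrow> I st' \<Longrightarrow> \<not> bval b st' \<Longrightarrow> f st' \<le> ennreal (P st')"
  shows "ert \<tau> g (While b c) f st \<le> ennreal (\<tau> + P st)"
proof -
  let ?J = "\<lambda>st'. frame c st st' \<and> I st'"
  let ?F = "\<lambda>st'. if ?J st' then ennreal (\<tau> + P st') else \<infinity>"
  have "ert \<tau> g (While b c) f st \<le> ?F st"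
  proof (rule ert_While_le[where I = ?F])
    fix st'
    show "ennreal \<tau> + (if bval b st' then ert \<tau> g c ?F st' else f st') \<le> ?F st'"
    proof (cases "?J st'")
      case True
      have "ert \<tau> g c ?F st' \<le> ennreal (P st')" if "bval b st'"
        using True that by (intro body) auto
      then show ?thesis using True post[of st'] P[of st'] \<tau> by (auto intro!: ennreal_add_le simp del: ennreal_plus)
    qed auto
  qed
  then show ?thesis using I by simp
qed


subsection \<open>Walks\<close>

context walk_graph
begin

lemma out_mean_nth:
  assumes "v \<in> V"
  shows "(\<Sum>j<length (out_nbrs g v). h (out_nbrs g v ! j)) / real (length (out_nbrs g v)) = out_mean g h v"
proof -
  have "(\<Sum>j<length (out_nbrs g v). h (out_nbrs g v ! j)) = sum_list (map h (out_nbrs g v))"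
    by (simp add: sum_list_sum_nth lessThan_atLeast0)
  also have "\<dots> = (\<Sum>w\<in>set (out_nbrs g v). h w)"
    by (rule sum_list_distinct_conv_sum_set[OF distinct_out_nbrs[OF assms]])
  finally show ?thesis by (simp add: out_mean_def)
qed

text \<open>\<open>F\<close> is a superharmonic bound on the mean of \<open>h\<close> at the end of
  the walk, taken before the coin at the current node is tossed. With \<open>b = 0\<close> that coin
  has already said to go on, hence the mean of \<open>F\<close> over the successors. The 8 is a body
  of 7 steps plus a test, and 1 / \<alpha> is the mean number of iterations.\<close>

lemma ert_walk_loop_le:
  assumes \<tau>: "0 \<le> \<tau>" and al: "rv st ''alpha'' = \<alpha>" and x: "nv st ''x'' \<in> V" "nv st ''b'' \<in> {0, 1}"
    and f: "\<And>st'. frame walk_body st st' \<Longrightarrow> nv st' ''x'' \<in> V \<Longrightarrow> f st' \<le> ennreal (h (nv st' ''x''))"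
    and h: "\<And>v. v \<in> V \<Longrightarrow> 0 \<le> h v" and F: "\<And>v. v \<in> V \<Longrightarrow> 0 \<le> F v"
    and step: "\<And>v. v \<in> V \<Longrightarrow> \<alpha> * h v + (1 - \<alpha>) * out_mean g F v \<le> F v"
  shows "ert \<tau> g (While (BNLess (nvar ''b'') (NLit 1)) walk_body) f st \<le>
    ennreal (\<tau> + (if nv st ''b'' = 0 then 8 * \<tau> / \<alpha> + out_mean g F (nv st ''x'') else h (nv st ''x'')))"
    (is "_ \<le> ennreal (\<tau> + ?P st)")
proof (rule ert_While_inv_le[where I = "\<lambda>st'. nv st' ''x'' \<in> V \<and> nv st' ''b'' \<in> {0, 1}" and P = ?P], goal_cases)
  case (3 st')
  then show ?case
    using \<tau> alpha h F by (auto simp: out_mean_def intro!: add_nonneg_nonneg divide_nonneg_nonneg sum_nonneg dest: out_nbrs_in_V)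
next
  case (4 st' G)
  let ?x = "nv st' ''x''"
  have xV: "?x \<in> V" and b0: "nv st' ''b'' = 0" using 4 by auto
  have al': "rv st' ''alpha'' = \<alpha>" using 4(1) al by (simp add: frame_def walk_body_def)
  have mean0: "0 \<le> out_mean g F v" if "v \<in> V" for v
    using F that by (auto simp: out_mean_def intro!: divide_nonneg_nonneg sum_nonneg dest: out_nbrs_in_V)
  have flip: "ert \<tau> g (Flip ''b'' (NLit 0) (rvar ''alpha'')) G st1 \<le> ennreal (\<tau> + (\<tau> + (1 - \<alpha>) * 8 * \<tau> / \<alpha> + F v))"
    if s: "frame walk_body st st1" "nv st1 ''x'' = v" "v \<in> V" for st1 v
  proof -
    have fr: "frame walk_body st (store_nat ''b'' (NLit 0) z st1)" for z
      using s(1) by (auto simp: frame_def walk_body_def)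
    have al1: "rv st1 ''alpha'' = \<alpha>" using s al by (simp add: frame_def walk_body_def)
    have "ert \<tau> g (Flip ''b'' (NLit 0) (rvar ''alpha'')) G st1 \<le>
      ennreal (\<tau> + (\<alpha> * (\<tau> + h v) + (1 - \<alpha>) * (\<tau> + (8 * \<tau> / \<alpha> + out_mean g F v))))"
    proof (rule ert_Flip_le)
      show "G (store_nat ''b'' (NLit 0) 1 st1) \<le> ennreal (\<tau> + h v)"
        using 4(4)[OF fr, of 1] s by simp
      show "G (store_nat ''b'' (NLit 0) 0 st1) \<le> ennreal (\<tau> + (8 * \<tau> / \<alpha> + out_mean g F v))"
        using 4(4)[OF fr, of 0] s by simp
    qed (use s al1 alpha \<tau> h[OF s(3)] mean0[OF s(3)] in auto)
    also have "\<alpha> * (\<tau> + h v) + (1 - \<alpha>) * (\<tau> + (8 * \<tau> / \<alpha> + out_mean g F v)) =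
       \<tau> + (1 - \<alpha>) * 8 * \<tau> / \<alpha> + (\<alpha> * h v + (1 - \<alpha>) * out_mean g F v)"
      by (simp add: algebra_simps)
    also have "ennreal (\<tau> + \<dots>) \<le> ennreal (\<tau> + (\<tau> + (1 - \<alpha>) * 8 * \<tau> / \<alpha> + F v))"
      using step[OF s(3)] by (intro ennreal_leI) simp
    finally show ?thesis .
  qed
  let ?R = "\<tau> + (1 - \<alpha>) * 8 * \<tau> / \<alpha>"
  let ?n = "length (out_nbrs g ?x)"
  have R: "0 \<le> ?R" using \<tau> alpha by (intro add_nonneg_nonneg divide_nonneg_nonneg mult_nonneg_nonneg) auto
  have n: "0 < ?n" using out_nbrs_nonempty[OF xV] by simp
  have out: "ert \<tau> g (OutNbr ''x'' (NLit 0) (nvar ''x'') (nvar ''j'') ;; Flip ''b'' (NLit 0) (rvar ''alpha'')) G st1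
      \<le> ennreal (\<tau> + (\<tau> + (\<tau> + (?R + F (out_nbrs g ?x ! j)))))"
    if s: "frame walk_body st st1" "nv st1 ''x'' = ?x" "nv st1 ''j'' = j" "j < ?n" for st1 j
  proof (intro ert_Seq_le ert_moves_le[OF moves_intros(6)] flip)
    have jV: "out_nbrs g ?x ! j \<in> V" using out_nbrs_in_V[OF xV] s(4) by simp
    let ?s = "store_nat ''x'' (NLit 0) (list_get (out_nbrs g (nval (nvar ''x'') st1)) (nval (nvar ''j'') st1)) st1"
    show "frame walk_body st ?s" using s(1) by (auto simp: frame_def walk_body_def)
    show "nv ?s ''x'' = out_nbrs g ?x ! j" using s by (simp add: list_get_def)
    show "out_nbrs g ?x ! j \<in> V" by (rule jV)
    show "0 \<le> \<tau> + (?R + F (out_nbrs g ?x ! j))" "0 \<le> \<tau> + (\<tau> + (?R + F (out_nbrs g ?x ! j)))"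
      using \<tau> R F[OF jV] by simp_all
  qed (use \<tau> in auto)
  have nonneg: "0 \<le> \<tau> + (\<tau> + (\<tau> + (?R + F (out_nbrs g ?x ! j))))" if "j < ?n" for j
    using F[OF out_nbrs_in_V[OF xV nth_mem[OF that]]] R \<tau> by simp
  let ?rest = "OutNbr ''x'' (NLit 0) (nvar ''x'') (nvar ''j'') ;; Flip ''b'' (NLit 0) (rvar ''alpha'')"
  have unif: "ert \<tau> g (Uniform ''j'' (NLit 0) (nvar ''o'')) (ert \<tau> g ?rest G) st1 \<le>
     ennreal (\<tau> + (\<tau> + (\<tau> + (\<tau> + (?R + out_mean g F ?x)))))"
    if s: "frame walk_body st st1" "nv st1 ''x'' = ?x" "nv st1 ''o'' = ?n" for st1
  proof -
    have "ert \<tau> g (Uniform ''j'' (NLit 0) (nvar ''o'')) (ert \<tau> g ?rest G) st1 \<le>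
     ennreal (\<tau> + (\<Sum>j<?n. \<tau> + (\<tau> + (\<tau> + (?R + F (out_nbrs g ?x ! j))))) / real ?n)"
    proof (rule ert_Uniform_le[OF _ n])
      show "ert \<tau> g ?rest G (store_nat ''j'' (NLit 0) j st1)
        \<le> ennreal (\<tau> + (\<tau> + (\<tau> + (?R + F (out_nbrs g ?x ! j)))))" if "j < ?n" for j
        by (rule out) (use that s in \<open>auto simp: frame_def walk_body_def\<close>)
    qed (use s \<tau> nonneg in auto)
    also have "(\<Sum>j<?n. \<tau> + (\<tau> + (\<tau> + (?R + F (out_nbrs g ?x ! j))))) / real ?n =
        out_mean g (\<lambda>w. \<tau> + (\<tau> + (\<tau> + (?R + F w)))) ?x"
      by (rule out_mean_nth[OF xV])
    also have "\<dots> = \<tau> + (\<tau> + (\<tau> + (?R + out_mean g F ?x)))"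
      using xV by (simp add: out_mean_add)
    finally show ?thesis .
  qed
  have "ert \<tau> g walk_body G st' \<le> ennreal (\<tau> + (\<tau> + (\<tau> + (\<tau> + (\<tau> + (\<tau> + (\<tau> + (?R + out_mean g F ?x))))))))"
    unfolding walk_body_def
  proof (intro ert_Seq_le ert_moves_le[OF moves_intros(4)] unif)
    show "frame walk_body st (store_nat ''o'' (NLit 0) (length (out_nbrs g (nval (nvar ''x'') st'))) st')"
      using 4(1) by (auto simp: frame_def walk_body_def)
  qed (use \<tau> R mean0[OF xV] in auto)
  also have "\<tau> + (\<tau> + (\<tau> + (\<tau> + (\<tau> + (\<tau> + (\<tau> + (?R + out_mean g F ?x))))))) = ?P st'"
    using b0 alpha by (simp add: field_simps)
  finally show ?case .
qed (use \<tau> x f in auto)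

lemma ert_walk_once_le:
  assumes \<tau>: "0 \<le> \<tau>" and al: "rv st ''alpha'' = \<alpha>" and x: "nats st ''sample'' (nv st ''i'') \<in> V"
    and f: "\<And>st' v. frame walk_once st st' \<Longrightarrow> v \<in> V \<Longrightarrow> rv st' ''S'' = rv st ''S'' + reals st ''r'' v \<Longrightarrow>
        nv st' ''w'' = Suc (nv st ''w'') \<Longrightarrow> f st' \<le> ennreal (h v)"
    and h: "\<And>v. v \<in> V \<Longrightarrow> 0 \<le> h v" and F: "\<And>v. v \<in> V \<Longrightarrow> 0 \<le> F v"
    and step: "\<And>v. v \<in> V \<Longrightarrow> \<alpha> * h v + (1 - \<alpha>) * out_mean g F v \<le> F v"
  shows "ert \<tau> g walk_once f st \<le> ennreal (20 * \<tau> / \<alpha> + F (nats st ''sample'' (nv st ''i'')))"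
proof -
  let ?fin = "SetR ''S'' (NLit 0) (RAdd (rvar ''S'') (RGet ''r'' (nvar ''x''))) ;; incr ''w''"
  let ?loop = "While (BNLess (nvar ''b'') (NLit 1)) walk_body"
  let ?y = "nats st ''sample'' (nv st ''i'')"
  have mean0: "0 \<le> out_mean g F v" if "v \<in> V" for v
    using F that by (auto simp: out_mean_def intro!: divide_nonneg_nonneg sum_nonneg dest: out_nbrs_in_V)
  have fin: "ert \<tau> g ?fin f st' \<le> ennreal (\<tau> + (\<tau> + (\<tau> + h (nv st' ''x''))))"
    if "frame walk_once st st'" "nv st' ''x'' \<in> V" "rv st' ''S'' = rv st ''S''" "nv st' ''w'' = nv st ''w''"
      "reals st' ''r'' = reals st ''r''" for st'
    by (intro ert_Seq_le ert_moves_le[OF moves_intros(2)] ert_moves_le[OF moves_intros(1)] f)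
       (use that h[OF that(2)] \<tau> in \<open>auto simp: frame_def walk_once_def walk_body_def\<close>)
  have loop: "ert \<tau> g (?loop ;; ?fin) f st' \<le> ennreal (\<tau> + (\<tau> + (if nv st' ''b'' = 0
      then 8 * \<tau> / \<alpha> + (3 * \<tau> + out_mean g F ?y) else 3 * \<tau> + h ?y)))"
    if s: "frame walk_once st st'" "nv st' ''x'' = ?y" "nv st' ''b'' \<in> {0, 1}"
      "nv st' ''w'' = nv st ''w''" "reals st' = reals st" for st'
  proof (intro ert_Seq_le)
    have "ert \<tau> g ?loop (ert \<tau> g ?fin f) st' \<le> ennreal (\<tau> + (if nv st' ''b'' = 0
      then 8 * \<tau> / \<alpha> + out_mean g (\<lambda>v. 3 * \<tau> + F v) (nv st' ''x'') else 3 * \<tau> + h (nv st' ''x'')))"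
    proof (rule ert_walk_loop_le[OF \<tau>], goal_cases)
      case (4 st1)
      have "ert \<tau> g ?fin f st1 \<le> ennreal (\<tau> + (\<tau> + (\<tau> + h (nv st1 ''x''))))"
        by (rule fin) (use 4 s in \<open>auto simp: frame_def walk_once_def walk_body_def\<close>)
      then show ?case by (simp add: algebra_simps)
    next
      case (7 v)
      show ?case
        using step[OF 7] 7 by (simp add: out_mean_add algebra_simps)
    qed (use s x al h F \<tau> in auto)
    then show "ert \<tau> g ?loop (ert \<tau> g ?fin f) st' \<le> ennreal (\<tau> + (if nv st' ''b'' = 0
      then 8 * \<tau> / \<alpha> + (3 * \<tau> + out_mean g F ?y) else 3 * \<tau> + h ?y))"
      unfolding s(2) by (simp only: out_mean_add out_mean_const[OF x])
  qed (use \<tau> alpha h x mean0 in auto)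
  have flip: "ert \<tau> g (Flip ''b'' (NLit 0) (rvar ''alpha'')) (ert \<tau> g (?loop ;; ?fin) f) st' \<le>
     ennreal (\<tau> + (\<alpha> * (\<tau> + (\<tau> + (3 * \<tau> + h ?y))) + (1 - \<alpha>) * (\<tau> + (\<tau> + (8 * \<tau> / \<alpha> + (3 * \<tau> + out_mean g F ?y))))))"
    if s: "frame walk_once st st'" "nv st' ''x'' = ?y" 
      "nv st' ''w'' = nv st ''w''" "reals st' = reals st" for st'
  proof -
    have fr: "frame walk_once st (store_nat ''b'' (NLit 0) z st')" for z
      using s(1) by (auto simp: frame_def walk_once_def)
    have 1: "ert \<tau> g (?loop ;; ?fin) f (store_nat ''b'' (NLit 0) 1 st') \<le> ennreal (\<tau> + (\<tau> + (3 * \<tau> + h ?y)))"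
      using loop[OF fr, of 1] s by simp
    have 0: "ert \<tau> g (?loop ;; ?fin) f (store_nat ''b'' (NLit 0) 0 st') \<le> ennreal (\<tau> + (\<tau> + (8 * \<tau> / \<alpha> + (3 * \<tau> + out_mean g F ?y))))"
      using loop[OF fr, of 0] s by simp
    show ?thesis
      by (rule ert_Flip_le[OF 1 0]) (use s al alpha \<tau> h[OF x] mean0[OF x] in auto)
  qed
  let ?E = "\<alpha> * (\<tau> + (\<tau> + (3 * \<tau> + h ?y))) + (1 - \<alpha>) * (\<tau> + (\<tau> + (8 * \<tau> / \<alpha> + (3 * \<tau> + out_mean g F ?y))))"
  have E0: "0 \<le> ?E"
    using \<tau> alpha h[OF x] mean0[OF x] by (intro add_nonneg_nonneg mult_nonneg_nonneg divide_nonneg_nonneg) auto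
  have "ert \<tau> g walk_once f st \<le> ennreal (\<tau> + (\<tau> + (\<tau> + (\<tau> + ?E))))"
    unfolding walk_once_def
  proof (intro ert_Seq_le ert_moves_le[OF moves_intros(1)] flip[unfolded])
    show "frame walk_once st (store_nat ''x'' (NLit 0) (nval (NGet ''sample'' (nvar ''i'')) st) st)"
      by (auto simp: frame_def walk_once_def)
  qed (use \<tau> E0 in auto)
  also have "\<tau> + (\<tau> + (\<tau> + (\<tau> + ?E))) \<le> 20 * \<tau> / \<alpha> + F ?y"
  proof -
    have "?E = 5 * \<tau> + (1 - \<alpha>) * (8 * \<tau> / \<alpha>) + (\<alpha> * h ?y + (1 - \<alpha>) * out_mean g F ?y)"
      by (simp add: algebra_simps)
    also have "\<dots> \<le> 5 * \<tau> + (1 - \<alpha>) * (8 * \<tau> / \<alpha>) + F ?y" using step[OF x] by simp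
    also have "(1 - \<alpha>) * (8 * \<tau> / \<alpha>) \<le> 8 * \<tau> / \<alpha>" using alpha \<tau> by (intro mult_left_le_one_le) auto
    finally have "?E \<le> 5 * \<tau> + 8 * \<tau> / \<alpha> + F ?y" by simp
    \<comment> \<open>As \<alpha> < 1, the fixed overhead is absorbed into the term with 1 /
      \<alpha>.\<close>
    moreover have "9 * \<tau> \<le> 9 * \<tau> / \<alpha>" using alpha \<tau> by (simp add: field_simps mult_left_le_one_le)
    moreover have "20 * \<tau> / \<alpha> = 8 * \<tau> / \<alpha> + 9 * \<tau> / \<alpha> + 3 * \<tau> / \<alpha>" by (simp add: field_simps)
    moreover have "0 \<le> 3 * \<tau> / \<alpha>" using alpha \<tau> by simp
    ultimately show ?thesis by linarith
  qed
  finally show ?thesis by (simp add: ennreal_leI)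
qed

end


subsection \<open>Estimating one node\<close>

text \<open>Half of the failure probability pays for a node that was never sampled, hence the
  condition on \<open>K\<close>; the other half goes to Chebyshev's inequality.\<close>

locale ppr_instance = walk_graph +
  fixes \<epsilon> p\<^sub>f \<delta> :: real and t K :: nat
  assumes eps: "0 < \<epsilon>" "\<epsilon> < 1" and pf: "0 < p\<^sub>f" "p\<^sub>f < 1" and delta: "0 < \<delta>" "\<delta> \<le> 1"
    and target: "t \<in> V" and K: "(1 / 2) ^ K \<le> p\<^sub>f / 2"
begin

abbreviation ppr_t :: "nat \<Rightarrow> real" where
  "ppr_t v \<equiv> ppr \<alpha> (dgraph g) v t"

definition inputs :: "mem \<Rightarrow> bool" where
  "inputs st \<longleftrightarrow> reals st ''alpha'' = (\<lambda>_. 0)(0 := \<alpha>) \<and> rv st ''epsilon'' = \<epsilon> \<and> rv st ''pf'' = p\<^sub>f \<and>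
     rv st ''delta'' = \<delta> \<and> nv st ''target'' = t"

definition err :: "mem \<Rightarrow> nat \<Rightarrow> real" where
  "err st v = ppr_t v - reals st ''p'' v"

definition residue_ok :: "mem \<Rightarrow> bool" where
  "residue_ok st \<longleftrightarrow>
     (\<forall>v\<in>V. err st v = \<alpha> * reals st ''r'' v + (1 - \<alpha>) * out_mean g (err st) v) \<and>
     (\<forall>v\<in>V. 0 \<le> reals st ''r'' v \<and> reals st ''r'' v \<le> rv st ''M'') \<and> (\<forall>v\<in>V. 0 \<le> reals st ''p'' v)"

definition bad :: "real \<Rightarrow> nat \<Rightarrow> bool" where
  "bad x v \<longleftrightarrow> \<bar>x - ppr_t v\<bar> \<ge> \<epsilon> * max (ppr_t v) \<delta>"

text \<open>The last two bounds combine to \<open>\<alpha> * r v \<le> ppr_t v\<close>, the reason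
  why only nodes of large PageRank are ever pushed.\<close>

lemma err_bounds:
  assumes "residue_ok st" "v \<in> V"
  shows "0 \<le> err st v" "err st v \<le> rv st ''M''" "\<alpha> * reals st ''r'' v \<le> err st v" "err st v \<le> ppr_t v"
proof -
  have "0 \<le> reals st ''p'' v" using assms by (simp add: residue_ok_def)
  then show "err st v \<le> ppr_t v" by (simp add: err_def)
qed (use walk_value_lower[of "err st" "reals st ''r''" 0 v] walk_value_upper[of "err st" "reals st ''r''" "rv st ''M''" v]
    walk_value_ge_alpha_mult[of "err st" "reals st ''r''" v] assms
     in \<open>auto simp: residue_ok_def\<close>)

text \<open>With variance at most \<open>M * \<mu>\<close> per walk, Chebyshev's inequality asks for
  this many walks to reach failure probability \<open>p\<^sub>f / 2\<close>.\<close>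

definition num_walks :: "real \<Rightarrow> nat" where
  "num_walks M = nat \<lceil>2 * M / (\<epsilon>\<^sup>2 * \<delta> * p\<^sub>f)\<rceil>"

lemma num_walks_less_iff:
  "real w * (\<epsilon> * \<epsilon> * (\<delta> * p\<^sub>f)) < 2 * M \<longleftrightarrow> w < num_walks M"
proof -
  have z: "0 < \<epsilon>\<^sup>2 * \<delta> * p\<^sub>f" using eps pf delta by simp
  have "real w * (\<epsilon> * \<epsilon> * (\<delta> * p\<^sub>f)) < 2 * M \<longleftrightarrow> real w < 2 * M / (\<epsilon>\<^sup>2 * \<delta> * p\<^sub>f)"
    using z by (simp add: field_simps power2_eq_square)
  also have "\<dots> \<longleftrightarrow> w < num_walks M"
    unfolding num_walks_def by (simp add: less_ceiling_iff zless_nat_conj zless_nat_eq_int_zless)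
  finally show ?thesis .
qed

lemma num_walks_pos: "0 < M \<Longrightarrow> 0 < num_walks M"
  using num_walks_less_iff[of 0 M] by simp

lemma num_walks_ge: "2 * M / (\<epsilon>\<^sup>2 * \<delta> * p\<^sub>f) \<le> real (num_walks M)"
  unfolding num_walks_def by linarith

lemma num_walks_le:
  assumes "0 < M" shows "real (num_walks M) \<le> 1 + 2 * M / (\<epsilon>\<^sup>2 * \<delta> * p\<^sub>f)"
proof -
  have "0 \<le> 2 * M / (\<epsilon>\<^sup>2 * \<delta> * p\<^sub>f)" using assms eps pf delta by simp
  then show ?thesis unfolding num_walks_def by linarith
qed

text \<open>Chebyshev's inequality in the form of a potential: \<open>(S - w \<mu>)\<^sup>2 + (W - w) M \<mu>\<close> is a
  supermartingale, as a walk ends at a node whose residue lies between \<open>0\<close> and \<open>M\<close> and has mean \<open>\<mu>\<close>.\<close>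

lemma ert_walks_le:
  assumes \<tau>: "0 \<le> \<tau>" and inp: "inputs st" and res: "residue_ok st" and M: "rv st ''M'' = M" "0 < M"
    and y: "nats st ''sample'' (nv st ''i'') = y" "y \<in> V" and w0: "nv st ''w'' = 0" "rv st ''S'' = 0"
    and BD: "0 \<le> B" "0 \<le> D"
    and f: "\<And>st'. frame walk_once st st' \<Longrightarrow>
      f st' \<le> ennreal (B + (if bad (reals st ''p'' y + rv st' ''S'' / real (nv st' ''w'')) y then D else 0))"
  shows "ert \<tau> g (While walk_guard walk_once) f st \<le>
    ennreal (\<tau> + (real (num_walks M) * (20 * \<tau> / \<alpha> + \<tau>) + B + D * p\<^sub>f / 2))"
proof -
  define W where "W = num_walks M"
  define \<mu> where "\<mu> = err st y"
  define m where "m = max (ppr_t y) \<delta>"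
  \<comment> \<open>The square of the deviation of \<open>S\<close> that a bad estimate requires;
    divided by \<open>Z\<close>, the potential is at least 1 there.\<close>
  define Z where "Z = (real W)\<^sup>2 * \<epsilon>\<^sup>2 * m\<^sup>2"
  define P where "P w S = (real W - real w) * (20 * \<tau> / \<alpha> + \<tau>) + B +
      D * ((S - real w * \<mu>)\<^sup>2 + (real W - real w) * (M * \<mu>)) / Z" for w :: nat and S
  have W: "0 < W" using num_walks_pos M by (simp add: W_def)
  have m: "0 < m" "\<delta> \<le> m" "ppr_t y \<le> m" using delta by (auto simp: m_def)
  have Z: "0 < Z" using W m eps by (simp add: Z_def)
  have e: "0 \<le> err st v" "err st v \<le> M" if "v \<in> V" for v
    using err_bounds[OF res that] M by auto
  have \<mu>: "0 \<le> \<mu>" "\<mu> \<le> M" "\<mu> \<le> ppr_t y" using e[OF y(2)] err_bounds(4)[OF res y(2)] by (auto simp: \<mu>_def)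
  have P0: "0 \<le> P w S" if "w \<le> W" for w S
    using that BD \<tau> alpha Z \<mu> M unfolding P_def
    by (intro add_nonneg_nonneg mult_nonneg_nonneg divide_nonneg_nonneg) auto
  have fr: "rv st' ''epsilon'' = \<epsilon>" "rv st' ''delta'' = \<delta>" "rv st' ''pf'' = p\<^sub>f" "rv st' ''M'' = M"
    "rv st' ''alpha'' = \<alpha>" "nats st' ''sample'' (nv st' ''i'') = y" "reals st' ''r'' = reals st ''r''"
    if "frame walk_once st st'" for st'
    using that inp M y by (simp_all add: frame_def walk_once_def walk_body_def inputs_def)
  have guard: "bval walk_guard st' \<longleftrightarrow> nv st' ''w'' < W" if "frame walk_once st st'" for st'
    using num_walks_less_iff[of "nv st' ''w''" M] by (simp add: walk_guard_def fr[OF that] W_def)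
  have "ert \<tau> g (While walk_guard walk_once) f st \<le> ennreal (\<tau> + P (nv st ''w'') (rv st ''S''))"
  proof (rule ert_While_inv_le[where I = "\<lambda>st'. nv st' ''w'' \<le> W" and P = "\<lambda>st'. P (nv st' ''w'') (rv st' ''S'')"], goal_cases)
    case (4 st' F)
    define w where "w = nv st' ''w''"
    define S where "S = rv st' ''S''"
    have wW: "w < W" using 4 guard by (simp add: w_def)
    define a where "a = S - real (Suc w) * \<mu>"
    define k where "k = \<tau> + ((real W - real (Suc w)) * (20 * \<tau> / \<alpha> + \<tau>) + B)"
    define l where "l = (real W - real (Suc w)) * (M * \<mu>)"
    have k: "0 \<le> k" using wW \<tau> alpha BD by (simp add: k_def)
    have l: "0 \<le> l" using wW \<mu> M by (simp add: l_def)
    \<comment> \<open>The square of \<open>a + r\<close> is replaced by a bound affine in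
      \<open>r\<close>, since affine functions of the residue turn into the same functions of
      \<open>err\<close> under the walk.\<close>
    define G where "G v = k + D * (a\<^sup>2 + (2 * a + M) * err st v + l) / Z" for v
    have "ert \<tau> g walk_once F st' \<le> ennreal (20 * \<tau> / \<alpha> + G (nats st' ''sample'' (nv st' ''i'')))"
    proof (rule ert_walk_once_le[OF \<tau>, where h = "\<lambda>v. \<tau> + P (Suc w) (S + reals st ''r'' v)"])
      show "F st'' \<le> ennreal (\<tau> + P (Suc w) (S + reals st ''r'' v))"
        if "frame walk_once st' st''" "v \<in> V" "rv st'' ''S'' = rv st' ''S'' + reals st' ''r'' v"
          "nv st'' ''w'' = Suc (nv st' ''w'')" for st'' v
        using 4(4)[of st''] frame_trans[OF 4(1) that(1)] that wW fr(7)[OF 4(1)]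
        by (simp add: w_def S_def del: ennreal_plus)
      show "0 \<le> \<tau> + P (Suc w) (S + reals st ''r'' v)" for v
        using P0[of "Suc w"] wW \<tau> by simp
      show "0 \<le> G v" if "v \<in> V" for v
      proof -
        \<comment> \<open>\<open>2 * a + M\<close> may be negative; completing the square, with
          \<open>err\<close> between 0 and \<open>M\<close>, gives nonnegativity
          nevertheless.\<close>
        have "a\<^sup>2 + (2 * a + M) * err st v = (a + err st v)\<^sup>2 + err st v * (M - err st v)"
          by (simp add: power2_eq_square algebra_simps)
        also have "\<dots> \<ge> 0" using e[OF that] by simp
        finally have "0 \<le> D * (a\<^sup>2 + (2 * a + M) * err st v + l) / Z"
          using l BD Z by (intro divide_nonneg_pos mult_nonneg_nonneg[of D]) auto
        then show ?thesis unfolding G_def using k by simp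
      qed
      show "\<alpha> * (\<tau> + P (Suc w) (S + reals st ''r'' v)) + (1 - \<alpha>) * out_mean g G v \<le> G v" if v: "v \<in> V" for v
      proof -
        let ?r = "reals st ''r'' v"
        have r: "0 \<le> ?r" "?r \<le> M" using res v M by (auto simp: residue_ok_def)
        have "(a + ?r)\<^sup>2 \<le> a\<^sup>2 + (2 * a + M) * ?r"
          using mult_right_mono[OF r(2,1)] by (simp add: power2_eq_square algebra_simps)
        then have "D * ((a + ?r)\<^sup>2 + l) / Z \<le> D * (a\<^sup>2 + (2 * a + M) * ?r + l) / Z"
          using BD Z by (intro divide_right_mono mult_left_mono) auto
        then have 1: "\<tau> + P (Suc w) (S + ?r) \<le> k + D * (a\<^sup>2 + (2 * a + M) * ?r + l) / Z"
          by (simp add: P_def k_def l_def a_def algebra_simps)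
        define c where "c = D / Z * (2 * a + M)"
        define c0 where "c0 = k + D / Z * (a\<^sup>2 + l)"
        have Gc: "G = (\<lambda>v. c0 + c * err st v)"
          by (simp add: G_def fun_eq_iff c_def c0_def distrib_left distrib_right add_divide_distrib)
        have "out_mean g G v = c0 + c * out_mean g (err st) v"
          unfolding Gc using v by (simp add: out_mean_add out_mean_cmult)
        moreover have "\<tau> + P (Suc w) (S + ?r) \<le> c0 + c * ?r"
          using 1 by (simp add: c_def c0_def distrib_left distrib_right add_divide_distrib)
        then have "\<alpha> * (\<tau> + P (Suc w) (S + ?r)) \<le> \<alpha> * (c0 + c * ?r)"
          using alpha by (intro mult_left_mono) auto
        ultimately have "\<alpha> * (\<tau> + P (Suc w) (S + ?r)) + (1 - \<alpha>) * out_mean g G v \<le>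
            c0 + c * (\<alpha> * ?r + (1 - \<alpha>) * out_mean g (err st) v)"
          by (simp add: algebra_simps)
        also have "\<alpha> * ?r + (1 - \<alpha>) * out_mean g (err st) v = err st v"
          using res v by (simp add: residue_ok_def)
        finally show ?thesis by (simp add: Gc)
      qed
    qed (use fr[OF 4(1)] y in auto)
    also have "nats st' ''sample'' (nv st' ''i'') = y" by (rule fr(6)[OF 4(1)])
    also have "20 * \<tau> / \<alpha> + G y \<le> P w S"
    proof -
      \<comment> \<open>Recentring from \<open>w + 1\<close> walks to \<open>w\<close> leaves minus
        the squared mean. It is discarded, as the variance bound \<open>M * \<mu>\<close> is good
        enough.\<close>
      have "a\<^sup>2 + (2 * a + M) * \<mu> + l = (S - real w * \<mu>)\<^sup>2 + (real W - real w) * (M * \<mu>) - \<mu>\<^sup>2"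
        by (simp add: a_def l_def power2_eq_square algebra_simps)
      also have "\<dots> \<le> (S - real w * \<mu>)\<^sup>2 + (real W - real w) * (M * \<mu>)" by simp
      finally have "D * (a\<^sup>2 + (2 * a + M) * \<mu> + l) / Z \<le> D * ((S - real w * \<mu>)\<^sup>2 + (real W - real w) * (M * \<mu>)) / Z"
        using BD Z by (intro divide_right_mono mult_left_mono) auto
      moreover have dec: "(real W - real (Suc w)) * u = (real W - real w) * u - u" for u
        by (simp add: algebra_simps)
      ultimately show ?thesis unfolding G_def P_def k_def \<mu>_def[symmetric] dec by simp
    qed
    finally show ?case by (simp add: ennreal_leI w_def S_def)
  next
    case (5 st')
    then have wW: "nv st' ''w'' = W" using guard by auto
    define S where "S = rv st' ''S''"
    have "(if bad (reals st ''p'' y + S / real W) y then D else 0) \<le> D * (S - real W * \<mu>)\<^sup>2 / Z"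
    proof (cases "bad (reals st ''p'' y + S / real W) y")
      case True
      have "reals st ''p'' y + S / real W - ppr_t y = (S - real W * \<mu>) / real W"
        using W by (simp add: \<mu>_def err_def field_simps)
      then have "\<epsilon> * m \<le> \<bar>S - real W * \<mu>\<bar> / real W"
        using True W by (simp add: bad_def m_def abs_divide)
      then have "real W * \<epsilon> * m \<le> \<bar>S - real W * \<mu>\<bar>" using W by (simp add: field_simps)
      then have "(real W * \<epsilon> * m)\<^sup>2 \<le> \<bar>S - real W * \<mu>\<bar>\<^sup>2"
        using eps m by (intro power_mono) auto
      then have "Z \<le> (S - real W * \<mu>)\<^sup>2" by (simp add: Z_def power_mult_distrib)
      then have "D * 1 \<le> D * ((S - real W * \<mu>)\<^sup>2 / Z)" using BD Z by (intro mult_left_mono) auto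
      then show ?thesis using True by simp
    next
      case False
      then show ?thesis using BD Z by simp
    qed
    then have "B + (if bad (reals st ''p'' y + S / real W) y then D else 0) \<le> P W S"
      by (simp add: P_def)
    then show ?case using f[OF 5(1)] unfolding wW S_def by (meson ennreal_leI order_trans)
  qed (use \<tau> w0 P0 in auto)
  also have "P (nv st ''w'') (rv st ''S'') \<le> real (num_walks M) * (20 * \<tau> / \<alpha> + \<tau>) + B + D * p\<^sub>f / 2"
  proof -
    \<comment> \<open>Since \<mu> \<le> m, one factor \<open>m\<close> cancels against \<mu>, and
      the other is at least \<delta>. So a number of walks proportional to
      \<open>M / \<delta>\<close> yields relative error also for values far above \<delta>.\<close>
    have "M * \<mu> / (real W * \<epsilon>\<^sup>2 * m\<^sup>2) \<le> p\<^sub>f / 2"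
    proof -
      have w: "2 * M \<le> real W * (\<epsilon>\<^sup>2 * \<delta> * p\<^sub>f)"
        using num_walks_ge[of M] eps delta pf by (simp add: W_def field_simps)
      have "2 * (M * \<mu>) \<le> real W * (\<epsilon>\<^sup>2 * \<delta> * p\<^sub>f) * \<mu>"
        using mult_right_mono[OF w \<mu>(1)] by simp
      also have "\<dots> \<le> real W * (\<epsilon>\<^sup>2 * m * p\<^sub>f) * m"
        using m \<mu> eps pf delta W by (intro mult_mono) auto
      finally show ?thesis using W eps m by (simp add: field_simps power2_eq_square)
    qed
    then have "D * (M * \<mu> / (real W * \<epsilon>\<^sup>2 * m\<^sup>2)) \<le> D * (p\<^sub>f / 2)"
      using BD by (intro mult_left_mono)
    moreover have "D * (real W * (M * \<mu>)) / Z = D * (M * \<mu> / (real W * \<epsilon>\<^sup>2 * m\<^sup>2))"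
      using W by (simp add: Z_def field_simps power2_eq_square)
    ultimately show ?thesis using w0 by (simp add: P_def W_def)
  qed
  finally show ?thesis by (simp add: ennreal_leI)
qed


definition node_cost :: "real \<Rightarrow> real" where
  "node_cost M = 12 + real (num_walks M) * (20 / \<alpha> + 1)"

lemma node_cost_nonneg: "0 \<le> node_cost M"
  using alpha by (simp add: node_cost_def)

lemma ert_mc_body_le:
  assumes \<tau>: "0 \<le> \<tau>" and inp: "inputs st" and res: "residue_ok st" and M: "rv st ''M'' = M" "0 < M"
    and y: "nats st ''sample'' (nv st ''i'') = y" "y \<in> V"
    and BD: "0 \<le> B" "0 \<le> D"
    and f: "\<And>st' x. frame mc_body st st' \<Longrightarrow> nv st' ''i'' = Suc (nv st ''i'') \<Longrightarrow>
      reals st' ''estimate'' = (reals st ''estimate'')(y := x) \<Longrightarrow>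
      f st' \<le> ennreal (B + (if bad x y then D else 0))"
  shows "ert \<tau> g mc_body f st \<le> ennreal (\<tau> * node_cost M + (B + D * p\<^sub>f / 2))"
proof -
  let ?fin = "SetR ''estimate'' (NGet ''sample'' (nvar ''i''))
        (RAdd (RGet ''p'' (NGet ''sample'' (nvar ''i''))) (RDiv (rvar ''S'') (RNat (nvar ''w'')))) ;;
     incr ''i''"
  let ?x = "\<lambda>st'. reals st ''p'' y + rv st' ''S'' / real (nv st' ''w'')"
  have fin: "ert \<tau> g ?fin f st' \<le> ennreal (\<tau> + (\<tau> + (\<tau> + (B + (if bad (?x st') y then D else 0)))))"
    if "frame mc_body st st'" "nats st' ''i'' = nats st ''i''" "reals st' ''estimate'' = reals st ''estimate''" for st'
  proof (intro ert_Seq_le ert_moves_le[OF moves_intros(2)] ert_moves_le[OF moves_intros(1)] f, goal_cases)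
    case 1
    show ?case using that(1) by (auto simp: frame_def mc_body_def)
  next
    case 3
    have "nats st' ''sample'' = nats st ''sample''" "reals st' ''p'' = reals st ''p''"
      using that(1) by (simp_all add: frame_def mc_body_def walk_once_def walk_body_def)
    then show ?case using that y by simp
  qed (use that \<tau> BD in auto)
  let ?Z = "real (num_walks M) * (20 * \<tau> / \<alpha> + \<tau>)"
  have Z: "0 \<le> ?Z" using alpha \<tau> by simp
  have loop: "ert \<tau> g (While walk_guard walk_once) (ert \<tau> g ?fin f) st1 \<le>
      ennreal (\<tau> + (?Z + (3 * \<tau> + B) + D * p\<^sub>f / 2))"
    if s: "frame mc_body st st1" "nats st1 ''i'' = nats st ''i''" "reals st1 ''estimate'' = reals st ''estimate''"
      "nv st1 ''w'' = 0" "rv st1 ''S'' = 0" for st1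
  proof -
    have fr1: "nats st1 ''sample'' = nats st ''sample''" "reals st1 ''p'' = reals st ''p''"
      "reals st1 ''r'' = reals st ''r''" "reals st1 ''M'' = reals st ''M''" "inputs st1"
      using s(1) inp by (simp_all add: frame_def mc_body_def walk_once_def walk_body_def inputs_def)
    have "residue_ok st1"
      using res fr1 by (simp add: residue_ok_def err_def[abs_def])
    then show ?thesis
    proof (rule ert_walks_le[OF \<tau> fr1(5)])
      fix st' assume fr: "frame walk_once st1 st'"
      have "ert \<tau> g ?fin f st' \<le> ennreal (\<tau> + (\<tau> + (\<tau> + (B + (if bad (?x st') y then D else 0)))))"
      proof (rule fin)
        show "frame mc_body st st'"
          using s(1) fr by (auto simp: frame_def mc_body_def)
      qed (use s fr in \<open>auto simp: frame_def walk_once_def walk_body_def\<close>)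
      then show "ert \<tau> g ?fin f st' \<le> ennreal (3 * \<tau> + B +
          (if bad (reals st1 ''p'' y + rv st' ''S'' / real (nv st' ''w'')) y then D else 0))"
        unfolding fr1(2) by (simp add: algebra_simps)
    qed (use s fr1 M y \<tau> BD in auto)
  qed
  have "ert \<tau> g mc_body f st \<le> ennreal (\<tau> + (\<tau> + (\<tau> + (\<tau> + (\<tau> + (\<tau> + (?Z + (3 * \<tau> + B) + D * p\<^sub>f / 2)))))))"
    unfolding mc_body_def
  proof (intro ert_Seq_le ert_moves_le[OF moves_intros(2)] ert_moves_le[OF moves_intros(1)] loop[unfolded mc_body_def], goal_cases)
    case 1
    show ?case by (auto simp: frame_def)
  qed (use \<tau> Z BD pf in auto)
  also have "\<tau> + (\<tau> + (\<tau> + (\<tau> + (\<tau> + (\<tau> + (?Z + (3 * \<tau> + B) + D * p\<^sub>f / 2)))))) \<le>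
      \<tau> * node_cost M + (B + D * p\<^sub>f / 2)"
    using \<tau> by (simp add: node_cost_def algebra_simps)
  finally show ?thesis by (simp add: ennreal_leI)
qed


subsection \<open>Estimating all sampled nodes\<close>

definition samples :: "mem \<Rightarrow> nat set" where
  "samples st = nats st ''sample'' ` {..<nv st ''N''}"

text \<open>A node may be sampled repeatedly and overwrites its estimate each time, so only its last
  occurrence counts. While an occurrence lies ahead, the failure probability is at most
  \<open>p\<^sub>f / 2\<close> whatever the current estimate is; afterwards the estimate is final. A
  node that was never sampled is charged as a certain failure.\<close>

lemma ert_monte_carlo_le:
  assumes \<tau>: "0 \<le> \<tau>" and inp: "inputs st" and res: "residue_ok st" and M: "rv st ''M'' = M" "0 < M"
    and V: "samples st \<subseteq> V" and BD: "0 \<le> B" "0 \<le> D"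
    and f: "\<And>st'. frame monte_carlo st st' \<Longrightarrow> rv st' ''M'' = 0 \<Longrightarrow>
      f st' \<le> ennreal (B + (if bad (reals st' ''estimate'' s) s then D else 0))"
  shows "ert \<tau> g monte_carlo f st \<le>
    ennreal (\<tau> * (6 + real (nv st ''N'') * (1 + node_cost M)) + B + D * (if s \<in> samples st then p\<^sub>f / 2 else 1))"
proof -
  let ?fin = "SetR ''M'' (NLit 0) (rlit 0)"
  let ?loop = "While (BNLess (nvar ''i'') (nvar ''N'')) mc_body"
  define N where "N = nv st ''N''"
  define later where "later i = nats st ''sample'' ` {i..<N}" for i
  define P where "P i x = \<tau> + \<tau> * (real N - real i) * (1 + node_cost M) + B +
      D * (if s \<in> later i then p\<^sub>f / 2 else if bad x s then 1 else 0)" for i x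
  have fin: "ert \<tau> g ?fin f st' \<le> ennreal (\<tau> + (B + (if bad (reals st' ''estimate'' s) s then D else 0)))"
    if "frame monte_carlo st st'" for st'
  proof (rule ert_moves_le[OF moves_intros(2)])
    let ?s = "store_real ''M'' (NLit 0) (rval (rlit 0) st') st'"
    have "frame monte_carlo st ?s" using that by (auto simp: frame_def monte_carlo_def)
    from f[OF this] show "f ?s \<le> ennreal (B + (if bad (reals st' ''estimate'' s) s then D else 0))"
      by simp
  qed (use \<tau> BD in auto)
  have loop: "ert \<tau> g ?loop (ert \<tau> g ?fin f) st1 \<le> ennreal (\<tau> + P 0 (reals st ''estimate'' s))"
    if s1: "nv st1 ''i'' = 0" "frame monte_carlo st st1" "reals st1 = reals st" for st1
  proof -
    have fr: "nv st' ''N'' = N" "nats st' ''sample'' = nats st ''sample''" "reals st' ''p'' = reals st ''p''"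
      "reals st' ''r'' = reals st ''r''" "reals st' ''M'' = reals st ''M''" "inputs st'" "frame monte_carlo st st'" "residue_ok st'"
      if "frame mc_body st1 st'" for st'
    proof -
      show "frame monte_carlo st st'" using that s1(2) by (auto simp: frame_def monte_carlo_def)
      then show "nv st' ''N'' = N" "nats st' ''sample'' = nats st ''sample''" and *: "reals st' ''p'' = reals st ''p''"
      "reals st' ''r'' = reals st ''r''" "inputs st'"
        using inp by (simp_all add: frame_def monte_carlo_def mc_body_def walk_once_def walk_body_def inputs_def N_def)
      show **: "reals st' ''M'' = reals st ''M''" using that s1(3) by (simp add: frame_def mc_body_def walk_once_def walk_body_def)
      show "residue_ok st'" using res by (simp add: residue_ok_def err_def[abs_def] * **)
    qed
    have "ert \<tau> g ?loop (ert \<tau> g ?fin f) st1 \<le> ennreal (\<tau> + P (nv st1 ''i'') (reals st1 ''estimate'' s))"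
    proof (rule ert_While_inv_le[where I = "\<lambda>st'. nv st' ''i'' \<le> N" and P = "\<lambda>st'. P (nv st' ''i'') (reals st' ''estimate'' s)"], goal_cases)
      case (3 st')
      then show ?case
        using \<tau> BD pf node_cost_nonneg[of M] unfolding P_def by (intro add_nonneg_nonneg mult_nonneg_nonneg) auto
    next
      case (4 st' F)
      define i where "i = nv st' ''i''"
      define y where "y = nats st ''sample'' i"
      have i: "i < N" using 4 fr(1)[OF 4(1)] by (simp add: i_def)
      have y: "y \<in> V" using V i by (auto simp: samples_def y_def N_def)
      have later: "later i = insert y (later (Suc i))"
      proof -
        have "{i..<N} = insert i {Suc i..<N}" using i by auto
        then show ?thesis by (simp add: later_def y_def)
      qed
      define k where "k = \<tau> + (\<tau> + \<tau> * (real N - real (Suc i)) * (1 + node_cost M) + B)"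
      have k: "0 \<le> k" using i \<tau> BD node_cost_nonneg[of M] by (simp add: k_def)
      define B' where "B' = k + D * (if s \<in> later (Suc i) then p\<^sub>f / 2 else if y = s then 0
          else if bad (reals st' ''estimate'' s) s then 1 else 0)"
      \<comment> \<open>The outcome for this entry matters only if it is the last occurrence of
        \<open>s\<close>.\<close>
      define D' where "D' = (if s \<in> later (Suc i) \<or> y \<noteq> s then 0 else D)"
      have "ert \<tau> g mc_body F st' \<le> ennreal (\<tau> * node_cost M + (B' + D' * p\<^sub>f / 2))"
      proof (rule ert_mc_body_le[OF \<tau> fr(6)[OF 4(1)] fr(8)[OF 4(1)], where y = y])
        fix st'' x
        assume a: "frame mc_body st' st''" "nv st'' ''i'' = Suc (nv st' ''i'')"
          "reals st'' ''estimate'' = (reals st' ''estimate'')(y := x)"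
        have "F st'' \<le> ennreal (\<tau> + P (Suc i) (reals st'' ''estimate'' s))"
          using 4(4)[of st''] a i frame_trans[OF 4(1) a(1)] by (simp add: i_def)
        also have "\<tau> + P (Suc i) (reals st'' ''estimate'' s) = B' + (if bad x y then D' else 0)"
          by (auto simp: P_def B'_def D'_def k_def a(3))
        finally show "F st'' \<le> ennreal (B' + (if bad x y then D' else 0))" .
      qed (use fr[OF 4(1)] M y k BD pf in \<open>auto simp: y_def i_def B'_def D'_def\<close>)
      also have "\<tau> * node_cost M + (B' + D' * p\<^sub>f / 2) = P i (reals st' ''estimate'' s)"
        by (auto simp: B'_def D'_def P_def k_def later algebra_simps)
      finally show ?case by (simp add: i_def)
    next
      case (5 st')
      then have "nv st' ''i'' = N" using fr(1)[OF 5(1)] by simp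
      moreover have "later N = {}" by (simp add: later_def)
      ultimately show ?case using fin[OF fr(7)[OF 5(1)]] by (auto simp: P_def if_distrib algebra_simps)
    qed (use \<tau> s1 in auto)
    then show ?thesis using s1 by simp
  qed
  have P0: "0 \<le> P 0 x" for x
    using \<tau> BD pf node_cost_nonneg[of M] unfolding P_def by (intro add_nonneg_nonneg mult_nonneg_nonneg) auto
  have "ert \<tau> g monte_carlo f st \<le> ennreal (\<tau> + (\<tau> + (\<tau> + (\<tau> + P 0 (reals st ''estimate'' s)))))"
    unfolding monte_carlo_def
    by (intro ert_Seq_le ert_moves_le[OF moves_intros(1)] loop)
       (use \<tau> P0 in \<open>auto simp: frame_def monte_carlo_def\<close>)
  also have "\<tau> + (\<tau> + (\<tau> + (\<tau> + P 0 (reals st ''estimate'' s)))) \<le>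
     \<tau> * (6 + real (nv st ''N'') * (1 + node_cost M)) + B + D * (if s \<in> samples st then p\<^sub>f / 2 else 1)"
  proof -
    have "later 0 = samples st" by (simp add: later_def samples_def N_def lessThan_atLeast0)
    then show ?thesis using \<tau> BD by (auto simp: P_def N_def algebra_simps)
  qed
  finally show ?thesis by (simp add: ennreal_leI)
qed

end


subsection \<open>Sampling nodes\<close>

context ppr_instance
begin

abbreviation n :: real where "n \<equiv> real (card V)"

lemma n_pos: "0 < n" using card_V_pos by simp

lemma n_ge_1: "1 \<le> n" using card_V_pos by linarith

text \<open>The expected number of samples at the moment the target is hit for the \<open>K\<close>-th time.\<close>

definition total_samples :: "mem \<Rightarrow> real" where
  "total_samples st = real (nv st ''N'') + (real K - real (nv st ''hits'')) * n"

text \<open>Bounds the probability that \<open>s\<close> is still missing when the target is hit for the \<open>K\<close>-th time: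
  the next sample in \<open>{s, t}\<close> is equally likely to be \<open>s\<close> and \<open>t\<close>.\<close>

definition miss :: "nat \<Rightarrow> mem \<Rightarrow> real" where
  "miss s st = (if s \<in> samples st then 0 else (1 / 2) ^ (K - nv st ''hits''))"

lemma miss_nonneg: "0 \<le> miss s st" by (simp add: miss_def)

lemma ert_Jump_le:
  assumes "\<And>x. x \<in> V \<Longrightarrow> f (store_nat a i x st) \<le> ennreal (h x)" "\<And>x. x \<in> V \<Longrightarrow> 0 \<le> h x" "0 \<le> \<tau>"
    "(\<Sum>x\<in>V. h x) \<le> n * B"
  shows "ert \<tau> g (Jump a i) f st \<le> ennreal (\<tau> + B)"
proof -
  have "(\<integral>\<^sup>+ x. f (store_nat a i x st) \<partial>measure_pmf (pmf_of_set V)) \<le> ennreal ((\<Sum>x\<in>V. h x) / n)"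
    by (rule nn_integral_pmf_of_set_le) (use assms in auto)
  also have "\<dots> \<le> ennreal B"
    using assms(4) n_pos by (intro ennreal_leI) (simp add: field_simps)
  finally have "(\<integral>\<^sup>+ x. f (store_nat a i x st) \<partial>measure_pmf (pmf_of_set V)) \<le> ennreal B" .
  moreover have "0 \<le> B"
  proof -
    have "0 \<le> (\<Sum>x\<in>V. h x)" by (rule sum_nonneg) (use assms(2) in auto)
    then have "0 \<le> n * B" using assms(4) by linarith
    then show ?thesis using n_pos zero_le_mult_iff[of n B] by linarith
  qed
  ultimately show ?thesis
    using assms(3) by (simp add: ert.simps ennreal_add_le del: ennreal_plus)
qed

text \<open>The Boolean \<open>b\<close> selects how the sampling time is bounded: by
  \<open>c\<close>, as each sample uses up at least one unit of it, or by the number of samples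
  expected at the K-th hit. In the loop \<open>total_samples\<close> is a martingale and
  \<open>miss\<close> a supermartingale, so a continuation affine in them passes through.\<close>

lemma ert_sampling_le:
  assumes \<tau>: "0 \<le> \<tau>" and inp: "inputs st" and M: "rv st ''M'' = M" "0 < M"
    and X: "X = 1 + M / \<delta>" and c: "nv st ''c'' = c" and s: "s \<in> V"
    and h: "nv st ''hits'' < K" and V: "samples st \<subseteq> V" and pos: "0 \<le> \<beta>0" "0 \<le> \<beta>1" "0 \<le> D"
    and f: "\<And>st'. \<lbrakk>frame sample_body st st'; samples st' \<subseteq> V; nv st' ''hits'' \<le> K;
        nv st' ''hits'' < K \<Longrightarrow> real c < (real (nv st' ''N'') + 1) * X;
        nv st' ''hits'' = K \<Longrightarrow> real (nv st' ''N'') * X \<le> real c\<rbrakk> \<Longrightarrow>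
      f st' \<le> ennreal (\<beta>0 + \<beta>1 * total_samples st' + D * miss s st')"
  shows "ert \<tau> g (sampling K) f st \<le> ennreal (\<tau> + 12 * \<tau> * (if b then real c else total_samples st) +
     \<beta>0 + \<beta>1 * total_samples st + D * miss s st)"
proof -
  define E where "E N k = (if b then max 0 (real c - real N) else (real K - real k) * n)" for N k :: nat
  define P where "P N k z = 12 * \<tau> * E N k + \<beta>0 + \<beta>1 * (real N + (real K - real k) * n) + D * z" for N k :: nat and z
  have X1: "1 \<le> X" using M delta by (simp add: X)
  have P0: "0 \<le> P N k z" if "k \<le> K" "0 \<le> z" for N k z
    using that \<tau> pos n_pos unfolding P_def E_def
    by (intro add_nonneg_nonneg mult_nonneg_nonneg) (auto simp: mult_nonneg_nonneg)
  have fr: "nv st' ''target'' = t" "rv st' ''M'' = M" "rv st' ''delta'' = \<delta>" "nv st' ''c'' = c"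
    if "frame sample_body st st'" for st'
    using that inp M c by (simp_all add: frame_def sample_body_def inputs_def)
  have guard: "bval (sample_guard K) st' \<longleftrightarrow> nv st' ''hits'' < K \<and> (real (nv st' ''N'') + 1) * X \<le> real c"
    if "frame sample_body st st'" for st'
    by (simp add: sample_guard_def fr[OF that] X not_less algebra_simps)
  \<comment> \<open>At the K-th hit \<open>N * X\<close> is still at most \<open>c\<close>, because
    that sample had to pass the guard with \<open>N + 1\<close>. This bounds the cost of the walks
    by that of the pushes they replace.\<close>
  let ?I = "\<lambda>st'. samples st' \<subseteq> V \<and> nv st' ''hits'' \<le> K \<and> (nv st' ''hits'' = K \<longrightarrow> real (nv st' ''N'') * X \<le> real c)"
  let ?P = "\<lambda>st'. P (nv st' ''N'') (nv st' ''hits'') (miss s st')"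
  have "ert \<tau> g (sampling K) f st \<le> ennreal (\<tau> + ?P st)"
    unfolding sampling_def
  proof (rule ert_While_inv_le[where I = ?I and P = ?P], goal_cases)
    case (3 st')
    then show ?case by (intro P0) (auto simp: miss_nonneg)
  next
    case (4 st' F)
    define N where "N = nv st' ''N''"
    define k where "k = nv st' ''hits''"
    have kK: "k < K" and NX: "(real N + 1) * X \<le> real c" using 4 guard by (auto simp: N_def k_def)
    have "real N + 1 \<le> (real N + 1) * X" using mult_left_mono[OF X1, of "real N + 1"] by auto
    then have Nc: "real N + 1 \<le> real c" using NX by (rule order_trans)
    define m where "m = (if s \<in> samples st' then 0 else (1 / 2 :: real) ^ (K - k))"
    have m: "m = miss s st'" "0 \<le> m" by (auto simp: m_def miss_def k_def)
    let ?rest = "SetN ''sample'' (nvar ''N'') (nvar ''x'') ;; incr ''N'' ;;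
       Cond (BAnd (BNot (BNLess (nvar ''x'') (nvar ''target'')))
                  (BNot (BNLess (nvar ''target'') (nvar ''x'')))) (incr ''hits'') Skip"
    define k' where "k' x = (if x = t then Suc k else k)" for x
    define z where "z x = (if s \<in> insert x (samples st') then 0 else (1 / 2 :: real) ^ (K - k' x))" for x
    have z0: "0 \<le> z x" for x by (simp add: z_def)
    have k'K: "k' x \<le> K" for x using kK by (simp add: k'_def)
    have rest: "ert \<tau> g ?rest F (store_nat ''x'' (NLit 0) x st') \<le> ennreal (9 * \<tau> + P (Suc N) (k' x) (z x))"
      if x: "x \<in> V" for x
    proof -
      have T: "triple g (store_nat ''x'' (NLit 0) x st') ?rest 8
        (\<lambda>st''. nats st'' ''sample'' = (nats st' ''sample'')(N := x) \<and> nv st'' ''N'' = Suc N \<and> nv st'' ''hits'' = k' x)"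
        by (intro straight_intros triple_Cond_end)
           (use fr[OF 4(1)] in \<open>auto simp: N_def k_def k'_def\<close>)
      have "triple g (store_nat ''x'' (NLit 0) x st') ?rest 8
        (\<lambda>st''. nats st'' ''sample'' = (nats st' ''sample'')(N := x) \<and> nv st'' ''N'' = Suc N \<and> nv st'' ''hits'' = k' x \<and>
          frame sample_body st st'')"
        by (rule triple_weaken[OF T]) (use 4(1) in \<open>auto simp: frame_def sample_body_def\<close>)
      then show ?thesis
      proof (rule tripleD[OF _ \<tau>, where B = "\<tau> + P (Suc N) (k' x) (z x)"], goal_cases)
        case 1
        show ?case using P0[OF k'K z0] \<tau> by simp
      next
        case (2 st'')
        have sm: "samples st'' = insert x (samples st')"
          using 2 by (auto simp: samples_def N_def lessThan_Suc)
        have "F st'' \<le> ennreal (\<tau> + ?P st'')"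
        proof (rule 4(4))
          show "?I st''" using 2 sm x 4(2) NX k'K by (simp add: algebra_simps)
        qed (use 2 in blast)
        also have "?P st'' = P (Suc N) (k' x) (z x)"
          using 2 by (simp add: miss_def sm z_def)
        finally show ?case .
      qed simp
    qed
    define A where "A = 9 * \<tau> + 12 * \<tau> * (if b then real c - real (Suc N) else (real K - real k) * n) + \<beta>0 +
        \<beta>1 * (real (Suc N) + (real K - real k) * n)"
    define q where "q = (if b then 0 else 12 * \<tau> * n) + \<beta>1 * n"
    \<comment> \<open>A hit of the target doubles the bound and a hit of \<open>s\<close> removes
      it. Over a uniform sample the two corrections on the right cancel.\<close>
    have zle: "z x \<le> m * (1 + (if x = t then 1 else 0) - (if x = s then 1 else 0))" for x
    proof -
      have "(1 / 2 :: real) ^ (K - k) = (1 / 2) * (1 / 2) ^ (K - Suc k)"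
        using kK by (metis Suc_diff_Suc power_Suc)
      then show ?thesis by (auto simp: z_def m_def k'_def)
    qed
    have "(\<Sum>x\<in>V. 9 * \<tau> + P (Suc N) (k' x) (z x)) \<le>
        (\<Sum>x\<in>V. A + D * m + (D * m - q) * (if x = t then 1 else 0) - D * m * (if x = s then 1 else 0))"
    proof (rule sum_mono)
      fix x
      have "9 * \<tau> + P (Suc N) (k' x) (z x) = A - q * (if x = t then 1 else 0) + D * z x"
        using Nc by (simp add: A_def q_def P_def E_def k'_def algebra_simps)
      moreover have "D * z x \<le> D * (m * (1 + (if x = t then 1 else 0) - (if x = s then 1 else 0)))"
        using zle pos by (intro mult_left_mono) auto
      ultimately show "9 * \<tau> + P (Suc N) (k' x) (z x) \<le>
        A + D * m + (D * m - q) * (if x = t then 1 else 0) - D * m * (if x = s then 1 else 0)"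
        by (simp add: algebra_simps split: if_splits)
    qed
    also have "\<dots> = n * (A + D * m) + (D * m - q) - D * m"
      using s target by (simp add: sum.distrib sum_subtractf sum_distrib_left[symmetric])
    \<comment> \<open>A hit shortens the expected wait by \<open>n\<close> samples and has
      probability \<open>1 / n\<close>, which pays for the sample just taken.\<close>
    also have "\<dots> = n * (A + D * m - (if b then 0 else 12 * \<tau>) - \<beta>1)"
      by (simp add: q_def algebra_simps)
    finally have sum: "(\<Sum>x\<in>V. 9 * \<tau> + P (Suc N) (k' x) (z x)) \<le> n * (A + D * m - (if b then 0 else 12 * \<tau>) - \<beta>1)" .
    have hn: "0 \<le> 9 * \<tau> + P (Suc N) (k' x) (z x)" for x using P0[OF k'K z0] \<tau> by simp
    have jump: "ert \<tau> g (Jump ''x'' (NLit 0)) (ert \<tau> g ?rest F) st' \<le>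
        ennreal (\<tau> + (A + D * m - (if b then 0 else 12 * \<tau>) - \<beta>1))"
      by (rule ert_Jump_le[OF rest hn \<tau> sum])
    have "0 \<le> (\<Sum>x\<in>V. 9 * \<tau> + P (Suc N) (k' x) (z x))" by (intro sum_nonneg hn)
    then have "0 \<le> n * (A + D * m - (if b then 0 else 12 * \<tau>) - \<beta>1)"
      using sum by (rule order_trans)
    then have "0 \<le> A + D * m - (if b then 0 else 12 * \<tau>) - \<beta>1"
      using n_pos zero_le_mult_iff by (metis less_le_not_le)
    then have "ert \<tau> g sample_body F st' \<le> ennreal (\<tau> + (\<tau> + (A + D * m - (if b then 0 else 12 * \<tau>) - \<beta>1)))"
      unfolding sample_body_def using \<tau> by (intro ert_Seq_le jump) auto
    also have "\<tau> + (\<tau> + (A + D * m - (if b then 0 else 12 * \<tau>) - \<beta>1)) \<le> P N k m"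
      using Nc \<tau> by (simp add: A_def P_def E_def algebra_simps)
    finally show ?case by (simp add: ennreal_leI N_def k_def m(1))
  next
    case (5 st')
    have "f st' \<le> ennreal (\<beta>0 + \<beta>1 * total_samples st' + D * miss s st')"
      by (rule f) (use 5 guard[OF 5(1)] in auto)
    also have "\<beta>0 + \<beta>1 * total_samples st' + D * miss s st' \<le> ?P st'"
      using \<tau> 5(2) n_pos by (simp add: P_def E_def total_samples_def)
    finally show ?case by (simp add: ennreal_leI)
  qed (use h V \<tau> in auto)
  also have "\<tau> + ?P st \<le> \<tau> + 12 * \<tau> * (if b then real c else total_samples st) +
     \<beta>0 + \<beta>1 * total_samples st + D * miss s st"
  proof -
    have "E (nv st ''N'') (nv st ''hits'') \<le> (if b then real c else total_samples st)"
      by (simp add: E_def total_samples_def)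
    then have "12 * \<tau> * E (nv st ''N'') (nv st ''hits'') \<le> 12 * \<tau> * (if b then real c else total_samples st)"
      using \<tau> by (intro mult_left_mono) auto
    then show ?thesis unfolding P_def total_samples_def[symmetric] by linarith
  qed
  finally show ?thesis by (simp add: ennreal_leI)
qed


section \<open>Phases\<close>

definition level :: "nat \<Rightarrow> real" where
  "level k = (1 - \<alpha> / 2) ^ k"

lemma level_pos: "0 < level k" and level_le_1: "level k \<le> 1"
  using alpha by (auto simp: level_def intro: power_le_one)

text \<open>Cost per node of the walks in phase \<open>k\<close>, up to \<open>mc_factor\<close>;
  the summand 1 accounts for rounding the number of walks up.\<close>

definition walk_factor :: "nat \<Rightarrow> real" where
  "walk_factor k = 1 + level k / \<delta>"

lemma walk_factor_ge_1: "1 \<le> walk_factor k"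
  using level_pos[of k] delta by (simp add: walk_factor_def)

text \<open>A pushed node has residue more than \<open>\<alpha> M / 2\<close>, and \<open>\<alpha>\<close> times the residue is at most
  the PageRank value; hence this bounds the work of a push phase independently of its state.\<close>

definition push_bound :: "nat \<Rightarrow> real" where
  "push_bound k = (\<Sum>u | u \<in> V \<and> \<alpha> * \<alpha> * level k / 2 < ppr_t u. real (length (in_nbrs g u)))"

lemma push_bound_nonneg: "0 \<le> push_bound k"
  by (simp add: push_bound_def sum_nonneg)

text \<open>A phase always starts with \<open>hits < K\<close>, as the K-th hit leads to the walks
  and out of the loop. Keeping \<open>estimate\<close> equal to \<open>p\<close> allows stopping
  before any phase.\<close>

definition phase_inv :: "nat \<Rightarrow> mem \<Rightarrow> bool" where
  "phase_inv k st \<longleftrightarrow> inputs st \<and> touched_ok st \<and> (\<forall>v. reals st ''r'' v \<noteq> 0 \<longrightarrow> v \<in> set (touched st)) \<and>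
     reals st ''estimate'' = reals st ''p'' \<and> residue_ok st \<and> rv st ''M'' = level k \<and>
     nv st ''hits'' < K \<and> samples st \<subseteq> V"

lemma scan_cost_le_push_bound:
  assumes "phase_inv k st"
  shows "real (\<Sum>j<nv st ''len''. scan_cost g st (nats st ''list'' j)) \<le> push_bound k"
proof -
  have ok: "touched_ok st" "residue_ok st" and M: "rv st ''M'' = level k" "rv st ''alpha'' = \<alpha>"
    using assms by (auto simp: phase_inv_def inputs_def)
  have "(\<Sum>j<nv st ''len''. scan_cost g st (nats st ''list'' j)) = sum_list (map (scan_cost g st) (touched st))"
    by (simp add: touched_def sum_list_sum_nth lessThan_atLeast0)
  also have "\<dots> = (\<Sum>u\<in>set (touched st). scan_cost g st u)"
    using ok(1) by (intro sum_list_distinct_conv_sum_set) (simp add: touched_ok_def)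
  also have "\<dots> \<le> (\<Sum>u\<in>V. scan_cost g st u)"
    using ok(1) by (intro sum_mono2) (auto simp: touched_ok_def)
  also have "\<dots> \<le> (\<Sum>u\<in>V. if \<alpha> * \<alpha> * level k / 2 < ppr_t u then length (in_nbrs g u) else 0)"
  proof (rule sum_mono)
    fix u assume u: "u \<in> V"
    have "\<alpha> * \<alpha> * level k / 2 < ppr_t u" if "\<alpha> * level k / 2 < reals st ''r'' u"
    proof -
      have "\<alpha> * (\<alpha> * level k / 2) < \<alpha> * reals st ''r'' u" using that alpha by (intro mult_strict_left_mono)
      also have "\<dots> \<le> ppr_t u" using err_bounds(3,4)[OF ok(2) u] by linarith
      finally show ?thesis by simp
    qed
    then show "scan_cost g st u \<le> (if \<alpha> * \<alpha> * level k / 2 < ppr_t u then length (in_nbrs g u) else 0)"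
      by (auto simp: scan_cost_def M)
  qed
  finally have "real (\<Sum>j<nv st ''len''. scan_cost g st (nats st ''list'' j)) \<le>
      real (\<Sum>u\<in>V. if \<alpha> * \<alpha> * level k / 2 < ppr_t u then length (in_nbrs g u) else 0)"
    by (rule of_nat_mono)
  also have "\<dots> = push_bound k"
    unfolding push_bound_def by (simp add: sum.inter_filter of_nat_sum if_distrib cong: if_cong)
  finally show ?thesis .
qed

lemma residue_ok_cong:
  assumes "reals st' ''p'' = reals st ''p''" "reals st' ''r'' = reals st ''r''" "reals st' ''M'' = reals st ''M''"
  shows "residue_ok st' = residue_ok st"
  by (simp add: residue_ok_def err_def[abs_def] assms)

text \<open>What is left at a node is at most \<open>\<alpha> * M / 2\<close>, and what arrives is
  at most \<open>(1 - \<alpha>) * M\<close>; the scan threshold makes the sum smaller than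
  \<open>M\<close> by a constant factor. The residue equation survives as it is linear in
  \<open>err\<close>, \<open>r\<close> and \<open>a\<close>.\<close>

lemma residue_ok_push:
  assumes ok: "residue_ok st" and a: "\<And>v. v \<in> V \<Longrightarrow> a v = scan_amt st v"
    and M: "0 < rv st ''M''" "rv st' ''M'' = rv st ''M'' * (1 - \<alpha> / 2)" and al: "rv st ''alpha'' = \<alpha>"
    and p: "\<And>v. v \<in> V \<Longrightarrow> reals st' ''p'' v = reals st ''p'' v + \<alpha> * a v"
    and r: "\<And>v. v \<in> V \<Longrightarrow> reals st' ''r'' v = reals st ''r'' v - a v + (1 - \<alpha>) * out_mean g a v"
  shows "residue_ok st'"
  unfolding residue_ok_def
proof (intro conjI ballI)
  let ?M = "rv st ''M''"
  have r0: "0 \<le> reals st ''r'' v" "reals st ''r'' v \<le> ?M" if "v \<in> V" for v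
    using ok that by (auto simp: residue_ok_def)
  have a0: "0 \<le> a v" "a v \<le> ?M" "a v \<le> reals st ''r'' v" "reals st ''r'' v - a v \<le> \<alpha> * ?M / 2" if "v \<in> V" for v
    using r0[OF that] M alpha by (auto simp: a[OF that] scan_amt_def al)
  fix v assume v: "v \<in> V"
  show "0 \<le> reals st' ''p'' v" using ok v a0[OF v] alpha by (simp add: p residue_ok_def)
  have mean: "0 \<le> out_mean g a v" "out_mean g a v \<le> ?M"
    using out_mean_mono[OF v, of "\<lambda>_. 0" a] out_mean_mono[OF v, of a "\<lambda>_. ?M"] a0 v by auto
  then show "0 \<le> reals st' ''r'' v" using a0[OF v] alpha r[OF v] by simp
  have "(1 - \<alpha>) * out_mean g a v \<le> (1 - \<alpha>) * ?M" using mean alpha by (intro mult_left_mono) auto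
  then show "reals st' ''r'' v \<le> rv st' ''M''" using a0[OF v] r[OF v] M by (simp add: algebra_simps)
  have "out_mean g (err st') v = out_mean g (\<lambda>w. err st w - \<alpha> * a w) v"
    by (rule out_mean_cong[OF v]) (simp add: err_def p)
  also have "\<dots> = out_mean g (err st) v - \<alpha> * out_mean g a v" by (simp add: out_mean_diff out_mean_cmult)
  finally have m: "out_mean g (err st') v = out_mean g (err st) v - \<alpha> * out_mean g a v" .
  have "err st' v = err st v - \<alpha> * a v" by (simp add: err_def p[OF v])
  also have "err st v = \<alpha> * reals st ''r'' v + (1 - \<alpha>) * out_mean g (err st) v"
    using ok v by (simp add: residue_ok_def)
  finally show "err st' v = \<alpha> * reals st' ''r'' v + (1 - \<alpha>) * out_mean g (err st') v"
    by (simp add: m r[OF v] algebra_simps)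
qed

lemma triple_push_phase:
  assumes inv: "phase_inv k st" and fr: "frame (Seq scan (sampling K)) st st2"
    and amt: "\<And>j. j < nv st ''len'' \<Longrightarrow> reals st2 ''amt'' (nats st ''list'' j) = scan_amt st (nats st ''list'' j)"
    and c: "c = (\<Sum>j<nv st ''len''. scan_cost g st (nats st ''list'' j))"
    and hits: "nv st2 ''hits'' < K" and sam: "samples st2 \<subseteq> V"
  shows "triple g st2 push (10 + 30 * real (nv st ''len'') + 25 * real c)
    (\<lambda>st'. phase_inv (Suc k) st' \<and> nv st' ''len'' \<le> nv st ''len'' + c \<and>
       nats st' ''hits'' = nats st2 ''hits'' \<and> nats st' ''N'' = nats st2 ''N'' \<and> nats st' ''sample'' = nats st2 ''sample'')"
proof -
  have fr2: "nats st2 ''list'' = nats st ''list''" "nats st2 ''len'' = nats st ''len''" "nats st2 ''mark'' = nats st ''mark''"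
    "reals st2 ''r'' = reals st ''r''" "reals st2 ''p'' = reals st ''p''" "reals st2 ''estimate'' = reals st ''estimate''"
    "reals st2 ''M'' = reals st ''M''" "inputs st2 = inputs st" "reals st2 ''alpha'' = reals st ''alpha''"
    using fr by (simp_all add: frame_def scan_def scan_body_def sampling_def sample_body_def inputs_def)
  note i = inv[unfolded phase_inv_def]
  have al: "rv st ''alpha'' = \<alpha>" using i by (simp add: inputs_def)
  have M: "0 < rv st ''M''" using i level_pos by simp
  have res2: "residue_ok st2" using residue_ok_cong[OF fr2(5,4,7)] i by simp
  have t2: "touched st2 = touched st" "touched_ok st2" using touched_ok_cong[OF fr2(1-3)] i by auto
  have th: "0 < \<alpha> * rv st ''M'' / 2" using alpha M by simp
  have amt': "reals st2 ''amt'' (touched st ! j) = scan_amt st (touched st ! j)" if "j < nv st ''len''" for j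
    using amt[OF that] that by (simp add: touched_nth)
  have amt_in: "reals st2 ''amt'' v = scan_amt st v" if "v \<in> set (touched st)" for v
    using that amt' by (metis in_set_conv_nth length_touched)
  have pos: "0 \<le> scan_amt st v" for v using th by (simp add: scan_amt_def al)
  have pc: "push_cost st2 (touched st ! j) = scan_cost g st (nats st ''list'' j)" if "j < nv st ''len''" for j
    using amt'[OF that] th that by (auto simp: push_cost_def scan_cost_def scan_amt_def al touched_nth)
  then have sc: "(\<Sum>j<nv st2 ''len''. push_cost st2 (touched st2 ! j)) = c"
    unfolding c t2 fr2 by (intro sum.cong) auto
  have "triple g st2 push (10 + 30 * real (nv st2 ''len'') +
      25 * real (\<Sum>j<nv st2 ''len''. push_cost st2 (touched st2 ! j)))
    (\<lambda>st'. push_result st2 (nv st2 ''len'') st' \<and> rv st' ''M'' = rv st2 ''M'' * (1 - \<alpha> / 2))"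
  proof (rule triple_push[OF t2(2)])
    show "0 \<le> reals st2 ''amt'' (touched st2 ! j)" if "j < nv st2 ''len''" for j
      using that pos amt' by (simp add: t2 fr2)
  qed (use i fr2 t2 in \<open>auto simp: inputs_def\<close>)
  from this[unfolded sc] show ?thesis
  proof (rule triple_weaken, goal_cases)
    case (2 st')
    have fr3: "inputs st' = inputs st" "nats st' ''hits'' = nats st2 ''hits''" "nats st' ''N'' = nats st2 ''N''"
      "nats st' ''sample'' = nats st2 ''sample''"
      using 2(1) fr2(8) by (simp_all add: frame_def push_def push_body_def spread_body_def inputs_def)
    note pr = conjunct1[OF 2(2), unfolded push_result_def sc]
    \<comment> \<open>Untouched nodes have residue 0, below the positive threshold, so the list
      misses no node that has to be pushed.\<close>
    have full: "pushed st2 (nv st ''len'') v = scan_amt st v" for v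
      using amt_in[of v] i th by (auto simp: pushed_def t2 fr2 scan_amt_def al)
    have "residue_ok st'"
      by (rule residue_ok_push[OF res2, where a = "pushed st2 (nv st ''len'')"])
         (use pr 2(2) M al in \<open>auto simp: full scan_amt_def fr2\<close>)
    moreover have "reals st' ''estimate'' = reals st' ''p''" using pr by auto
    moreover have "nv st' ''len'' \<le> nv st ''len'' + c"
    proof -
      obtain xs where "touched st' = touched st2 @ xs" "length xs \<le> c" using pr by auto
      then show ?thesis by (metis fr2(2) add_left_mono length_append length_touched)
    qed
    moreover have "samples st' \<subseteq> V" using sam fr3 by (simp add: samples_def)
    ultimately show ?case
      using pr 2(2) i hits fr3 by (simp add: phase_inv_def level_def fr2)
  qed (simp add: fr2)
qed

end

section \<open>Expected cost and failure probability of one phase\<close>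

context ppr_instance
begin

definition mc_factor :: real where
  "mc_factor = 13 + (1 + 2 / (\<epsilon>\<^sup>2 * p\<^sub>f)) * (20 / \<alpha> + 1)"

lemma mc_factor_nonneg: "0 \<le> mc_factor"
  using eps pf alpha by (simp add: mc_factor_def)

lemma node_cost_le: "1 + node_cost (level k) \<le> mc_factor * walk_factor k"
proof -
  let ?u = "20 / \<alpha> + 1" and ?q = "2 / (\<epsilon>\<^sup>2 * p\<^sub>f)" and ?x = "level k / \<delta>"
  have u: "0 \<le> ?u" and q: "0 \<le> ?q" and x: "0 \<le> ?x"
    using alpha eps pf delta level_pos[of k] by auto
  have "real (num_walks (level k)) \<le> 1 + ?q * ?x"
    using num_walks_le[OF level_pos[of k]] by (simp add: field_simps)
  also have "1 + a * b \<le> (1 + a) * (1 + b)" if "0 \<le> a" "0 \<le> b" for a b :: real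
    using that by (simp add: algebra_simps)
  note this[OF q x]
  finally have "real (num_walks (level k)) * ?u \<le> (1 + ?q) * (1 + ?x) * ?u"
    using u by (intro mult_right_mono)
  moreover have "13 \<le> 13 * (1 + ?x)" using x by simp
  moreover have "mc_factor * walk_factor k = 13 * (1 + ?x) + (1 + ?q) * (1 + ?x) * ?u"
  proof -
    have "(13 + a * u) * y = 13 * y + a * y * u" for a u y :: real by (simp add: algebra_simps)
    then show ?thesis unfolding mc_factor_def walk_factor_def .
  qed
  ultimately show ?thesis by (simp add: node_cost_def)
qed

text \<open>37 is 12 for a sample plus 25 for a push along one arc.\<close>

definition phase_factor :: real where
  "phase_factor = 37 + mc_factor"

text \<open>With fewer than \<open>K\<close> hits at least one more wait of \<open>n\<close> samples
  is expected. This turns the stopping condition \<open>c < (N + 1) * X\<close> into a bound on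
  \<open>c\<close> in terms of \<open>total_samples\<close>.\<close>

lemma total_samples_ge:
  assumes "nv st ''hits'' < K"
  shows "real (nv st ''N'') + 1 \<le> total_samples st"
proof -
  have "1 \<le> real K - real (nv st ''hits'')" using assms by linarith
  then have "1 * 1 \<le> (real K - real (nv st ''hits'')) * n"
    using n_ge_1 by (intro mult_mono) auto
  then show ?thesis by (simp add: total_samples_def)
qed

text \<open>Either charge covers either outcome. If pushes are made, their cost \<open>c\<close> is
  at most \<open>push_bound k\<close> and also below \<open>(N + 1) * X\<close>; if walks are made,
  they cost about \<open>N * X\<close>, which is at most \<open>c\<close>. So the analysis may fix
  \<open>b\<^sub>0\<close> and \<open>b\<^sub>1\<close> without knowing what the program will
  choose. Assumption and conclusion are both affine in \<open>len\<close>,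
  \<open>total_samples\<close> and \<open>miss\<close>, which makes the lemma iterable;
  \<open>\<gamma>L\<close> prices the list entries that the pushes add.\<close>

lemma ert_phase_le:
  assumes \<tau>: "0 \<le> \<tau>" and inv: "phase_inv k st" and s: "s \<in> V"
    and pos: "0 \<le> \<gamma>0" "0 \<le> \<gamma>L" "0 \<le> \<gamma>1" "0 \<le> D"
    and b: "(b\<^sub>0 = push_bound k \<and> b\<^sub>1 = 0) \<or> (b\<^sub>0 = 0 \<and> b\<^sub>1 = walk_factor k)"
    and f1: "\<And>st'. phase_inv (Suc k) st' \<Longrightarrow> f st' \<le> ennreal (\<gamma>0 + D * p\<^sub>f / 2 + \<gamma>L * real (nv st' ''len'') +
       \<gamma>1 * total_samples st' + D * miss s st')"
    and f2: "\<And>st'. rv st' ''M'' = 0 \<Longrightarrow> inputs st' \<Longrightarrow>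
       f st' \<le> ennreal (\<gamma>0 + (if bad (reals st' ''estimate'' s) s then D else 0))"
  shows "ert \<tau> g (phase K) f st \<le> ennreal (\<gamma>0 + D * p\<^sub>f / 2 + 40 * \<tau> + (\<gamma>L + 60 * \<tau>) * real (nv st ''len'') +
     \<gamma>1 * total_samples st + (phase_factor * \<tau> + \<gamma>L) * (b\<^sub>0 + b\<^sub>1 * total_samples st) + D * miss s st)"
proof -
  define L where "L = nv st ''len''"
  define c where "c = (\<Sum>j<nv st ''len''. scan_cost g st (nats st ''list'' j))"
  define X where "X = walk_factor k"
  define e where "e = (25 + mc_factor) * \<tau> + \<gamma>L"
  define \<beta>0 where "\<beta>0 = \<gamma>0 + D * p\<^sub>f / 2 + \<tau> * (11 + 30 * real L) + \<gamma>L * real L + e * b\<^sub>0"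
  define \<beta>1 where "\<beta>1 = \<gamma>1 + e * b\<^sub>1"
  have e: "0 \<le> e" using \<tau> pos mc_factor_nonneg by (simp add: e_def)
  have X1: "1 \<le> X" using walk_factor_ge_1 by (simp add: X_def)
  have b0: "0 \<le> b\<^sub>0" "0 \<le> b\<^sub>1" using b push_bound_nonneg[of k] X1 by (auto simp: X_def)
  have \<beta>: "0 \<le> \<beta>0" "0 \<le> \<beta>1" using e b0 pos \<tau> pf by (auto simp: \<beta>0_def \<beta>1_def)
  have cb: "real c \<le> push_bound k" unfolding c_def by (rule scan_cost_le_push_bound[OF inv])
  note i = inv[unfolded phase_inv_def]
  let ?cond = "Cond (BNLess (nvar ''hits'') (NLit K)) push monte_carlo"
  have cond: "ert \<tau> g ?cond f st2 \<le> ennreal (\<beta>0 + \<beta>1 * total_samples st2 + D * miss s st2)"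
    if fr: "frame (Seq scan (sampling K)) st st2"
      and amt: "\<And>j. j < nv st ''len'' \<Longrightarrow> reals st2 ''amt'' (nats st ''list'' j) = scan_amt st (nats st ''list'' j)"
      and sam: "samples st2 \<subseteq> V" and hK: "nv st2 ''hits'' \<le> K"
      and h1: "nv st2 ''hits'' < K \<Longrightarrow> real c < (real (nv st2 ''N'') + 1) * X"
      and h2: "nv st2 ''hits'' = K \<Longrightarrow> real (nv st2 ''N'') * X \<le> real c" for st2
  proof (cases "nv st2 ''hits'' < K")
    case True
    have "real c \<le> b\<^sub>0 + b\<^sub>1 * total_samples st2"
      using b
    proof
      assume "b\<^sub>0 = 0 \<and> b\<^sub>1 = walk_factor k"
      moreover have "(real (nv st2 ''N'') + 1) * X \<le> total_samples st2 * X"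
        using total_samples_ge[OF True] X1 by (intro mult_right_mono) auto
      ultimately show ?thesis using h1[OF True] by (simp add: X_def mult.commute)
    qed (use cb in auto)
    then have ec: "e * real c \<le> e * (b\<^sub>0 + b\<^sub>1 * total_samples st2)" using e by (intro mult_left_mono)
    have Y0: "0 \<le> total_samples st2" using total_samples_ge[OF True] by linarith
    have "ert \<tau> g push f st2 \<le> ennreal (\<tau> * (10 + 30 * real L + 25 * real c) +
        (\<gamma>0 + D * p\<^sub>f / 2 + \<gamma>L * (real L + real c) + \<gamma>1 * total_samples st2 + D * miss s st2))"
    proof (rule tripleD[OF triple_push_phase[OF inv fr amt c_def True sam] \<tau>, where B = "\<gamma>0 + D * p\<^sub>f / 2 +
          \<gamma>L * (real L + real c) + \<gamma>1 * total_samples st2 + D * miss s st2"], goal_cases)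
      case 2
      show ?case using pos Y0 miss_nonneg[of s st2] pf by (intro add_nonneg_nonneg mult_nonneg_nonneg divide_nonneg_nonneg) auto
    next
      case (3 st')
      have eq: "total_samples st' = total_samples st2" "miss s st' = miss s st2"
        using 3 by (simp_all add: total_samples_def miss_def samples_def)
      have "\<gamma>L * real (nv st' ''len'') \<le> \<gamma>L * (real L + real c)"
        using 3 pos by (intro mult_left_mono) (auto simp: L_def simp flip: of_nat_add)
      then show ?case using f1[of st'] 3 by (simp add: eq) (erule order_trans, intro ennreal_leI, simp)
    qed (auto simp: L_def)
    moreover have nn: "0 \<le> \<tau> * (10 + 30 * real L + 25 * real c) +
        (\<gamma>0 + D * p\<^sub>f / 2 + \<gamma>L * (real L + real c) + \<gamma>1 * total_samples st2 + D * miss s st2)"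
      using pos \<tau> Y0 miss_nonneg[of s st2] pf by (intro add_nonneg_nonneg mult_nonneg_nonneg divide_nonneg_nonneg) auto
    ultimately have "ert \<tau> g ?cond f st2 \<le> ennreal (\<tau> + (\<tau> * (10 + 30 * real L + 25 * real c) +
        (\<gamma>0 + D * p\<^sub>f / 2 + \<gamma>L * (real L + real c) + \<gamma>1 * total_samples st2 + D * miss s st2)))"
      using \<tau> True by (simp add: ert.simps ennreal_add_le del: ennreal_plus)
    also have "\<tau> + (\<tau> * (10 + 30 * real L + 25 * real c) +
        (\<gamma>0 + D * p\<^sub>f / 2 + \<gamma>L * (real L + real c) + \<gamma>1 * total_samples st2 + D * miss s st2)) \<le>
        \<beta>0 + \<beta>1 * total_samples st2 + D * miss s st2"
    proof -
      have "(25 * \<tau> + \<gamma>L) * real c \<le> e * real c"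
        using mc_factor_nonneg \<tau> by (intro mult_right_mono) (auto simp: e_def distrib_right)
      then show ?thesis using ec by (simp add: \<beta>0_def \<beta>1_def algebra_simps)
    qed
    finally show ?thesis by (simp add: ennreal_leI)
  next
    case False
    then have hits: "nv st2 ''hits'' = K" using hK by simp
    define N where "N = nv st2 ''N''"
    have Y: "total_samples st2 = real N" using hits by (simp add: total_samples_def N_def)
    have "real N * X \<le> b\<^sub>0 + b\<^sub>1 * total_samples st2"
      using b h2[OF hits] cb by (auto simp: Y N_def X_def)
    then have eN: "e * (real N * X) \<le> e * (b\<^sub>0 + b\<^sub>1 * total_samples st2)" using e by (intro mult_left_mono)
    have fr2: "reals st2 ''r'' = reals st ''r''" "reals st2 ''p'' = reals st ''p''"
      "reals st2 ''M'' = reals st ''M''" "inputs st2 = inputs st"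
      using fr by (simp_all add: frame_def scan_def scan_body_def sampling_def sample_body_def inputs_def)
    have res2: "residue_ok st2" using residue_ok_cong[OF fr2(2,1,3)] i by simp
    have "ert \<tau> g monte_carlo f st2 \<le> ennreal (\<tau> * (6 + real (nv st2 ''N'') * (1 + node_cost (level k))) + \<gamma>0 +
        D * (if s \<in> samples st2 then p\<^sub>f / 2 else 1))"
    proof (rule ert_monte_carlo_le[OF \<tau> _ res2])
      fix st' assume "frame monte_carlo st2 st'" and M0: "rv st' ''M'' = 0"
      then have "inputs st' = inputs st2"
        by (simp add: frame_def monte_carlo_def mc_body_def walk_once_def walk_body_def inputs_def)
      then show "f st' \<le> ennreal (\<gamma>0 + (if bad (reals st' ''estimate'' s) s then D else 0))"
        using f2[OF M0] fr2(4) i by blast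
    qed (use i fr2 sam pos level_pos in auto)
    moreover have "0 \<le> \<tau> * (6 + real (nv st2 ''N'') * (1 + node_cost (level k))) + \<gamma>0 +
        D * (if s \<in> samples st2 then p\<^sub>f / 2 else 1)"
      using \<tau> pos pf node_cost_nonneg[of "level k"] by (intro add_nonneg_nonneg mult_nonneg_nonneg) auto
    ultimately have "ert \<tau> g ?cond f st2 \<le> ennreal (\<tau> + (\<tau> * (6 + real (nv st2 ''N'') * (1 + node_cost (level k))) + \<gamma>0 +
        D * (if s \<in> samples st2 then p\<^sub>f / 2 else 1)))"
      using \<tau> False by (simp add: ert.simps ennreal_add_le del: ennreal_plus)
    also have "\<tau> + (\<tau> * (6 + real (nv st2 ''N'') * (1 + node_cost (level k))) + \<gamma>0 +
        D * (if s \<in> samples st2 then p\<^sub>f / 2 else 1)) \<le> \<beta>0 + \<beta>1 * total_samples st2 + D * miss s st2"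
    proof -
      have "real N * (1 + node_cost (level k)) \<le> real N * (mc_factor * X)"
        using node_cost_le unfolding X_def by (intro mult_left_mono) auto
      then have "\<tau> * (real N * (1 + node_cost (level k))) \<le> \<tau> * (real N * (mc_factor * X))"
        using \<tau> by (rule mult_left_mono)
      also have "\<dots> = (mc_factor * \<tau>) * (real N * X)" by simp
      also have "\<dots> \<le> e * (real N * X)"
        using X1 \<tau> pos by (intro mult_right_mono) (auto simp: e_def distrib_right)
      also note eN
      finally have "\<tau> * (real N * (1 + node_cost (level k))) \<le> e * b\<^sub>0 + e * b\<^sub>1 * total_samples st2"
        by (simp add: algebra_simps)
      \<comment> \<open>After hit \<open>K\<close>, \<open>miss\<close> equals 1 for an unsampled
        node, so its certain failure has been paid for.\<close>
      moreover have "D * (if s \<in> samples st2 then p\<^sub>f / 2 else 1) \<le> D * p\<^sub>f / 2 + D * miss s st2"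
        using pos pf hits by (auto simp: miss_def)
      moreover have "0 \<le> \<gamma>1 * total_samples st2" "0 \<le> \<tau> * real L" "0 \<le> \<gamma>L * real L"
        using pos \<tau> Y by auto
      moreover have "\<tau> * (6 + real N * (1 + node_cost (level k))) = 6 * \<tau> + \<tau> * (real N * (1 + node_cost (level k)))"
        "\<tau> * (11 + 30 * real L) = 11 * \<tau> + 30 * (\<tau> * real L)"
        "\<beta>1 * total_samples st2 = \<gamma>1 * total_samples st2 + e * b\<^sub>1 * total_samples st2"
        by (simp_all add: \<beta>1_def distrib_left distrib_right)
      ultimately show ?thesis
        using \<tau> unfolding \<beta>0_def N_def[symmetric] by linarith
    qed
    finally show ?thesis by (simp add: ennreal_leI)
  qed
  define bb where "bb \<longleftrightarrow> b\<^sub>1 = 0"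
  have Y1: "1 \<le> total_samples st" using total_samples_ge[of st] i by linarith
  have cost: "(if bb then real c else total_samples st) \<le> b\<^sub>0 + b\<^sub>1 * total_samples st"
  proof -
    have "total_samples st * 1 \<le> total_samples st * X" using X1 Y1 by (intro mult_left_mono) auto
    then show ?thesis using b cb X1 by (auto simp: bb_def X_def mult.commute)
  qed
  define R where "R = \<tau> + 12 * \<tau> * (if bb then real c else total_samples st) +
     \<beta>0 + \<beta>1 * total_samples st + D * miss s st"
  have R0: "0 \<le> R" unfolding R_def using \<tau> Y1 \<beta> pos miss_nonneg[of s st]
    by (intro add_nonneg_nonneg mult_nonneg_nonneg) auto
  have "ert \<tau> g scan (ert \<tau> g (Seq (sampling K) ?cond) f) st \<le> ennreal (\<tau> * (6 + 20 * real L) + (\<tau> + R))"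
  proof (rule tripleD[OF triple_weaken[OF triple_scan order_refl, where Q' = "\<lambda>st'. frame scan st st' \<and> nv st' ''c'' = c \<and>
       (\<forall>j<nv st ''len''. reals st' ''amt'' (nats st ''list'' j) = scan_amt st (nats st ''list'' j))"] \<tau>, where B = "\<tau> + R"], goal_cases)
    case (3 st1)
    have fr1: "nats st1 ''N'' = nats st ''N''" "nats st1 ''hits'' = nats st ''hits''" "nats st1 ''sample'' = nats st ''sample''"
      "reals st1 ''M'' = reals st ''M''" "inputs st1 = inputs st"
      using 3 by (simp_all add: frame_def scan_def scan_body_def inputs_def)
    have eq: "total_samples st1 = total_samples st" "miss s st1 = miss s st" "samples st1 = samples st"
      by (simp_all add: total_samples_def miss_def samples_def fr1)
    have "ert \<tau> g (sampling K) (ert \<tau> g ?cond f) st1 \<le> ennreal (\<tau> + 12 * \<tau> * (if bb then real c else total_samples st1) +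
     \<beta>0 + \<beta>1 * total_samples st1 + D * miss s st1)"
    proof (rule ert_sampling_le[OF \<tau>, where M = "level k" and X = X])
      fix st2
      assume a: "frame sample_body st1 st2" "samples st2 \<subseteq> V" "nv st2 ''hits'' \<le> K"
        "nv st2 ''hits'' < K \<Longrightarrow> real c < (real (nv st2 ''N'') + 1) * X"
        "nv st2 ''hits'' = K \<Longrightarrow> real (nv st2 ''N'') * X \<le> real c"
      show "ert \<tau> g ?cond f st2 \<le> ennreal (\<beta>0 + \<beta>1 * total_samples st2 + D * miss s st2)"
      proof (rule cond)
        show "frame (Seq scan (sampling K)) st st2"
          using a(1) 3 by (auto simp: frame_def sampling_def)
        have "reals st2 ''amt'' = reals st1 ''amt''" using a(1) by (simp add: frame_def sample_body_def)
        then show "reals st2 ''amt'' (nats st ''list'' j) = scan_amt st (nats st ''list'' j)" if "j < nv st ''len''" for j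
          using 3 that by simp
      qed (use a in auto)
    qed (use 3 i fr1 eq s \<beta> pos level_pos in \<open>auto simp: X_def walk_factor_def\<close>)
    then show ?case
      using \<tau> R0 unfolding eq R_def[symmetric] by (simp add: ert.simps ennreal_add_le del: ennreal_plus)
  qed (use \<tau> R0 in \<open>auto simp: c_def L_def\<close>)
  then have "ert \<tau> g (phase K) f st \<le> ennreal (\<tau> + (\<tau> * (6 + 20 * real L) + (\<tau> + R)))"
    unfolding phase_def using \<tau> R0 by (intro ert_Seq_le) auto
  also have "\<tau> + (\<tau> * (6 + 20 * real L) + (\<tau> + R)) \<le>
     \<gamma>0 + D * p\<^sub>f / 2 + 40 * \<tau> + (\<gamma>L + 60 * \<tau>) * real L +
     \<gamma>1 * total_samples st + (phase_factor * \<tau> + \<gamma>L) * (b\<^sub>0 + b\<^sub>1 * total_samples st) + D * miss s st"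
  proof -
    have "12 * \<tau> * (if bb then real c else total_samples st) \<le> 12 * \<tau> * (b\<^sub>0 + b\<^sub>1 * total_samples st)"
      using cost \<tau> by (intro mult_left_mono) auto
    moreover have "(phase_factor * \<tau> + \<gamma>L) * z = 12 * \<tau> * z + e * z" for z
      by (simp add: phase_factor_def e_def algebra_simps)
    from this[of "b\<^sub>0 + b\<^sub>1 * total_samples st"]
    have "(phase_factor * \<tau> + \<gamma>L) * (b\<^sub>0 + b\<^sub>1 * total_samples st) =
        12 * \<tau> * (b\<^sub>0 + b\<^sub>1 * total_samples st) + (e * b\<^sub>0 + e * b\<^sub>1 * total_samples st)"
      by (simp only: distrib_left mult.assoc)
    moreover have "\<beta>1 * total_samples st = \<gamma>1 * total_samples st + e * b\<^sub>1 * total_samples st"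
      "\<tau> * (6 + 20 * real L) = 6 * \<tau> + 20 * (\<tau> * real L)"
      "\<tau> * (11 + 30 * real L) = 11 * \<tau> + 30 * (\<tau> * real L)"
      "(\<gamma>L + 60 * \<tau>) * real L = \<gamma>L * real L + 60 * (\<tau> * real L)"
      by (simp_all add: \<beta>1_def distrib_left distrib_right)
    moreover have "0 \<le> \<tau> * real L" using \<tau> by simp
    ultimately show ?thesis using \<tau> unfolding R_def \<beta>0_def by linarith
  qed
  finally show ?thesis by (simp add: ennreal_leI L_def)
qed


section \<open>The whole program\<close>

text \<open>The term with \<open>J\<close> is the price of a new list entry, which costs at most 60
  in each later phase; the number of new entries is charged like the pushes that create
  them.\<close>

definition remaining :: "real \<Rightarrow> (nat \<Rightarrow> real) \<Rightarrow> nat \<Rightarrow> nat \<Rightarrow> real" where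
  "remaining \<tau> b J k = (phase_factor * \<tau> + 60 * \<tau> * real J) * (\<Sum>j=k..<J. b j)"

lemma not_bad_of_level_less:
  assumes inv: "phase_inv k st" and k: "level k < \<epsilon> * \<delta>" and s: "s \<in> V"
  shows "\<not> bad (reals st ''estimate'' s) s"
proof -
  have "0 \<le> err st s" "err st s \<le> level k"
    using err_bounds[of st s] inv s by (auto simp: phase_inv_def)
  moreover have "\<epsilon> * \<delta> \<le> \<epsilon> * max (ppr_t s) \<delta>" using eps by (intro mult_left_mono) auto
  ultimately have "\<bar>reals st ''p'' s - ppr_t s\<bar> < \<epsilon> * max (ppr_t s) \<delta>"
    using k by (simp add: err_def)
  then show ?thesis using inv by (simp add: bad_def phase_inv_def)
qed

lemma ert_main_loop_stop:
  assumes "inputs st" "rv st ''M'' < \<epsilon> * \<delta>"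
  shows "ert \<tau> g (main_loop K) f st = ennreal \<tau> + f st"
  unfolding main_loop_def by (subst ert_While_unfold) (use assms in \<open>auto simp: inputs_def\<close>)

text \<open>Backward induction from phase \<open>J\<close>, whose level forces the loop to stop. As
  the walks end the loop, their failure term \<open>D * p\<^sub>f / 2\<close> is passed on unchanged
  and does not accumulate over the phases.\<close>

lemma ert_main_loop_le:
  assumes \<tau>: "0 \<le> \<tau>" and s: "s \<in> V" and D: "0 \<le> D" and J: "level J < \<epsilon> * \<delta>"
    and b: "\<And>k. (b\<^sub>0 k = push_bound k \<and> b\<^sub>1 k = 0) \<or> (b\<^sub>0 k = 0 \<and> b\<^sub>1 k = walk_factor k)"
    and f: "\<And>st'. f st' \<le> ennreal (if bad (reals st' ''estimate'' s) s then D else 0)"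
    and inv: "phase_inv k st" and k: "k \<le> J"
  shows "ert \<tau> g (main_loop K) f st \<le> ennreal (\<tau> + 41 * \<tau> * (real J - real k) +
     60 * \<tau> * (real J - real k) * real (nv st ''len'') + remaining \<tau> b\<^sub>0 J k +
     remaining \<tau> b\<^sub>1 J k * total_samples st + D * p\<^sub>f / 2 + D * miss s st)"
    (is "_ \<le> ennreal (?R k st)")
proof -
  let ?co = "phase_factor * \<tau> + 60 * \<tau> * real J"
  have co: "0 \<le> ?co" using \<tau> mc_factor_nonneg by (simp add: phase_factor_def)
  have b0: "0 \<le> b\<^sub>0 k" "0 \<le> b\<^sub>1 k" for k
    using b[of k] push_bound_nonneg[of k] walk_factor_ge_1[of k] by auto
  have rem0: "0 \<le> remaining \<tau> b\<^sub>0 J k" "0 \<le> remaining \<tau> b\<^sub>1 J k" for k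
    unfolding remaining_def using co b0 by (auto intro!: mult_nonneg_nonneg sum_nonneg)
  have Y0: "0 \<le> total_samples st" if "phase_inv k st" for k st
    using total_samples_ge[of st] that unfolding phase_inv_def by linarith
  have R: "\<tau> \<le> ?R k st" if "phase_inv k st" "k \<le> J" for k st
  proof -
    have "0 \<le> 41 * \<tau> * (real J - real k)" "0 \<le> 60 * \<tau> * (real J - real k) * real (nv st ''len'')"
      "0 \<le> remaining \<tau> b\<^sub>1 J k * total_samples st" "0 \<le> D * p\<^sub>f / 2" "0 \<le> D * miss s st"
      using that \<tau> rem0 Y0[OF that(1)] D pf miss_nonneg[of s st] by simp_all
    then show ?thesis using rem0(1)[of k] by linarith
  qed
  have stop: "ert \<tau> g (main_loop K) f st \<le> ennreal (?R k st)"
    if "phase_inv k st" "k \<le> J" "level k < \<epsilon> * \<delta>" for k st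
  proof -
    have "f st \<le> 0" using f[of st] not_bad_of_level_less[OF that(1,3) s] by simp
    then have "ert \<tau> g (main_loop K) f st \<le> ennreal \<tau>"
      using ert_main_loop_stop[of st] that by (simp add: phase_inv_def)
    also have "\<dots> \<le> ennreal (?R k st)" using R[OF that(1,2)] by (rule ennreal_leI)
    finally show ?thesis .
  qed
  show ?thesis
    using k inv
  proof (induction k arbitrary: st rule: inc_induct)
    case base
    then show ?case using stop J by blast
  next
    case (step k)
    note inv = step.prems
    show ?case
    proof (cases "level k < \<epsilon> * \<delta>")
      case True
      then show ?thesis using stop inv step.hyps by simp
    next
      case False
      define \<gamma>0 where "\<gamma>0 = \<tau> + 41 * \<tau> * (real J - real (Suc k)) + remaining \<tau> b\<^sub>0 J (Suc k)"
      define \<gamma>L where "\<gamma>L = 60 * \<tau> * (real J - real (Suc k))"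
      define \<gamma>1 where "\<gamma>1 = remaining \<tau> b\<^sub>1 J (Suc k)"
      define Y where "Y = total_samples st"
      have kJ: "Suc k \<le> J" using step.hyps by simp
      have \<gamma>: "\<tau> \<le> \<gamma>0" "0 \<le> \<gamma>L" "0 \<le> \<gamma>1"
        using kJ \<tau> rem0 by (simp_all add: \<gamma>0_def \<gamma>L_def \<gamma>1_def)
      define Z where "Z = \<gamma>0 + D * p\<^sub>f / 2 + 40 * \<tau> + (\<gamma>L + 60 * \<tau>) * real (nv st ''len'') +
         \<gamma>1 * Y + (phase_factor * \<tau> + \<gamma>L) * (b\<^sub>0 k + b\<^sub>1 k * Y) + D * miss s st"
      have Yp: "0 \<le> Y" using Y0[OF inv] by (simp add: Y_def)
      have Z0: "0 \<le> Z" unfolding Z_def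
        using \<gamma> \<tau> D pf Yp b0[of k] miss_nonneg[of s st] mc_factor_nonneg
        by (intro add_nonneg_nonneg mult_nonneg_nonneg divide_nonneg_nonneg) (auto simp: phase_factor_def)
      have "ert \<tau> g (phase K) (ert \<tau> g (main_loop K) f) st \<le> ennreal Z"
        unfolding Z_def Y_def
      proof (rule ert_phase_le[OF \<tau> inv s _ _ _ D b])
        fix st' assume "phase_inv (Suc k) st'"
        from step.IH[OF this] show "ert \<tau> g (main_loop K) f st' \<le> ennreal (\<gamma>0 + D * p\<^sub>f / 2 +
            \<gamma>L * real (nv st' ''len'') + \<gamma>1 * total_samples st' + D * miss s st')"
          by (simp add: \<gamma>0_def \<gamma>L_def \<gamma>1_def algebra_simps)
      next
        fix st' assume "rv st' ''M'' = 0" "inputs st'"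
        then have "ert \<tau> g (main_loop K) f st' = ennreal \<tau> + f st'"
          using ert_main_loop_stop eps delta by simp
        also have "\<dots> \<le> ennreal (\<tau> + (if bad (reals st' ''estimate'' s) s then D else 0))"
          using f \<tau> D by (intro ennreal_add_le) auto
        also have "\<dots> \<le> ennreal (\<gamma>0 + (if bad (reals st' ''estimate'' s) s then D else 0))"
          using \<gamma> by (intro ennreal_leI) auto
        finally show "ert \<tau> g (main_loop K) f st' \<le>
            ennreal (\<gamma>0 + (if bad (reals st' ''estimate'' s) s then D else 0))" .
      qed (use \<gamma> \<tau> in auto)
      moreover have "ert \<tau> g (main_loop K) f st = ennreal \<tau> + ert \<tau> g (phase K) (ert \<tau> g (main_loop K) f) st"
        unfolding main_loop_def
        by (subst ert_While_unfold) (use inv False in \<open>auto simp: phase_inv_def inputs_def\<close>)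
      ultimately have "ert \<tau> g (main_loop K) f st \<le> ennreal (\<tau> + Z)"
        using ennreal_add_le[OF \<tau> Z0] by simp
      also have "\<tau> + Z \<le> ?R k st"
      proof -
        have split: "remaining \<tau> x J k = ?co * x k + remaining \<tau> x J (Suc k)" for x
          using kJ by (simp add: remaining_def sum.atLeast_Suc_lessThan distrib_left)
        have "\<gamma>L \<le> 60 * \<tau> * real J" using \<tau> by (simp add: \<gamma>L_def mult_left_mono)
        then have "(phase_factor * \<tau> + \<gamma>L) * (b\<^sub>0 k + b\<^sub>1 k * Y) \<le> ?co * (b\<^sub>0 k + b\<^sub>1 k * Y)"
          using b0[of k] Yp by (intro mult_right_mono) auto
        also have "\<dots> = ?co * b\<^sub>0 k + ?co * b\<^sub>1 k * Y" by (simp only: distrib_left mult.assoc)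
        finally have 1: "(phase_factor * \<tau> + \<gamma>L) * (b\<^sub>0 k + b\<^sub>1 k * Y) \<le> ?co * b\<^sub>0 k + ?co * b\<^sub>1 k * Y" .
        have 2: "remaining \<tau> b\<^sub>1 J k * Y = ?co * b\<^sub>1 k * Y + \<gamma>1 * Y"
          unfolding split \<gamma>1_def by (rule distrib_right)
        have 3: "(\<gamma>L + 60 * \<tau>) * real (nv st ''len'') = 60 * \<tau> * (real J - real k) * real (nv st ''len'')"
          by (simp add: \<gamma>L_def algebra_simps)
        have 4: "41 * \<tau> * (real J - real k) = 41 * \<tau> * (real J - real (Suc k)) + 41 * \<tau>"
          by (simp add: algebra_simps)
        show ?thesis
          unfolding Z_def Y_def[symmetric] 2 3 4 split[of b\<^sub>0] \<gamma>0_def using 1 by linarith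
      qed
      finally show ?thesis by (simp add: ennreal_leI)
    qed
  qed
qed

lemma K_pos: "0 < K"
  using K pf by (cases K) auto

lemma ert_main_le:
  assumes \<tau>: "0 \<le> \<tau>" and s: "s \<in> V" and D: "0 \<le> D" and J: "level J < \<epsilon> * \<delta>"
    and b: "\<And>k. (b\<^sub>0 k = push_bound k \<and> b\<^sub>1 k = 0) \<or> (b\<^sub>0 k = 0 \<and> b\<^sub>1 k = walk_factor k)"
    and f: "\<And>st'. f st' \<le> ennreal (if bad (reals st' ''estimate'' s) s then D else 0)"
  shows "ert \<tau> g (main K) f (input_mem \<alpha> \<epsilon> p\<^sub>f \<delta> t) \<le> ennreal (11 * \<tau> + 101 * \<tau> * real J +
     (remaining \<tau> b\<^sub>0 J 0 + remaining \<tau> b\<^sub>1 J 0 * (real K * n)) + D * p\<^sub>f)"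
proof -
  let ?R = "\<tau> + 101 * \<tau> * real J + (remaining \<tau> b\<^sub>0 J 0 + remaining \<tau> b\<^sub>1 J 0 * (real K * n)) + D * p\<^sub>f"
  have loop: "ert \<tau> g (main_loop K) f st \<le> ennreal ?R"
    if nats: "nv st ''len'' = 1" "nats st ''list'' 0 = t" "nats st ''mark'' = (\<lambda>_. 0)(t := 1)" "nv st ''N'' = 0"
        "nv st ''hits'' = 0"
      and reals: "reals st ''r'' = (\<lambda>_. 0)(t := 1)" "reals st ''p'' = (\<lambda>_. 0)" "reals st ''estimate'' = (\<lambda>_. 0)"
        "rv st ''M'' = 1"
      and inp: "inputs st" for st
  proof -
    have tch: "touched st = [t]" using nats by (simp add: touched_def)
    have smp: "samples st = {}" using nats by (simp add: samples_def)
    \<comment> \<open>Without reserves, the residue equation is the first-step equation of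
      PageRank.\<close>
    have "residue_ok st"
      using ppr_first_step by (auto simp: residue_ok_def err_def[abs_def] reals)
    then have inv: "phase_inv 0 st"
      using nats reals inp target K_pos
      by (auto simp: phase_inv_def touched_ok_def tch smp level_def)
    have Y: "total_samples st = real K * n" using nats by (simp add: total_samples_def)
    \<comment> \<open>Nothing has been sampled yet, so \<open>miss\<close> is
      \<open>(1 / 2) ^ K\<close>: the second half of the failure probability.\<close>
    have m: "D * miss s st \<le> D * (p\<^sub>f / 2)" using K D nats by (intro mult_left_mono) (simp_all add: miss_def smp)
    have "ert \<tau> g (main_loop K) f st \<le> ennreal (\<tau> + 41 * \<tau> * (real J - real 0) +
     60 * \<tau> * (real J - real 0) * real (nv st ''len'') + remaining \<tau> b\<^sub>0 J 0 +
     remaining \<tau> b\<^sub>1 J 0 * total_samples st + D * p\<^sub>f / 2 + D * miss s st)"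
      by (rule ert_main_loop_le[OF \<tau> s D J b f inv]) simp
    also have "\<dots> \<le> ennreal ?R"
      using m by (intro ennreal_leI) (simp add: Y nats algebra_simps)
    finally show ?thesis .
  qed
  have R0: "0 \<le> ?R"
  proof -
    have b0: "0 \<le> b\<^sub>0 k" "0 \<le> b\<^sub>1 k" for k
      using b[of k] push_bound_nonneg[of k] walk_factor_ge_1[of k] by auto
    then show ?thesis
      unfolding remaining_def using \<tau> D pf mc_factor_nonneg
      by (intro add_nonneg_nonneg mult_nonneg_nonneg sum_nonneg) (auto simp: phase_factor_def)
  qed
  have "ert \<tau> g (main K) f (input_mem \<alpha> \<epsilon> p\<^sub>f \<delta> t) \<le>
      ennreal (\<tau> + (\<tau> + (\<tau> + (\<tau> + (\<tau> + (\<tau> + (\<tau> + (\<tau> + (\<tau> + (\<tau> + ?R))))))))))"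
    unfolding main_def
    by (intro ert_Seq_le ert_moves_le[OF moves_intros(1)] ert_moves_le[OF moves_intros(2)] loop)
       (use \<tau> R0 in \<open>auto simp: input_mem_def inputs_def\<close>)
  also have "\<tau> + (\<tau> + (\<tau> + (\<tau> + (\<tau> + (\<tau> + (\<tau> + (\<tau> + (\<tau> + (\<tau> + ?R))))))))) = 11 * \<tau> + 101 * \<tau> * real J +
     (remaining \<tau> b\<^sub>0 J 0 + remaining \<tau> b\<^sub>1 J 0 * (real K * n)) + D * p\<^sub>f"
    by simp
  finally show ?thesis .
qed

section \<open>Running time, error and halting for one input\<close>

lemma ex_level_less: "\<exists>J. level J < \<epsilon> * \<delta>"
  unfolding level_def using alpha eps delta by (intro real_arch_pow_inv) auto

lemma expected_time_main_le:
  assumes J: "level J < \<epsilon> * \<delta>"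
  shows "expected_time g (main K) (input_mem \<alpha> \<epsilon> p\<^sub>f \<delta> t) \<le>
    ennreal (11 + 101 * real J + (phase_factor + 60 * real J) *
      (\<Sum>j<J. min (push_bound j) (walk_factor j * (real K * n))))"
proof -
  let ?P = "\<lambda>k. push_bound k \<le> walk_factor k * (real K * n)"
  \<comment> \<open>The cheaper charge is chosen phase by phase, using the number of nodes, which
    the program does not know.\<close>
  define b\<^sub>0 where "b\<^sub>0 k = (if ?P k then push_bound k else 0)" for k
  define b\<^sub>1 where "b\<^sub>1 k = (if ?P k then 0 else walk_factor k)" for k
  have eq: "b\<^sub>0 j + b\<^sub>1 j * (real K * n) = min (push_bound j) (walk_factor j * (real K * n))" for j
    by (simp add: b\<^sub>0_def b\<^sub>1_def)
  have "expected_time g (main K) (input_mem \<alpha> \<epsilon> p\<^sub>f \<delta> t) \<le> ert 1 g (main K) (\<lambda>_. 0) (input_mem \<alpha> \<epsilon> p\<^sub>f \<delta> t)"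
    by (rule expected_time_le_ert)
  also have "\<dots> \<le> ennreal (11 * 1 + 101 * 1 * real J +
     (remaining 1 b\<^sub>0 J 0 + remaining 1 b\<^sub>1 J 0 * (real K * n)) + 0 * p\<^sub>f)"
    by (rule ert_main_le[OF _ target _ J]) (auto simp: b\<^sub>0_def b\<^sub>1_def)
  also have "remaining 1 b\<^sub>0 J 0 + remaining 1 b\<^sub>1 J 0 * (real K * n) =
     (phase_factor + 60 * real J) * (\<Sum>j<J. b\<^sub>0 j + b\<^sub>1 j * (real K * n))"
    by (simp add: remaining_def sum.distrib distrib_left sum_distrib_right lessThan_atLeast0 mult.assoc)
  finally show ?thesis by (simp add: eq)
qed

text \<open>With \<open>\<tau> = 0\<close> all time terms vanish, so any choice of charges will
  do.\<close>

lemma halt_prob_bad_le: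
  assumes s: "s \<in> V"
  shows "halt_prob g (main K) (input_mem \<alpha> \<epsilon> p\<^sub>f \<delta> t) (\<lambda>st. bad (estimate st s) s) \<le> p\<^sub>f"
proof (rule halt_prob_le_ert)
  obtain J where J: "level J < \<epsilon> * \<delta>" using ex_level_less by blast
  have "ert 0 g (main K) (\<lambda>st'. if bad (estimate st' s) s then 1 else 0) (input_mem \<alpha> \<epsilon> p\<^sub>f \<delta> t) \<le>
     ennreal (11 * 0 + 101 * 0 * real J +
     (remaining 0 push_bound J 0 + remaining 0 (\<lambda>_. 0) J 0 * (real K * n)) + 1 * p\<^sub>f)"
    by (rule ert_main_le[OF _ s _ J]) (auto simp: estimate_def)
  then show "ert 0 g (main K) (\<lambda>st'. if bad (estimate st' s) s then 1 else 0) (input_mem \<alpha> \<epsilon> p\<^sub>f \<delta> t) \<le> ennreal p\<^sub>f"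
    by (simp add: remaining_def)
qed (use pf in simp)

lemma halts_almost_surely: "halt_prob g (main K) (input_mem \<alpha> \<epsilon> p\<^sub>f \<delta> t) (\<lambda>_. True) = 1"
proof -
  obtain J where J: "level J < \<epsilon> * \<delta>" using ex_level_less by blast
  show ?thesis
    by (rule halt_prob_True_eq_1, rule le_less_trans[OF expected_time_main_le[OF J]]) simp
qed

end


section \<open>Asymptotic bounds\<close>

text \<open>\<open>push_bound\<close> with the target as an argument, outside the locale that fixes
  it, so that targets can be summed over.\<close>

definition push_work :: "adj_graph \<Rightarrow> real \<Rightarrow> real \<Rightarrow> nat \<Rightarrow> real" where
  "push_work g \<alpha> M t =
     (\<Sum>u | u \<in> pverts (dgraph g) \<and> \<alpha> * \<alpha> * M / 2 < ppr \<alpha> (dgraph g) u t. real (length (in_nbrs g u)))"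

context walk_graph
begin

lemma push_work_nonneg: "0 \<le> push_work g \<alpha> M t"
  by (simp add: push_work_def sum_nonneg)

lemma push_work_le_arcs: "push_work g \<alpha> M t \<le> real (card (parcs (dgraph g)))"
proof -
  have "push_work g \<alpha> M t \<le> (\<Sum>u\<in>V. real (length (in_nbrs g u)))"
    unfolding push_work_def by (rule sum_mono2) auto
  then show ?thesis by (simp add: sum_length_in_nbrs flip: of_nat_sum)
qed

text \<open>Markov's inequality at each node: the indicator of a large PageRank value is at most
  \<open>2 / (\<alpha> * \<alpha> * M)\<close> times the value, and the values of one source sum to
  at most 1 over all targets.\<close>

lemma sum_push_work_le:
  assumes M: "0 < M"
  shows "(\<Sum>t\<in>V. push_work g \<alpha> M t) \<le> 2 * real (card (parcs (dgraph g))) / (\<alpha> * \<alpha> * M)"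
proof -
  let ?d = "\<lambda>u. real (length (in_nbrs g u))" and ?q = "2 / (\<alpha> * \<alpha> * M)"
  have q: "0 < ?q" using M alpha by simp
  have "push_work g \<alpha> M t \<le> (\<Sum>u\<in>V. ?d u * (?q * ppr \<alpha> (dgraph g) u t))" for t
  proof -
    have "push_work g \<alpha> M t \<le>
      (\<Sum>u | u \<in> V \<and> \<alpha> * \<alpha> * M / 2 < ppr \<alpha> (dgraph g) u t. ?d u * (?q * ppr \<alpha> (dgraph g) u t))"
      unfolding push_work_def
    proof (rule sum_mono)
      fix u assume "u \<in> {u \<in> V. \<alpha> * \<alpha> * M / 2 < ppr \<alpha> (dgraph g) u t}"
      then have "1 \<le> ?q * ppr \<alpha> (dgraph g) u t" using M alpha by (simp add: field_simps)
      then show "?d u \<le> ?d u * (?q * ppr \<alpha> (dgraph g) u t)"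
        using mult_left_mono[of 1 "?q * ppr \<alpha> (dgraph g) u t" "?d u"] by simp
    qed
    also have "\<dots> \<le> (\<Sum>u\<in>V. ?d u * (?q * ppr \<alpha> (dgraph g) u t))"
      using q by (intro sum_mono2 mult_nonneg_nonneg) (auto intro: ppr_nonneg)
    finally show ?thesis .
  qed
  then have "(\<Sum>t\<in>V. push_work g \<alpha> M t) \<le> (\<Sum>t\<in>V. \<Sum>u\<in>V. ?d u * (?q * ppr \<alpha> (dgraph g) u t))"
    by (intro sum_mono)
  also have "\<dots> = (\<Sum>u\<in>V. ?d u * (?q * (\<Sum>t\<in>V. ppr \<alpha> (dgraph g) u t)))"
    by (subst sum.swap) (simp add: sum_distrib_left)
  also have "\<dots> \<le> (\<Sum>u\<in>V. ?d u * (?q * 1))"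
    using q sum_ppr_le_1 by (intro sum_mono mult_left_mono) auto
  also have "\<dots> = ?q * real (\<Sum>u\<in>V. length (in_nbrs g u))"
    by (simp add: sum_distrib_left mult.commute)
  finally show ?thesis by (simp add: sum_length_in_nbrs)
qed

end

text \<open>Exceeds \<open>phase_factor\<close> by 161 = 101 + 60, the two coefficients of
  \<open>J\<close> in \<open>expected_time_main_le\<close>.\<close>

definition time_factor :: "real \<Rightarrow> real \<Rightarrow> real \<Rightarrow> real" where
  "time_factor \<alpha> \<epsilon> p\<^sub>f = 211 + (1 + 2 / (\<epsilon>\<^sup>2 * p\<^sub>f)) * (20 / \<alpha> + 1)"

definition phase_work :: "adj_graph \<Rightarrow> real \<Rightarrow> nat \<Rightarrow> real \<Rightarrow> nat \<Rightarrow> nat \<Rightarrow> real" where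
  "phase_work g \<alpha> K \<delta> t j = min (push_work g \<alpha> ((1 - \<alpha> / 2) ^ j) t)
     ((1 + (1 - \<alpha> / 2) ^ j / \<delta>) * (real K * real (card (pverts (dgraph g)))))"

lemma (in ppr_instance) target_time_le_phase_work:
  assumes "(1 - \<alpha> / 2) ^ J < \<epsilon> * \<delta>"
  shows "target_time \<alpha> \<epsilon> p\<^sub>f (main K) \<delta> g t \<le>
    ennreal (time_factor \<alpha> \<epsilon> p\<^sub>f * (1 + real J) * (1 + (\<Sum>j<J. phase_work g \<alpha> K \<delta> t j)))"
proof -
  let ?S = "\<Sum>j<J. phase_work g \<alpha> K \<delta> t j"
  have pw: "phase_work g \<alpha> K \<delta> t j = min (push_bound j) (walk_factor j * (real K * n))" for j
    by (simp add: phase_work_def push_work_def push_bound_def walk_factor_def level_def)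
  have S0: "0 \<le> ?S"
  proof (rule sum_nonneg)
    show "0 \<le> phase_work g \<alpha> K \<delta> t j" for j
      using push_bound_nonneg[of j] order_trans[OF zero_le_one walk_factor_ge_1[of j]] by (simp add: pw)
  qed
  have F: "phase_factor \<le> time_factor \<alpha> \<epsilon> p\<^sub>f - 161" "0 \<le> phase_factor"
    using mc_factor_nonneg by (simp_all add: phase_factor_def mc_factor_def time_factor_def)
  have "target_time \<alpha> \<epsilon> p\<^sub>f (main K) \<delta> g t \<le> ennreal (11 + 101 * real J + (phase_factor + 60 * real J) * ?S)"
    using expected_time_main_le[of J] assms by (simp add: target_time_def pw level_def)
  also have "\<dots> \<le> ennreal (time_factor \<alpha> \<epsilon> p\<^sub>f * (1 + real J) * (1 + ?S))"
  proof (rule ennreal_leI)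
    have "11 + 101 * real J \<le> time_factor \<alpha> \<epsilon> p\<^sub>f * (1 + real J)"
    proof -
      have "11 + 101 * real J \<le> 161 * (1 + real J)" by simp
      also have "\<dots> \<le> time_factor \<alpha> \<epsilon> p\<^sub>f * (1 + real J)" using F by (intro mult_right_mono) auto
      finally show ?thesis .
    qed
    moreover have "(phase_factor + 60 * real J) \<le> time_factor \<alpha> \<epsilon> p\<^sub>f * (1 + real J)"
    proof -
      have "(phase_factor + 60) * (1 + real J) \<le> time_factor \<alpha> \<epsilon> p\<^sub>f * (1 + real J)"
        using F by (intro mult_right_mono) auto
      moreover have "(phase_factor + 60) * (1 + real J) = phase_factor + 60 * real J + (60 + phase_factor * real J)"
        by (simp add: algebra_simps)
      moreover have "0 \<le> phase_factor * real J" using F by simp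
      ultimately show ?thesis by linarith
    qed
    then have "(phase_factor + 60 * real J) * ?S \<le> time_factor \<alpha> \<epsilon> p\<^sub>f * (1 + real J) * ?S"
      using S0 by (rule mult_right_mono)
    ultimately show "11 + 101 * real J + (phase_factor + 60 * real J) * ?S \<le>
        time_factor \<alpha> \<epsilon> p\<^sub>f * (1 + real J) * (1 + ?S)"
      by (simp add: distrib_left)
  qed
  finally show ?thesis .
qed

text \<open>The least such \<open>J\<close> serves two ends: the number of phases is logarithmic,
  and every phase counted still has residue bound at least \<open>\<epsilon> * \<delta>\<close>, on
  which the average-case bound relies.\<close>

lemma ex_phase_count:
  fixes \<rho> \<epsilon> :: real
  assumes \<rho>: "0 < \<rho>" "\<rho> < 1" and \<epsilon>: "0 < \<epsilon>" "\<epsilon> < 1"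
  shows "\<exists>C\<ge>1. \<forall>\<delta>. 0 < \<delta> \<and> \<delta> \<le> 1 \<longrightarrow>
    (\<exists>J. \<rho> ^ J < \<epsilon> * \<delta> \<and> (\<forall>j<J. \<epsilon> * \<delta> \<le> \<rho> ^ j) \<and> 1 + real J \<le> C * (1 + ln (1 / \<delta>)))"
proof -
  define l where "l = - ln \<rho>"
  have l: "0 < l" using \<rho> by (simp add: l_def)
  define a where "a = - ln \<epsilon>"
  have a: "0 < a" using \<epsilon> by (simp add: a_def)
  define C where "C = 2 + (a + 1) / l"
  have "\<exists>J. \<rho> ^ J < \<epsilon> * \<delta> \<and> (\<forall>j<J. \<epsilon> * \<delta> \<le> \<rho> ^ j) \<and> 1 + real J \<le> C * (1 + ln (1 / \<delta>))"
    if \<delta>: "0 < \<delta>" "\<delta> \<le> 1" for \<delta>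
  proof -
    define J where "J = (LEAST J. \<rho> ^ J < \<epsilon> * \<delta>)"
    have ed: "0 < \<epsilon> * \<delta>" using \<epsilon> \<delta> by simp
    obtain J0 where "\<rho> ^ J0 < \<epsilon> * \<delta>" using real_arch_pow_inv[OF ed \<rho>(2)] by blast
    then have J: "\<rho> ^ J < \<epsilon> * \<delta>" unfolding J_def by (rule LeastI)
    have less: "\<epsilon> * \<delta> \<le> \<rho> ^ j" if "j < J" for j
      using not_less_Least[of j "\<lambda>J. \<rho> ^ J < \<epsilon> * \<delta>"] that by (simp add: J_def)
    have d: "0 \<le> - ln \<delta>" using \<delta> by simp
    have "1 + real J \<le> 2 + (a - ln \<delta>) / l"
    proof (cases J)
      case 0
      then show ?thesis using a d l by (simp add: divide_nonneg_pos)
    next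
      case (Suc j)
      have "ln (\<epsilon> * \<delta>) \<le> ln (\<rho> ^ j)" using less[of j] Suc ed \<rho> by (subst ln_le_cancel_iff) auto
      then have "real j * l \<le> a - ln \<delta>"
        using \<epsilon> \<delta> \<rho> by (simp add: ln_mult ln_realpow a_def l_def)
      then have "real j \<le> (a - ln \<delta>) / l" using l by (simp add: field_simps)
      then show ?thesis using Suc by simp
    qed
    also have "\<dots> \<le> C * (1 + ln (1 / \<delta>))"
    proof -
      have "0 \<le> a * (- ln \<delta>)" using a d by (intro mult_nonneg_nonneg) auto
      then have "a - ln \<delta> \<le> (a + 1) * (1 - ln \<delta>)" by (simp add: algebra_simps)
      then have "(a - ln \<delta>) / l \<le> (a + 1) * (1 - ln \<delta>) / l" using l by (intro divide_right_mono) auto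
      moreover have "2 \<le> 2 * (1 - ln \<delta>)" using d by simp
      moreover have "C * (1 + ln (1 / \<delta>)) = 2 * (1 - ln \<delta>) + (a + 1) * (1 - ln \<delta>) / l"
        using \<delta> by (simp add: C_def ln_div distrib_right)
      ultimately show ?thesis by linarith
    qed
    finally show ?thesis using J less by blast
  qed
  moreover have "1 \<le> C" using a l by (simp add: C_def)
  ultimately show ?thesis by blast
qed

lemma one_le_mult: "1 \<le> a \<Longrightarrow> 1 \<le> b \<Longrightarrow> 1 \<le> a * b" for a b :: real
  using mult_mono[of 1 a 1 b] by simp

lemma min_le_cmult_min:
  fixes a b c x :: real
  assumes "x \<le> a" "x \<le> c * b" "1 \<le> c" "0 \<le> a"
  shows "x \<le> c * min a b"
  using assms mult_right_mono[of 1 c a] by (auto simp: min_def)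

text \<open>Neither the residue bound nor \<delta> exceeds 1, so \<open>1 + M / \<delta>\<close> is
  at most \<open>2 / \<delta>\<close> in every phase.\<close>

lemma phase_work_le_worst:
  assumes "walk_graph g \<alpha>" and \<delta>: "0 < \<delta>" "\<delta> \<le> 1" and K: "1 \<le> K"
  shows "phase_work g \<alpha> K \<delta> t j \<le>
    2 * real K * min (real (card (parcs (dgraph g)))) (real (card (pverts (dgraph g))) / \<delta>)"
proof (rule min_le_cmult_min)
  interpret walk_graph g \<alpha> by fact
  show "phase_work g \<alpha> K \<delta> t j \<le> real (card (parcs (dgraph g)))"
    using push_work_le_arcs by (simp add: phase_work_def min.coboundedI1)
  have "(1 - \<alpha> / 2) ^ j \<le> 1" using alpha by (intro power_le_one) auto
  then have "(1 - \<alpha> / 2) ^ j / \<delta> \<le> 1 / \<delta>" using \<delta> by (intro divide_right_mono) auto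
  moreover have "1 \<le> 1 / \<delta>" using \<delta> by simp
  ultimately have "1 + (1 - \<alpha> / 2) ^ j / \<delta> \<le> 2 / \<delta>" by simp
  then have "(1 + (1 - \<alpha> / 2) ^ j / \<delta>) * (real K * real (card V)) \<le> 2 / \<delta> * (real K * real (card V))"
    by (rule mult_right_mono) simp
  then show "phase_work g \<alpha> K \<delta> t j \<le> 2 * real K * (real (card V) / \<delta>)"
    by (simp add: phase_work_def min.coboundedI2 field_simps)
qed (use K in auto)

lemma sum_phase_work_le:
  assumes "walk_graph g \<alpha>" and \<epsilon>: "0 < \<epsilon>" "\<epsilon> < 1" and \<delta>: "0 < \<delta>" "\<delta> \<le> 1" and K: "1 \<le> K"
    and j: "\<epsilon> * \<delta> \<le> (1 - \<alpha> / 2) ^ j"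
    and nm: "real (card (pverts (dgraph g))) = n" "real (card (parcs (dgraph g))) = m"
    and c: "c = 1 + sqrt (2 * real K * (1 + 1 / \<epsilon>) / (\<alpha> * \<alpha>)) + 2 / (\<alpha> * \<alpha> * \<epsilon>)"
  shows "(\<Sum>t\<in>pverts (dgraph g). phase_work g \<alpha> K \<delta> t j) / n \<le> c * min m (min (sqrt (m / \<delta>)) (m / n / \<delta>))"
proof -
  interpret walk_graph g \<alpha> by fact
  define M where "M = (1 - \<alpha> / 2) ^ j"
  define S where "S = (\<Sum>t\<in>V. phase_work g \<alpha> K \<delta> t j)"
  define c2 where "c2 = 2 * real K * (1 + 1 / \<epsilon>) / (\<alpha> * \<alpha>)"
  have M: "0 < M" using alpha by (simp add: M_def)
  have n: "0 < n" using card_V_pos nm by simp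
  have m: "0 \<le> m" using nm by simp
  have S0: "0 \<le> S" unfolding S_def phase_work_def using push_work_nonneg alpha \<delta> by (intro sum_nonneg) auto
  have c2: "0 \<le> c2" using \<epsilon> by (simp add: c2_def)
  have "S \<le> (\<Sum>t\<in>V. m)" unfolding S_def
    using push_work_le_arcs nm by (intro sum_mono) (auto simp: phase_work_def intro: min.coboundedI1)
  then have 1: "S / n \<le> m" using n nm by (simp add: field_simps)
  have "S \<le> (\<Sum>t\<in>V. push_work g \<alpha> M t)" unfolding S_def by (intro sum_mono) (simp add: phase_work_def M_def)
  also have "\<dots> \<le> 2 * m / (\<alpha> * \<alpha> * M)" using sum_push_work_le[OF M] nm by simp
  finally have 2: "S \<le> 2 * m / (\<alpha> * \<alpha> * M)" .
  also have "\<dots> \<le> 2 * m / (\<alpha> * \<alpha> * (\<epsilon> * \<delta>))"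
    using j m \<epsilon> \<delta> alpha by (intro divide_left_mono mult_left_mono mult_pos_pos) (auto simp: M_def)
  finally have 3: "S / n \<le> 2 / (\<alpha> * \<alpha> * \<epsilon>) * (m / n / \<delta>)"
    using n \<delta> \<epsilon> alpha by (simp add: field_simps)
  have "1 \<le> M / (\<epsilon> * \<delta>)" using j \<epsilon> \<delta> by (simp add: M_def)
  \<comment> \<open>The extra walk per node due to rounding is absorbed because \<open>M\<close> is
    at least \<open>\<epsilon> * \<delta>\<close>.\<close>
  then have "1 + M / \<delta> \<le> (1 + 1 / \<epsilon>) * (M / \<delta>)" using \<epsilon> \<delta> by (simp add: field_simps)
  then have "(1 + M / \<delta>) * (real K * n) \<le> (1 + 1 / \<epsilon>) * (M / \<delta>) * (real K * n)"
    using n by (intro mult_right_mono) auto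
  then have "S \<le> (\<Sum>t\<in>V. (1 + 1 / \<epsilon>) * (M / \<delta>) * (real K * n))"
    unfolding S_def by (intro sum_mono) (auto simp: phase_work_def M_def nm intro: min.coboundedI2)
  then have 4: "S \<le> n * ((1 + 1 / \<epsilon>) * (M / \<delta>) * (real K * n))" using nm by simp
  \<comment> \<open>In the product of the two bounds \<open>M\<close> cancels, so the square root no
    longer depends on the phase.\<close>
  have "S * S \<le> (2 * m / (\<alpha> * \<alpha> * M)) * (n * ((1 + 1 / \<epsilon>) * (M / \<delta>) * (real K * n)))"
    using 2 4 S0 by (intro mult_mono order_trans[OF S0 2]) auto
  also have "\<dots> = c2 * (m / \<delta>) * (n * n)"
    using M alpha \<delta> \<epsilon> by (simp add: c2_def field_simps)
  finally have "(S / n)\<^sup>2 \<le> c2 * (m / \<delta>)" using n by (simp add: field_simps power2_eq_square)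
  then have 5: "S / n \<le> sqrt c2 * sqrt (m / \<delta>)"
    by (simp add: real_le_rsqrt flip: real_sqrt_mult)
  have c1: "sqrt c2 \<le> c" "2 / (\<alpha> * \<alpha> * \<epsilon>) \<le> c" "1 \<le> c"
    using c2 \<epsilon> alpha by (simp_all add: c c2_def[symmetric])
  have "S / n \<le> c * m" using 1 c1(3) m mult_right_mono[of 1 c m] by simp
  moreover have "S / n \<le> c * sqrt (m / \<delta>)"
    using 5 mult_right_mono[OF c1(1), of "sqrt (m / \<delta>)"] m \<delta> by simp
  moreover have "S / n \<le> c * (m / n / \<delta>)"
    using 3 mult_right_mono[OF c1(2), of "m / n / \<delta>"] m \<delta> n by simp
  ultimately show ?thesis unfolding S_def[symmetric] by (simp add: min_def)
qed

theorem theorem5p3: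
  fixes \<alpha> \<epsilon> p\<^sub>f :: real
  assumes "0 < \<alpha>" "\<alpha> < 1" "0 < \<epsilon>" "\<epsilon> < 1" "0 < p\<^sub>f" "p\<^sub>f < 1"
  shows "\<exists>prog. solves_single_target \<alpha> \<epsilon> p\<^sub>f prog \<and>
    (\<exists>C k. \<forall>n m \<delta>. 0 < \<delta> \<and> \<delta> \<le> 1 \<longrightarrow>
       (\<forall>g\<in>graphs n m. \<forall>t\<in>pverts (dgraph g).
          target_time \<alpha> \<epsilon> p\<^sub>f prog \<delta> g t
            \<le> ennreal (C * polylog k n \<delta> * min (real m) (real n / \<delta>)))) \<and>
    (\<exists>C k. \<forall>n m \<delta>. 0 < \<delta> \<and> \<delta> \<le> 1 \<longrightarrow>
       (let d = real m / real n in
          average_case_time \<alpha> \<epsilon> p\<^sub>f prog \<delta> n m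
            \<le> ennreal (C * polylog k n \<delta> *
                  min (real m) (min (sqrt (real m / \<delta>)) (d / \<delta>)))))"
proof -
  obtain K where "(1 / 2) ^ K < p\<^sub>f / 2"
    using real_arch_pow_inv[of "p\<^sub>f / 2" "1 / 2"] assms by auto
  then have K: "(1 / 2) ^ K \<le> p\<^sub>f / 2" by simp
  then have K1: "1 \<le> K" using assms by (cases K) auto
  define \<rho> where "\<rho> = 1 - \<alpha> / 2"
  obtain C\<^sub>J where CJ: "1 \<le> C\<^sub>J" "\<And>\<delta>. 0 < \<delta> \<Longrightarrow> \<delta> \<le> 1 \<Longrightarrow>
    \<exists>J. \<rho> ^ J < \<epsilon> * \<delta> \<and> (\<forall>j<J. \<epsilon> * \<delta> \<le> \<rho> ^ j) \<and> 1 + real J \<le> C\<^sub>J * (1 + ln (1 / \<delta>))"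
    using ex_phase_count[of \<rho> \<epsilon>] assms by (auto simp: \<rho>_def)
  define A where "A = time_factor \<alpha> \<epsilon> p\<^sub>f"
  have A: "0 \<le> A" using assms by (simp add: A_def time_factor_def)
  have inst: "ppr_instance g \<alpha> \<epsilon> p\<^sub>f \<delta> t K" if "valid_graph g" "t \<in> pverts (dgraph g)" "0 < \<delta>" "\<delta> \<le> 1" for g t \<delta>
    using that assms K by unfold_locales auto
  have wg: "walk_graph g \<alpha>" if "valid_graph g" for g
    using that assms by unfold_locales auto
  \<comment> \<open>One factor \<open>1 + J\<close> counts the phases, the other the repeated scans
    of the touched list. The logarithm of \<open>n\<close> enters only because
    \<open>polylog\<close> contains it.\<close>
  have phases: "\<exists>J. \<rho> ^ J < \<epsilon> * \<delta> \<and> (\<forall>j<J. \<epsilon> * \<delta> \<le> \<rho> ^ j) \<and> (1 + real J)\<^sup>2 \<le> C\<^sub>J\<^sup>2 * polylog 2 n \<delta>"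
    if "0 < \<delta>" "\<delta> \<le> 1" "1 \<le> n" for \<delta> and n :: nat
  proof -
    obtain J where J: "\<rho> ^ J < \<epsilon> * \<delta>" "\<forall>j<J. \<epsilon> * \<delta> \<le> \<rho> ^ j" "1 + real J \<le> C\<^sub>J * (1 + ln (1 / \<delta>))"
      using CJ(2)[OF \<open>0 < \<delta>\<close> \<open>\<delta> \<le> 1\<close>] by blast
    have "0 \<le> ln (real n)" using that by simp
    then have "C\<^sub>J * (1 + ln (1 / \<delta>)) \<le> C\<^sub>J * (1 + ln (real n) + ln (1 / \<delta>))" using CJ(1) by (intro mult_left_mono) auto
    then have "(1 + real J)\<^sup>2 \<le> (C\<^sub>J * (1 + ln (real n) + ln (1 / \<delta>)))\<^sup>2" using J(3) by (intro power_mono) auto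
    then show ?thesis using J by (auto simp: polylog_def power_mult_distrib)
  qed
  have solves: "solves_single_target \<alpha> \<epsilon> p\<^sub>f (main K)"
    unfolding solves_single_target_def
  proof (intro allI impI conjI ballI)
    fix g t and \<delta> :: real assume a: "valid_graph g \<and> t \<in> pverts (dgraph g) \<and> 0 < \<delta> \<and> \<delta> \<le> 1"
    then interpret ppr_instance g \<alpha> \<epsilon> p\<^sub>f \<delta> t K using inst by blast
    show "halt_prob g (main K) (input_mem \<alpha> \<epsilon> p\<^sub>f \<delta> t) (\<lambda>_. True) = 1" by (rule halts_almost_surely)
    show "halt_prob g (main K) (input_mem \<alpha> \<epsilon> p\<^sub>f \<delta> t) (\<lambda>st. \<bar>estimate st s - ppr \<alpha> (dgraph g) s t\<bar>
                    \<ge> \<epsilon> * max (ppr \<alpha> (dgraph g) s t) \<delta>) \<le> p\<^sub>f" if "s \<in> pverts (dgraph g)" for s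
      using halt_prob_bad_le[OF that] by (simp add: bad_def)
  qed
  have time: "target_time \<alpha> \<epsilon> p\<^sub>f (main K) \<delta> g t \<le>
      ennreal (A * (1 + real J) * (1 + (\<Sum>j<J. phase_work g \<alpha> K \<delta> t j)))"
    if "valid_graph g" "t \<in> pverts (dgraph g)" "0 < \<delta>" "\<delta> \<le> 1" "\<rho> ^ J < \<epsilon> * \<delta>" for g t \<delta> J
    using ppr_instance.target_time_le_phase_work[OF inst[OF that(1-4)]] that(5) by (simp add: \<rho>_def A_def)
  have gr: "valid_graph g" "card (pverts (dgraph g)) = n" "card (parcs (dgraph g)) = m" "1 \<le> n" "n \<le> m"
    if "g \<in> graphs n m" for g n m
    using that walk_graph.card_V_pos[OF wg, of g] walk_graph.card_V_le_arcs[OF wg, of g]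
    by (auto simp: graphs_def)
  have worst: "target_time \<alpha> \<epsilon> p\<^sub>f (main K) \<delta> g t \<le>
      ennreal (A * 2 * real K * C\<^sub>J\<^sup>2 * polylog 2 n \<delta> * min (real m) (real n / \<delta>))"
    if \<delta>: "0 < \<delta>" "\<delta> \<le> 1" and g: "g \<in> graphs n m" and t: "t \<in> pverts (dgraph g)" for n m \<delta> g t
  proof -
    note g' = gr[OF g]
    obtain J where J: "\<rho> ^ J < \<epsilon> * \<delta>" "(1 + real J)\<^sup>2 \<le> C\<^sub>J\<^sup>2 * polylog 2 n \<delta>" using phases[OF \<delta> g'(4)] by blast
    let ?Q = "min (real m) (real n / \<delta>)"
    have n\<delta>: "1 \<le> real n / \<delta>" using \<delta> g' by (simp add: field_simps)
    \<comment> \<open>The additive constants are absorbed because the claimed bound is at least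
      1.\<close>
    then have Q: "1 \<le> ?Q" using g' by auto
    have "(\<Sum>j<J. phase_work g \<alpha> K \<delta> t j) \<le> (\<Sum>j<J. 2 * real K * ?Q)"
      using phase_work_le_worst[OF wg[OF g'(1)] \<delta> K1] g' by (intro sum_mono) simp
    moreover have "1 \<le> 2 * real K * ?Q" using K1 Q by (intro one_le_mult) auto
    ultimately have "1 + (\<Sum>j<J. phase_work g \<alpha> K \<delta> t j) \<le> (1 + real J) * (2 * real K * ?Q)"
      by (simp add: distrib_right)
    then have "A * (1 + real J) * (1 + (\<Sum>j<J. phase_work g \<alpha> K \<delta> t j)) \<le>
        A * (1 + real J) * ((1 + real J) * (2 * real K * ?Q))"
      using A by (intro mult_left_mono) auto
    also have "\<dots> = A * 2 * real K * (1 + real J)\<^sup>2 * ?Q" by (simp add: power2_eq_square)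
    also have "\<dots> \<le> A * 2 * real K * (C\<^sub>J\<^sup>2 * polylog 2 n \<delta>) * ?Q"
      using A J(2) Q by (intro mult_right_mono mult_left_mono) auto
    finally have "A * (1 + real J) * (1 + (\<Sum>j<J. phase_work g \<alpha> K \<delta> t j)) \<le>
        A * 2 * real K * C\<^sub>J\<^sup>2 * polylog 2 n \<delta> * ?Q" by (simp only: mult.assoc)
    then show ?thesis using time[OF g'(1) t \<delta> J(1)] by (meson ennreal_leI order_trans)
  qed
  define c where "c = 1 + sqrt (2 * real K * (1 + 1 / \<epsilon>) / (\<alpha> * \<alpha>)) + 2 / (\<alpha> * \<alpha> * \<epsilon>)"
  have c: "1 \<le> c" using assms by (simp add: c_def)
  have average: "average_case_time \<alpha> \<epsilon> p\<^sub>f (main K) \<delta> n m \<le> ennreal (A * c * C\<^sub>J\<^sup>2 * polylog 2 n \<delta> *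
                  min (real m) (min (sqrt (real m / \<delta>)) (real m / real n / \<delta>)))"
    if \<delta>: "0 < \<delta>" "\<delta> \<le> 1" for n m \<delta>
    unfolding average_case_time_def
  \<comment> \<open>If there is no graph of these sizes, the supremum is 0 and nothing remains to be
    shown.\<close>
  proof (rule SUP_least)
    fix g assume g: "g \<in> graphs n m"
    note g' = gr[OF g]
    interpret walk_graph g \<alpha> by (rule wg[OF g'(1)])
    obtain J where J: "\<rho> ^ J < \<epsilon> * \<delta>" "\<forall>j<J. \<epsilon> * \<delta> \<le> \<rho> ^ j" "(1 + real J)\<^sup>2 \<le> C\<^sub>J\<^sup>2 * polylog 2 n \<delta>"
      using phases[OF \<delta> g'(4)] by blast
    let ?Q = "min (real m) (min (sqrt (real m / \<delta>)) (real m / real n / \<delta>))"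
    have n0: "0 < real n" using g' by simp
    have "1 \<le> real m / \<delta>" using \<delta> g' by (simp add: field_simps)
    \<comment> \<open>Every node has an out-neighbour, so \<open>n \<le> m\<close>; this keeps
      \<open>d / \<delta>\<close> at least 1, large enough to absorb additive constants.\<close>
    moreover have "\<delta> * real n \<le> 1 * real m" using \<delta> g' by (intro mult_mono) auto
    then have "1 \<le> real m / real n / \<delta>" using \<delta> n0 by (simp add: field_simps)
    ultimately have Q: "1 \<le> ?Q" using g' by auto
    define W where "W t = (\<Sum>j<J. phase_work g \<alpha> K \<delta> t j)" for t
    have W0: "0 \<le> W t" for t
      unfolding W_def phase_work_def using push_work_nonneg alpha \<delta> by (intro sum_nonneg) auto
    have "(\<Sum>t\<in>V. target_time \<alpha> \<epsilon> p\<^sub>f (main K) \<delta> g t) \<le> (\<Sum>t\<in>V. ennreal (A * (1 + real J) * (1 + W t)))"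
      unfolding W_def using time[OF g'(1) _ \<delta> J(1)] by (intro sum_mono) auto
    also have "\<dots> = ennreal (\<Sum>t\<in>V. A * (1 + real J) * (1 + W t))"
      using A W0 by (intro sum_ennreal) auto
    finally have "(\<Sum>t\<in>V. target_time \<alpha> \<epsilon> p\<^sub>f (main K) \<delta> g t) / of_nat n \<le>
        ennreal (\<Sum>t\<in>V. A * (1 + real J) * (1 + W t)) / ennreal (real n)"
      by (simp add: divide_right_mono_ennreal ennreal_of_nat_eq_real_of_nat)
    also have "\<dots> = ennreal ((\<Sum>t\<in>V. A * (1 + real J) * (1 + W t)) / real n)"
      using A W0 n0 by (intro divide_ennreal sum_nonneg) auto
    also have "(\<Sum>t\<in>V. A * (1 + real J) * (1 + W t)) / real n = A * (1 + real J) * (1 + (\<Sum>t\<in>V. W t) / real n)"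
      using n0 g'(2) by (simp add: sum.distrib field_simps flip: sum_distrib_left)
    also have "(\<Sum>t\<in>V. W t) / real n = (\<Sum>j<J. (\<Sum>t\<in>V. phase_work g \<alpha> K \<delta> t j) / real n)"
      unfolding W_def by (subst sum.swap) (simp add: sum_divide_distrib)
    also have "A * (1 + real J) * (1 + (\<Sum>j<J. (\<Sum>t\<in>V. phase_work g \<alpha> K \<delta> t j) / real n)) \<le>
        A * c * C\<^sub>J\<^sup>2 * polylog 2 n \<delta> * ?Q"
    proof -
      have "(\<Sum>j<J. (\<Sum>t\<in>V. phase_work g \<alpha> K \<delta> t j) / real n) \<le> (\<Sum>j<J. c * ?Q)"
      proof (rule sum_mono)
        fix j assume "j \<in> {..<J}"
        then have "\<epsilon> * \<delta> \<le> (1 - \<alpha> / 2) ^ j" using J(2) by (simp add: \<rho>_def)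
        from sum_phase_work_le[OF wg[OF g'(1)] assms(3,4) \<delta> K1 this _ _ c_def, of "real n" "real m"] g'
        show "(\<Sum>t\<in>V. phase_work g \<alpha> K \<delta> t j) / real n \<le> c * ?Q" by simp
      qed
      moreover have "1 \<le> c * ?Q" by (rule one_le_mult[OF c Q])
      ultimately have "1 + (\<Sum>j<J. (\<Sum>t\<in>V. phase_work g \<alpha> K \<delta> t j) / real n) \<le> (1 + real J) * (c * ?Q)"
        by (simp add: distrib_right)
      then have "A * (1 + real J) * (1 + (\<Sum>j<J. (\<Sum>t\<in>V. phase_work g \<alpha> K \<delta> t j) / real n)) \<le>
          A * (1 + real J) * ((1 + real J) * (c * ?Q))"
        using A by (intro mult_left_mono) auto
      also have "\<dots> = A * c * (1 + real J)\<^sup>2 * ?Q" by (simp add: power2_eq_square)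
      also have "\<dots> \<le> A * c * (C\<^sub>J\<^sup>2 * polylog 2 n \<delta>) * ?Q"
        using A J(3) Q c by (intro mult_right_mono mult_left_mono) auto
      finally show ?thesis by (simp only: mult.assoc)
    qed
    finally show "(\<Sum>t\<in>V. target_time \<alpha> \<epsilon> p\<^sub>f (main K) \<delta> g t) / of_nat n \<le> ennreal (A * c * C\<^sub>J\<^sup>2 * polylog 2 n \<delta> * ?Q)"
      by (simp add: ennreal_leI)
  qed
  have first: "\<exists>C k. \<forall>n m \<delta>. 0 < \<delta> \<and> \<delta> \<le> 1 \<longrightarrow>
       (\<forall>g\<in>graphs n m. \<forall>t\<in>pverts (dgraph g).
          target_time \<alpha> \<epsilon> p\<^sub>f (main K) \<delta> g t
            \<le> ennreal (C * polylog k n \<delta> * min (real m) (real n / \<delta>)))"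
    using worst by (intro exI[of _ "A * 2 * real K * C\<^sub>J\<^sup>2"] exI[of _ 2]) blast
  have second: "\<exists>C k. \<forall>n m \<delta>. 0 < \<delta> \<and> \<delta> \<le> 1 \<longrightarrow>
       (let d = real m / real n in
          average_case_time \<alpha> \<epsilon> p\<^sub>f (main K) \<delta> n m
            \<le> ennreal (C * polylog k n \<delta> *
                  min (real m) (min (sqrt (real m / \<delta>)) (d / \<delta>))))"
    unfolding Let_def using average by (intro exI[of _ "A * c * C\<^sub>J\<^sup>2"] exI[of _ 2]) blast
  from solves first second show ?thesis by blast
qed

end
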